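(* Let $\mathsf P_1,\dots,\mathsf P_r$ be indecomposable polytopes in parallelogramic position. Then $\mathsf P_1+\dots+\mathsf P_r$ is edge decomposable, and therefore uniquely decomposable. The deformation cone of $\mathsf P_1+\dots+\mathsf P_r$ is simplicial of dimension $r$, and its rays are associated to the polytopes $\mathsf P_1,\dots,\mathsf P_r$. In particular every deformation of $\mathsf P_1+\dots+\mathsf P_r$ is of the form $\alpha_1\mathsf P_1+\dots+\alpha_r\mathsf P_r$ with $\alpha_i\ge0$, and this decomposition is unique up to translation (with the condition that the summands are not normally equivalent).
   Context: All polytopes are in $\mathbb R^d$ and sums are Minkowski sums. A polytope $\mathsf R$ is a deformation of a polytope $\mathsf P$ if $\mathsf P=\lambda\mathsf R+\mathsf R'$ for some $\lambda>0$ and some polytope $\mathsf R'$. Then each vertex $p$ of $\mathsf P$ has an associated vertex $q(p)$ of $\mathsf R$ (every linear functional maximized on $\mathsf P$ exactly at $p$ is maximized on $\mathsf R$ exactly at $q(p)$), and for every edge $e=pp'$ of $\mathsf P$ there is $\lambda_e\ge0$ with $q(p)-q(p')=\lambda_e(p-p')$. The vector $(\lambda_e)_e\in\mathbb R_{\ge0}^{E(\mathsf P)}$, where $E(\mathsf P)$ is the set of edges of $\mathsf P$, is the edge-deformation vector of $\mathsf R$ and determines $\mathsf R$ up to translation; deformations are considered up to translation. The deformation cone $\mathbb{DC}(\mathsf P)$ is the cone of edge-deformation vectors of all deformations of $\mathsf P$; the ray associated to a deformation is the one spanned by its edge-deformation vector. $\mathsf P$ is indecomposable if its only deformations are of the form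 $\lambda\mathsf P+t$ with $\lambda\ge0$ and $t\in\mathbb R^d$; it is uniquely decomposable if $\mathbb{DC}(\mathsf P)$ is simplicial. A set $X\subseteq E(\mathsf P)$ is dependent if $\lambda_e=\lambda_f$ for all $e,f\in X$ and all $\lambda\in\mathbb{DC}(\mathsf P)$, and contractible if the characteristic vector of $E(\mathsf P)\setminus X$ (equivalently of $X$) is in $\mathbb{DC}(\mathsf P)$. $\mathsf P$ is edge decomposable if $E(\mathsf P)$ can be partitioned into non-empty contractible dependent sets. Two polytopes are normally equivalent if they have the same normal fan. Parallelogramic position: a vector $v$ is $2$-generic with respect to $\mathsf P$ if it is not parallel to any $2$-face of $\mathsf P$, i.e. there do not exist two edges $xy$ and $ab$ in a common $2$-face of $\mathsf P$ with $v=\alpha(y-x)+\beta(b-a)$ for some $\alpha,\beta\in\mathbb R$. Two polytopes $\mathsf P,\mathsf Q$ are in parallelogramic position if every edge direction of $\mathsf P$ is $2$-generic with respect to $\mathsf Q$ and every edge direction of $\mathsf Q$ is $2$-generic with respect to $\mathsf P$. A collection $\mathsf P_1,\dots,\mathsf P_r$ is in parallelogramic position if for every $1\le i\le r$ the polytopes $\mathsf P_i$ and $\sum_{j\ne i}\mathsf P_j$ are in parallelogramic position.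
   Formalization: Added assumptions: no P_i is a point (or empty), and for r ≥ 2 the sum has dimension at least 2. A point spans no ray, and parallel segments are vacuously in parallelogramic position though their sum has a 1-dimensional deformation cone, so the claim fails in these cases. *)

theory Defs
  imports "HOL-Analysis.Analysis" "HOL-Library.Function_Algebras"
begin

section \<open>Real-valued functions as a real vector space\<close>

instantiation "fun" :: (type, real_vector) real_vector
begin

definition scaleR_fun :: "real \<Rightarrow> ('a \<Rightarrow> 'b) \<Rightarrow> 'a \<Rightarrow> 'b" where
  "scaleR_fun c f = (\<lambda>x. c *\<^sub>R f x)"

instance
  by standard (simp_all add: scaleR_fun_def fun_eq_iff scaleR_add_right scaleR_add_left)

end

lemma scaleR_fun_apply [simp]: "(c *\<^sub>R f) x = c *\<^sub>R f x"
  by (simp add: scaleR_fun_def)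


section \<open>Deformations\<close>

text \<open>
  The sum of sets, also in indexed form, is the Minkowski sum of the library
  (empty sum: the origin), dilation is \<open>(*\<^sub>R) c ` P\<close> and translation is \<open>(+) t ` P\<close>.
\<close>

definition deformation :: "'a::euclidean_space set \<Rightarrow> 'a set \<Rightarrow> bool" where
  "deformation R P \<longleftrightarrow> polytope R \<and>
     (\<exists>l>0. \<exists>R'. polytope R' \<and> P = (*\<^sub>R) l ` R + R')"

definition indecomposable :: "'a::euclidean_space set \<Rightarrow> bool" where
  "indecomposable P \<longleftrightarrow>
     (\<forall>R. deformation R P \<longrightarrow> (\<exists>l\<ge>0. \<exists>t. R = (+) t ` (*\<^sub>R) l ` P))"

definition edges :: "'a::euclidean_space set \<Rightarrow> 'a set set" where
  "edges P = {e. e edge_of P}"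

definition max_face :: "'a::euclidean_space \<Rightarrow> 'a set \<Rightarrow> 'a set" where
  "max_face c P = {x \<in> P. \<forall>y\<in>P. c \<bullet> y \<le> c \<bullet> x}"

text \<open>
  The vertex \<open>q(p)\<close> of \<open>R\<close> associated to a vertex \<open>p\<close> of \<open>P\<close>. It is uniquely determined when
  \<open>R\<close> is a deformation of the nonempty polytope \<open>P\<close>, as are the edge-deformation coefficients below.
\<close>

definition assoc_vertex :: "'a::euclidean_space set \<Rightarrow> 'a set \<Rightarrow> 'a \<Rightarrow> 'a" where
  "assoc_vertex P R p =
     (THE q. q extreme_point_of R \<and> (\<forall>c. max_face c P = {p} \<longrightarrow> max_face c R = {q}))"

text \<open>
  Vectors in \<open>\<real>\<close>-to-the-\<open>edges P\<close> are functions on all sets that vanish outside \<open>edges P\<close>.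
\<close>

definition edge_deformation_vector ::
    "'a::euclidean_space set \<Rightarrow> 'a set \<Rightarrow> 'a set \<Rightarrow> real" where
  "edge_deformation_vector P R = (\<lambda>e.
     if e \<in> edges P then
       (THE l. 0 \<le> l \<and> (\<forall>p p'. e = closed_segment p p' \<longrightarrow>
          assoc_vertex P R p - assoc_vertex P R p' = l *\<^sub>R (p - p')))
     else 0)"

definition deformation_cone :: "'a::euclidean_space set \<Rightarrow> ('a set \<Rightarrow> real) set" where
  "deformation_cone P = {edge_deformation_vector P R | R. deformation R P}"

definition deformation_ray :: "'a::euclidean_space set \<Rightarrow> 'a set \<Rightarrow> ('a set \<Rightarrow> real) set" where
  "deformation_ray P R = conic hull {edge_deformation_vector P R}"


section \<open>Cones\<close>

definition simplicial_cone :: "'b::real_vector set \<Rightarrow> bool" where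
  "simplicial_cone C \<longleftrightarrow>
     (\<exists>B. finite B \<and> independent B \<and>
        C = {(\<Sum>b\<in>B. a b *\<^sub>R b) | a. \<forall>b\<in>B. 0 \<le> a b})"

definition rays :: "'b::real_vector set \<Rightarrow> 'b set set" where
  "rays C = {\<rho>. \<rho> face_of C \<and> (\<exists>v. v \<noteq> 0 \<and> \<rho> = conic hull {v})}"


section \<open>Edge decomposability\<close>

definition uniquely_decomposable :: "'a::euclidean_space set \<Rightarrow> bool" where
  "uniquely_decomposable P \<longleftrightarrow> simplicial_cone (deformation_cone P)"

definition dependent_edges :: "'a::euclidean_space set \<Rightarrow> 'a set set \<Rightarrow> bool" where
  "dependent_edges P X \<longleftrightarrow> X \<subseteq> edges P \<and>
     (\<forall>l\<in>deformation_cone P. \<forall>e\<in>X. \<forall>f\<in>X. l e = l f)"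

definition contractible_edges :: "'a::euclidean_space set \<Rightarrow> 'a set set \<Rightarrow> bool" where
  "contractible_edges P X \<longleftrightarrow> X \<subseteq> edges P \<and>
     indicat_real (edges P - X) \<in> deformation_cone P"

definition edge_decomposable :: "'a::euclidean_space set \<Rightarrow> bool" where
  "edge_decomposable P \<longleftrightarrow>
     (\<exists>\<X>. partition_on (edges P) \<X> \<and>
        (\<forall>X\<in>\<X>. contractible_edges P X \<and> dependent_edges P X))"


section \<open>Normal equivalence\<close>

definition normal_cone :: "'a::euclidean_space set \<Rightarrow> 'a set \<Rightarrow> 'a set" where
  "normal_cone P F = {c. \<forall>x\<in>F. \<forall>y\<in>P. c \<bullet> y \<le> c \<bullet> x}"

definition normal_fan :: "'a::euclidean_space set \<Rightarrow> 'a set set" where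
  "normal_fan P = {normal_cone P F | F. F face_of P \<and> F \<noteq> {}}"

definition normally_equivalent :: "'a::euclidean_space set \<Rightarrow> 'a set \<Rightarrow> bool" where
  "normally_equivalent P Q \<longleftrightarrow> normal_fan P = normal_fan Q"

text \<open>
  \<open>R\<close> is, up to translation, the Minkowski sum of the indecomposable polytopes \<open>Q j\<close> for \<open>j \<in> J\<close>,
  none of which is a point and no two of which are normally equivalent.
\<close>

definition indecomposable_decomposition ::
    "nat set \<Rightarrow> (nat \<Rightarrow> 'a::euclidean_space set) \<Rightarrow> 'a set \<Rightarrow> bool" where
  "indecomposable_decomposition J Q R \<longleftrightarrow> finite J \<and>
     (\<forall>j\<in>J. polytope (Q j) \<and> 1 \<le> aff_dim (Q j) \<and> indecomposable (Q j)) \<and>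
     pairwise (\<lambda>j k. \<not> normally_equivalent (Q j) (Q k)) J \<and>
     (\<exists>t. R = (+) t ` (\<Sum>j\<in>J. Q j))"


section \<open>Parallelogramic position\<close>

definition two_generic :: "'a::euclidean_space \<Rightarrow> 'a set \<Rightarrow> bool" where
  "two_generic v P \<longleftrightarrow>
     \<not> (\<exists>F x y a b \<alpha> \<beta>. F face_of P \<and> aff_dim F = 2 \<and>
          closed_segment x y \<in> edges P \<and> closed_segment x y \<subseteq> F \<and>
          closed_segment a b \<in> edges P \<and> closed_segment a b \<subseteq> F \<and>
          v = \<alpha> *\<^sub>R (y - x) + \<beta> *\<^sub>R (b - a))"

definition parallelogramic_pair :: "'a::euclidean_space set \<Rightarrow> 'a set \<Rightarrow> bool" where
  "parallelogramic_pair P Q \<longleftrightarrow>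
     (\<forall>x y. closed_segment x y \<in> edges P \<longrightarrow> two_generic (y - x) Q) \<and>
     (\<forall>x y. closed_segment x y \<in> edges Q \<longrightarrow> two_generic (y - x) P)"

definition parallelogramic_position :: "nat set \<Rightarrow> (nat \<Rightarrow> 'a::euclidean_space set) \<Rightarrow> bool" where
  "parallelogramic_position I P \<longleftrightarrow>
     (\<forall>i\<in>I. parallelogramic_pair (P i) (\<Sum>j\<in>I - {i}. P j))"

end

theory Submission
  imports Defs
begin

text \<open>
  Let \<open>S\<close> be the sum of the \<open>P i\<close>, and \<open>Q i\<close> the sum of the others, so that \<open>S = P i + Q i\<close>. Parallelogramic
  position means that every edge of \<open>S\<close> is a translate of an edge of exactly one \<open>P i\<close>, and that every 2-face of
  \<open>S\<close> is a translate of a 2-face of \<open>P i\<close> or of \<open>Q i\<close>, or a parallelogram. Given a deformation \<open>R\<close> of \<open>S\<close> and an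
  edge \<open>e\<close> of \<open>P i\<close>, the translates of \<open>e\<close> among the edges of \<open>S\<close> are linked by parallelograms, so they have a common
  coefficient. The 2-faces of \<open>P i\<close> survive in \<open>S\<close>, hence these coefficients satisfy the cycle conditions of the
  2-faces of \<open>P i\<close> and define a deformation of \<open>P i\<close>. As \<open>P i\<close> is indecomposable, the coefficient is a constant
  \<open>\<alpha> i\<close> over all edges of \<open>P i\<close>. Since the vertices of \<open>S\<close> are connected by edges, \<open>R\<close> is a translate of the
  sum of the \<open>\<alpha> i\<close>-dilates of the \<open>P i\<close>, and everything else is linear algebra.
\<close>

section \<open>Exposed faces\<close>

text \<open>Faces are handled through the functionals that expose them, because
  \<open>max_face c\<close> is additive over Minkowski sums: the functional itself tells which faces
  of the summands are being added. A face of a face is reached by perturbing \<open>c\<close> to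
  \<open>c + \<epsilon> *\<^sub>R d\<close>, and one small \<epsilon> serves several polytopes at
  once.

  Two steps are hard. Translates of an edge of \<open>P i\<close> sit at many vertices of
  \<open>Q i\<close>, and it is not evident how parallelograms link them; the functionals exposing
  the edge form a convex, hence connected, set, and the coefficient is followed along it. Then
  coefficients that close up around 2-faces have to be integrated to a map on the vertices of
  \<open>P i\<close>. In place of simple connectivity of the 2-skeleton, a sweep by a generic
  functional is used, which needs only that vertex figures are connected above a hyperplane.

  The bound on the dimension of the sum excludes families of parallel segments: they have no 2-faces
  and so are in parallelogramic position vacuously, but their sum is again a segment.\<close>

lemma max_face_subset: "max_face c P \<subseteq> P"
  by (auto simp: max_face_def)

lemma max_face_inner_eq: "x \<in> max_face c P \<Longrightarrow> y \<in> max_face c P \<Longrightarrow> c \<bullet> x = c \<bullet> y"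
  unfolding max_face_def by (auto intro: antisym)

lemma max_face_inner_le: "x \<in> max_face c P \<Longrightarrow> y \<in> P \<Longrightarrow> c \<bullet> y \<le> c \<bullet> x"
  unfolding max_face_def by auto

lemma max_face_inner_less:
  "x \<in> max_face c P \<Longrightarrow> y \<in> P \<Longrightarrow> y \<notin> max_face c P \<Longrightarrow> c \<bullet> y < c \<bullet> x"
  unfolding max_face_def by force

lemma max_face_face_of: "convex P \<Longrightarrow> max_face c P face_of P"
proof (cases "max_face c P = {}")
  case False
  assume "convex P"
  from False obtain m where m: "m \<in> max_face c P" by auto
  then have "max_face c P = P \<inter> {x. c \<bullet> x = c \<bullet> m}"
    unfolding max_face_def by force
  moreover have "P \<inter> {x. c \<bullet> x = c \<bullet> m} face_of P"
    using \<open>convex P\<close> m by (intro face_of_Int_supporting_hyperplane_le) (auto simp: max_face_def)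
  ultimately show ?thesis by simp
qed auto

lemma max_face_nonempty:
  assumes "polytope P" "P \<noteq> {}"
  shows "max_face c P \<noteq> {}"
proof -
  have "\<exists>x\<in>P. \<forall>y\<in>P. c \<bullet> y \<le> c \<bullet> x"
    using assms polytope_imp_compact
    by (intro continuous_attains_sup continuous_intros) auto
  then show ?thesis unfolding max_face_def by auto
qed

lemma polytope_max_face: "polytope P \<Longrightarrow> polytope (max_face c P)"
  by (meson face_of_polytope_polytope max_face_face_of polytope_imp_convex)

lemma face_of_polytope_max_face:
  assumes "polytope P" "F face_of P" "F \<noteq> {}"
  obtains c where "F = max_face c P"
proof -
  have "F exposed_face_of P"
    using assms exposed_face_of_polyhedron polytope_imp_polyhedron by blast
  then obtain a b where ab: "P \<subseteq> {x. a \<bullet> x \<le> b}" "F = P \<inter> {x. a \<bullet> x = b}"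
    unfolding exposed_face_of_def by auto
  have "F = max_face a P"
    using ab \<open>F \<noteq> {}\<close> unfolding max_face_def by force
  then show ?thesis using that by blast
qed

lemma max_face_set_plus: "max_face c (A + B) = max_face c A + max_face c B"
proof
  show "max_face c (A + B) \<subseteq> max_face c A + max_face c B"
  proof
    fix x assume x: "x \<in> max_face c (A + B)"
    then obtain a b where ab: "a \<in> A" "b \<in> B" "x = a + b"
      using max_face_subset by (metis set_plus_elim subsetD)
    have "c \<bullet> y \<le> c \<bullet> a" if "y \<in> A" for y
      using max_face_inner_le [OF x set_plus_intro [OF that ab(2)]] ab(3) by (simp add: inner_add_right)
    moreover have "c \<bullet> y \<le> c \<bullet> b" if "y \<in> B" for y
      using max_face_inner_le [OF x set_plus_intro [OF ab(1) that]] ab(3) by (simp add: inner_add_right)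
    ultimately show "x \<in> max_face c A + max_face c B"
      using ab unfolding max_face_def by auto
  qed
  show "max_face c A + max_face c B \<subseteq> max_face c (A + B)"
    unfolding max_face_def by (auto simp: set_plus_def inner_add_right intro!: add_mono)
qed

lemma max_face_0 [simp]: "max_face c 0 = 0"
  by (auto simp: max_face_def)

lemma max_face_sum: "max_face c (\<Sum>i\<in>I. A i) = (\<Sum>i\<in>I. max_face c (A i))"
  by (induction I rule: infinite_finite_induct) (simp_all add: max_face_set_plus del: set_zero)

lemma max_face_scaleR:
  assumes "0 < l"
  shows "max_face c ((*\<^sub>R) l ` A) = (*\<^sub>R) l ` max_face c A"
  using assms by (auto simp: max_face_def)

lemma max_face_scaleR_nonneg:
  assumes "0 \<le> l" "polytope A"
  shows "max_face c ((*\<^sub>R) l ` A) = (*\<^sub>R) l ` max_face c A"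
proof (cases "l = 0 \<and> A \<noteq> {}")
  case True
  then show ?thesis using max_face_nonempty [OF assms(2), of c]
    by (auto simp: max_face_def)
next
  case False
  then show ?thesis using assms max_face_scaleR[of l c A] by (auto simp: max_face_def)
qed

lemma max_face_translation: "max_face c ((+) t ` A) = (+) t ` max_face c A"
  by (auto simp: max_face_def inner_add_right)

lemma max_face_singleton: "max_face c {x} = {x}"
  by (auto simp: max_face_def)

section \<open>Faces exposed by nearby functionals\<close>

lemma max_face_within:
  assumes "max_face c P \<subseteq> M" "M \<subseteq> P" "max_face c P \<noteq> {}"
  shows "max_face c P = max_face c M"
proof
  show "max_face c P \<subseteq> max_face c M" using assms by (auto simp: max_face_def)
  show "max_face c M \<subseteq> max_face c P"
  proof
    fix x assume x: "x \<in> max_face c M"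
    obtain y where y: "y \<in> max_face c P" using assms(3) by blast
    then have "c \<bullet> y \<le> c \<bullet> x" using x assms(1) by (auto simp: max_face_def)
    then show "x \<in> max_face c P" using x y assms(2) by (fastforce simp: max_face_def)
  qed
qed

lemma max_face_singleton_extreme:
  assumes "convex P" "max_face c P = {p}"
  shows "p extreme_point_of P"
  using max_face_face_of [OF assms(1), of c] assms(2) face_of_singleton by metis

lemma extreme_point_max_face:
  assumes "polytope P" "p extreme_point_of P"
  obtains c where "max_face c P = {p}"
  using face_of_polytope_max_face [of P "{p}"] assms face_of_singleton [of p P] by (metis insert_not_empty)

lemma polytope_extreme_hull:
  fixes P :: "'a::euclidean_space set"
  assumes "polytope P"
  shows "finite {x. x extreme_point_of P}" "P = convex hull {x. x extreme_point_of P}"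
  using finite_polyhedron_extreme_points[OF polytope_imp_polyhedron[OF assms]]
    Krein_Milman_Minkowski[OF polytope_imp_compact[OF assms] polytope_imp_convex[OF assms]] by simp_all

lemma polytope_extreme_exists:
  fixes P :: "'a::euclidean_space set"
  assumes "polytope P" "P \<noteq> {}"
  obtains p where "p extreme_point_of P"
  using polytope_extreme_hull(2) [OF assms(1)] assms(2) by (metis Collect_empty_eq convex_hull_empty)

lemma extreme_point_of_max_face:
  "convex P \<Longrightarrow> v extreme_point_of max_face c P \<longleftrightarrow> v extreme_point_of P \<and> v \<in> max_face c P"
  using extreme_point_of_face max_face_face_of by blast

lemma max_face_extreme_exists:
  assumes "polytope P" "P \<noteq> {}"
  obtains p where "p extreme_point_of P" "p \<in> max_face c P"
  using polytope_extreme_exists [OF polytope_max_face max_face_nonempty] assms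
    extreme_point_of_max_face polytope_imp_convex by metis

text \<open>Upper semicontinuity of the exposed face: finitely many vertices lie off
  \<open>max_face c P\<close>, each strictly below it, and strict inequalities persist for nearby
  functionals.\<close>

lemma eventually_max_face_subset:
  assumes "polytope P"
  shows "\<forall>\<^sub>F c' in nhds c. max_face c' P \<subseteq> max_face c P"
proof (cases "P = {}")
  case False
  then obtain m where m: "m \<in> max_face c P" using max_face_nonempty assms by blast
  let ?V = "{x. x extreme_point_of P}"
  let ?W = "?V - max_face c P"
  have fin: "finite ?W" using polytope_extreme_hull [OF assms] by auto
  have "\<forall>\<^sub>F c' in nhds c. c' \<bullet> v < c' \<bullet> m" if "v \<in> ?W" for v
  proof -
    have "c \<bullet> v < c \<bullet> m"
      using that m max_face_inner_less extreme_point_of_def by blast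
    moreover have "((\<lambda>c'. c' \<bullet> m - c' \<bullet> v) \<longlongrightarrow> c \<bullet> m - c \<bullet> v) (nhds c)"
      by (intro tendsto_intros filterlim_ident)
    ultimately have "\<forall>\<^sub>F c' in nhds c. 0 < c' \<bullet> m - c' \<bullet> v"
      by (intro order_tendstoD(1)) auto
    then show ?thesis by eventually_elim simp
  qed
  then have "\<forall>\<^sub>F c' in nhds c. \<forall>v\<in>?W. c' \<bullet> v < c' \<bullet> m"
    using fin by (simp add: eventually_ball_finite)
  then show ?thesis
  proof eventually_elim
    case (elim c')
    have "{x. x extreme_point_of max_face c' P} \<subseteq> max_face c P"
    proof
      fix x assume "x \<in> {x. x extreme_point_of max_face c' P}"
      then have x: "x extreme_point_of P" "x \<in> max_face c' P"
        using extreme_point_of_max_face assms polytope_imp_convex by auto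
      show "x \<in> max_face c P"
      proof (rule ccontr)
        assume "x \<notin> max_face c P"
        then have "c' \<bullet> x < c' \<bullet> m" using elim x by auto
        then show False using max_face_inner_le[OF x(2), of m] m max_face_subset by fastforce
      qed
    qed
    then have "convex hull {x. x extreme_point_of max_face c' P} \<subseteq> max_face c P"
      using polytope_imp_convex[OF polytope_max_face[OF assms]] by (intro hull_minimal) auto
    then show ?case
      unfolding polytope_extreme_hull(2)[OF polytope_max_face[OF assms, of c'], symmetric] .
  qed
qed (auto simp: max_face_def)

text \<open>Lexicographic maximization: on the face of \<open>c\<close> the perturbed functional
  equals \<open>\<epsilon> *\<^sub>R d\<close> up to a constant. Stating it for all small \<epsilon>
  allows two polytopes to be perturbed simultaneously.\<close>

lemma eventually_max_face_perturb:
  assumes "polytope P"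
  shows "\<forall>\<^sub>F \<epsilon> in at_right 0. max_face (c + \<epsilon> *\<^sub>R d) P = max_face d (max_face c P)"
proof (cases "P = {}")
  case False
  have "((\<lambda>\<epsilon>. c + \<epsilon> *\<^sub>R d) \<longlongrightarrow> c + 0 *\<^sub>R d) (at_right 0)"
    by (intro tendsto_intros)
  then have "\<forall>\<^sub>F \<epsilon> in at_right 0. max_face (c + \<epsilon> *\<^sub>R d) P \<subseteq> max_face c P"
    using eventually_max_face_subset [OF assms, of c] by (auto simp: filterlim_iff)
  moreover have "\<forall>\<^sub>F \<epsilon>::real in at_right 0. \<epsilon> > 0" by (simp add: eventually_at_right_less)
  ultimately show ?thesis
  proof eventually_elim
    case (elim \<epsilon>)
    have "max_face (c + \<epsilon> *\<^sub>R d) P = max_face (c + \<epsilon> *\<^sub>R d) (max_face c P)"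
      by (rule max_face_within[OF elim(1) max_face_subset max_face_nonempty[OF assms False]])
    also have "\<dots> = max_face d (max_face c P)"
    proof -
      have "(c + \<epsilon> *\<^sub>R d) \<bullet> y \<le> (c + \<epsilon> *\<^sub>R d) \<bullet> x \<longleftrightarrow> d \<bullet> y \<le> d \<bullet> x"
        if "x \<in> max_face c P" "y \<in> max_face c P" for x y
        using max_face_inner_eq[OF that] elim by (simp add: inner_add_left)
      then show ?thesis by (auto simp: max_face_def[of _ "max_face c P"])
    qed
    finally show ?case .
  qed
qed (auto simp: max_face_def)

lemma max_face_orthogonal:
  assumes "\<And>x y. x \<in> F \<Longrightarrow> y \<in> F \<Longrightarrow> d \<bullet> x = d \<bullet> y"
  shows "max_face d F = F"
  using eq_refl[OF assms] by (auto simp: max_face_def)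

text \<open>
  Take \<open>c'\<close> with a face of \<open>Q\<close> of least dimension: a direction \<open>d\<close> violating the claim would be a perturbation of \<open>c'\<close>
  that keeps the face of \<open>P\<close> and shrinks that of \<open>Q\<close>.
\<close>

lemma generic_max_face:
  fixes P Q :: "'a::euclidean_space set"
  assumes P: "polytope P" and Q: "polytope Q" "Q \<noteq> {}"
  obtains c' where "max_face c' P = max_face c P" "max_face c' Q \<subseteq> max_face c Q"
    "\<And>d. \<forall>a\<in>max_face c P. \<forall>b\<in>max_face c P. d \<bullet> a = d \<bullet> b \<Longrightarrow>
        \<forall>x\<in>max_face c' Q. \<forall>y\<in>max_face c' Q. d \<bullet> x = d \<bullet> y"
proof -
  let ?ok = "\<lambda>c'. max_face c' P = max_face c P \<and> max_face c' Q \<subseteq> max_face c Q"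
  have "\<exists>c'. ?ok c' \<and> (\<forall>y. ?ok y \<longrightarrow> nat (aff_dim (max_face c' Q)) \<le> nat (aff_dim (max_face y Q)))"
    by (rule ex_has_least_nat[of ?ok c]) auto
  then obtain c' where c': "max_face c' P = max_face c P" "max_face c' Q \<subseteq> max_face c Q"
    and least: "\<And>y. ?ok y \<Longrightarrow> nat (aff_dim (max_face c' Q)) \<le> nat (aff_dim (max_face y Q))"
    by blast
  show thesis
  proof (rule that[OF c'])
    fix d
    assume d: "\<forall>a\<in>max_face c P. \<forall>b\<in>max_face c P. d \<bullet> a = d \<bullet> b"
    have "\<forall>\<^sub>F \<epsilon> in at_right 0. max_face (c' + \<epsilon> *\<^sub>R d) P = max_face d (max_face c' P) \<and>
        max_face (c' + \<epsilon> *\<^sub>R d) Q = max_face d (max_face c' Q)"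
      using eventually_max_face_perturb P Q by (intro eventually_conj) auto
    then obtain \<epsilon> where e: "max_face (c' + \<epsilon> *\<^sub>R d) P = max_face d (max_face c' P)"
        "max_face (c' + \<epsilon> *\<^sub>R d) Q = max_face d (max_face c' Q)"
      using eventually_happens'[OF trivial_limit_at_right_real] by blast
    have "max_face d (max_face c P) = max_face c P"
      using d by (intro max_face_orthogonal) blast
    then have "?ok (c' + \<epsilon> *\<^sub>R d)" using e c' max_face_subset by fastforce
    from least[OF this] have le: "nat (aff_dim (max_face c' Q)) \<le> nat (aff_dim (max_face d (max_face c' Q)))"
      using e by simp
    have ne: "max_face d (max_face c' Q) \<noteq> {}"
      using max_face_nonempty polytope_max_face Q by metis
    have eq: "max_face d (max_face c' Q) = max_face c' Q"
    proof (rule ccontr)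
      assume "max_face d (max_face c' Q) \<noteq> max_face c' Q"
      then have "aff_dim (max_face d (max_face c' Q)) < aff_dim (max_face c' Q)"
        using polytope_imp_convex[OF polytope_max_face[OF Q(1)]]
        by (intro face_of_aff_dim_lt max_face_face_of) auto
      moreover have "0 \<le> aff_dim (max_face d (max_face c' Q))"
        using ne aff_dim_negative_iff[of "max_face d (max_face c' Q)"] by linarith
      ultimately show False using le by linarith
    qed
    show "\<forall>x\<in>max_face c' Q. \<forall>y\<in>max_face c' Q. d \<bullet> x = d \<bullet> y"
    proof (intro ballI)
      fix x y assume "x \<in> max_face c' Q" "y \<in> max_face c' Q"
      then show "d \<bullet> x = d \<bullet> y" using max_face_inner_eq[of x d "max_face c' Q" y] eq by simp
    qed
  qed
qed

section \<open>Polytopes compared through their support functions\<close>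

lemma subset_by_max_face:
  assumes "\<And>c. \<exists>x\<in>max_face c A. \<exists>y\<in>B. c \<bullet> x \<le> c \<bullet> y"
    and B: "closed B" "convex B"
  shows "A \<subseteq> B"
proof (rule ccontr)
  assume "\<not> A \<subseteq> B"
  then obtain z where z: "z \<in> A" "z \<notin> B" by blast
  obtain a b where ab: "a \<bullet> z < b" "\<forall>x\<in>B. b < a \<bullet> x"
    using separating_hyperplane_closed_point[OF B(2,1) z(2)] by blast
  obtain x y where xy: "x \<in> max_face (-a) A" "y \<in> B" "(-a) \<bullet> x \<le> (-a) \<bullet> y" using assms by blast
  have "(-a) \<bullet> z \<le> (-a) \<bullet> x" using xy z max_face_inner_le by blast
  then show False using ab xy by (auto simp: inner_minus_left)
qed

text \<open>A closed convex set is determined by its support function, whose value at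
  \<open>c\<close> is attained at every point of \<open>max_face c\<close>; one pair of points of
  equal height for each \<open>c\<close> is therefore enough.\<close>

lemma eq_by_max_face:
  assumes "\<And>c. \<exists>x\<in>max_face c A. \<exists>y\<in>max_face c B. c \<bullet> x = c \<bullet> y"
    and "polytope A" "polytope B"
  shows "A = B"
proof
  have "\<exists>x\<in>max_face c A. \<exists>y\<in>B. c \<bullet> x \<le> c \<bullet> y" "\<exists>x\<in>max_face c B. \<exists>y\<in>A. c \<bullet> x \<le> c \<bullet> y" for c
    using assms(1)[of c] max_face_subset[of c A] max_face_subset[of c B]
    by (metis order_refl subsetD)+
  then show "A \<subseteq> B" "B \<subseteq> A"
    using assms(2,3)[THEN polytope_imp_closed] assms(2,3)[THEN polytope_imp_convex]
    by (meson subset_by_max_face)+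
qed

section \<open>Edges\<close>

text \<open>A smallest face containing \<open>F\<close> of dimension at least \<open>k\<close> has
  dimension exactly \<open>k\<close>, since otherwise one of its facets containing \<open>F\<close>
  would still qualify.\<close>

lemma face_chain:
  fixes P :: "'a::euclidean_space set"
  assumes P: "polytope P" and F: "F face_of P" "F \<noteq> {}" and k: "aff_dim F \<le> k" "k \<le> aff_dim P"
  obtains G where "G face_of P" "F \<subseteq> G" "aff_dim G = k"
proof -
  let ?ok = "\<lambda>G. G face_of P \<and> F \<subseteq> G \<and> k \<le> aff_dim G"
  have "?ok P" using assms by (auto simp: face_of_refl polytope_imp_convex face_of_imp_subset)
  then obtain G where G: "?ok G" and least: "\<And>H. ?ok H \<Longrightarrow> nat (aff_dim G) \<le> nat (aff_dim H)"
    using ex_has_least_nat[of ?ok P "\<lambda>G. nat (aff_dim G)"] by blast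
  have "aff_dim G = k"
  proof (rule ccontr)
    assume "aff_dim G \<noteq> k"
    then have lt: "k < aff_dim G" using G by auto
    have FG: "F face_of G" using F G by (meson face_of_face face_of_refl face_of_subset face_of_imp_subset)
    have "polyhedron G" using G P face_of_polytope_polytope polytope_imp_polyhedron by blast
    moreover have "F \<noteq> G" using lt k by auto
    ultimately obtain H where H: "H facet_of G" "F \<subseteq> H"
      using face_of_polyhedron_subset_facet FG F(2) by blast
    then have "?ok H" using G lt face_of_trans by (fastforce simp: facet_of_def)
    from least[OF this] H have "nat (aff_dim G) \<le> nat (aff_dim G - 1)" by (simp add: facet_of_def)
    moreover have "0 \<le> aff_dim F" using F(2) aff_dim_negative_iff[of F] by linarith
    ultimately show False using lt k(1) by linarith
  qed
  then show thesis using G that by blast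
qed

lemma aff_dim_closed_segment:
  fixes p :: "'a::euclidean_space"
  shows "aff_dim (closed_segment p q) = (if p = q then 0 else 1)"
  using aff_dim_simplex simplex_segment_cases by blast

lemma edge_of_segment:
  fixes P :: "'a::euclidean_space set"
  assumes "polytope P" "e edge_of P"
  obtains p q where "e = closed_segment p q" "p \<noteq> q"
proof -
  have e: "polytope e" "aff_dim e = 1"
    using assms face_of_polytope_polytope unfolding edge_of_def by blast+
  then have "e \<noteq> {}" "collinear e" using collinear_aff_dim[of e] by auto
  then obtain p q where "e = closed_segment p q"
    using compact_convex_collinear_segment e polytope_imp_compact polytope_imp_convex by metis
  then show thesis using e that by (auto simp: aff_dim_closed_segment split: if_splits)
qed

lemma edge_of_endpoints:
  fixes P :: "'a::euclidean_space set"
  assumes "closed_segment p q edge_of P"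
  shows "p \<noteq> q" "p extreme_point_of P" "q extreme_point_of P" "p \<in> P" "q \<in> P"
proof -
  have e: "closed_segment p q face_of P" "aff_dim (closed_segment p q) = 1"
    using assms unfolding edge_of_def by auto
  show "p \<noteq> q" using e by (auto simp: aff_dim_closed_segment)
  show "p extreme_point_of P" "q extreme_point_of P"
    using extreme_point_of_face[OF e(1)] extreme_point_of_segment by blast+
  then show "p \<in> P" "q \<in> P" by (auto simp: extreme_point_of_def)
qed

lemma edge_of_face: "F face_of P \<Longrightarrow> e edge_of F \<longleftrightarrow> e edge_of P \<and> e \<subseteq> F"
  using face_of_face unfolding edge_of_def by blast

lemma edge_of_max_face:
  "convex P \<Longrightarrow> e edge_of max_face c P \<longleftrightarrow> e edge_of P \<and> e \<subseteq> max_face c P"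
  using edge_of_face max_face_face_of by blast

lemma edge_at_vertex:
  fixes P :: "'a::euclidean_space set"
  assumes P: "polytope P" and p: "p extreme_point_of P" and ne: "P \<noteq> {p}"
  obtains q where "closed_segment p q edge_of P"
proof -
  have "p \<in> P" using p by (simp add: extreme_point_of_def)
  then have "\<not> aff_dim P < 0" "aff_dim P \<noteq> 0"
    using ne aff_dim_negative_iff[of P] aff_dim_eq_0[of P] by auto
  then have "1 \<le> aff_dim P" by linarith
  then obtain G where G: "G face_of P" "{p} \<subseteq> G" "aff_dim G = 1"
    using face_chain[OF P, of "{p}" 1] p face_of_singleton[of p P] by auto
  then have e: "G edge_of P" by (simp add: edge_of_def)
  then obtain a b where ab: "G = closed_segment a b" using edge_of_segment P by blast
  have "p extreme_point_of G" using extreme_point_of_face[OF G(1)] p G(2) by auto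
  then have "p = a \<or> p = b" using ab extreme_point_of_segment by blast
  then show thesis using that e ab closed_segment_commute by metis
qed

text \<open>Any maximizer of the ratio below spans, with \<open>p\<close>, a face on which \<open>c\<close> is minimal exactly at \<open>p\<close>.\<close>

lemma improving_edge:
  fixes P :: "'a::euclidean_space set"
  assumes P: "polytope P" and p: "p extreme_point_of P" and x: "x \<in> P" "c \<bullet> p < c \<bullet> x"
  obtains q where "closed_segment p q edge_of P" "c \<bullet> p < c \<bullet> q"
proof -
  obtain c0 where c0: "max_face c0 P = {p}" using extreme_point_max_face P p by blast
  define V where "V = {x. x extreme_point_of P} - {p}"
  define \<rho> where "\<rho> v = c \<bullet> (v - p) / (c0 \<bullet> (p - v))" for v
  define r where "r = Max (\<rho> ` V)"
  have finV: "finite V" unfolding V_def using polytope_extreme_hull[OF P] by simp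
  have pos: "0 < c0 \<bullet> (p - v)" if "v \<in> P" "v \<noteq> p" for v
    using max_face_inner_less[of p c0 P v] c0 that by (auto simp: inner_diff_right)
  obtain m where m: "m extreme_point_of P" "m \<in> max_face c P" using max_face_extreme_exists P x by blast
  then have cm: "c \<bullet> p < c \<bullet> m" using x max_face_inner_le[OF m(2) x(1)] by linarith
  have mV: "m \<in> V" using m cm unfolding V_def by auto
  have VP: "V \<subseteq> P" unfolding V_def extreme_point_of_def by auto
  have "0 < \<rho> m" using cm pos[of m] mV VP unfolding \<rho>_def V_def by (auto simp: inner_diff_right)
  also have "\<rho> m \<le> r" unfolding r_def using finV mV by auto
  finally have r: "0 < r" .
  \<comment> \<open>\<open>r\<close> is the least multiple of \<open>c0\<close> that, added to
    \<open>c\<close>, makes \<open>p\<close> a maximizer; besides \<open>p\<close>, exactly the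
    vertices of ratio \<open>r\<close> share the maximum.\<close>
  define c' where "c' = c + r *\<^sub>R c0"
  have c': "c' \<bullet> (v - p) = (c0 \<bullet> (p - v)) * (\<rho> v - r)" if "v \<in> V" for v
    using pos[of v] that VP unfolding c'_def \<rho>_def V_def
    by (auto simp: field_simps inner_diff_right inner_add_left)
  have le: "c' \<bullet> v \<le> c' \<bullet> p" if "v \<in> V" for v
  proof -
    have "\<rho> v \<le> r" unfolding r_def using finV that by auto
    moreover have "0 < c0 \<bullet> (p - v)" using pos[of v] that VP unfolding V_def by auto
    ultimately have "c' \<bullet> (v - p) \<le> 0"
      unfolding c'[OF that] by (intro mult_nonneg_nonpos) auto
    then show ?thesis by (simp add: inner_diff_right)
  qed
  let ?F = "max_face c' P"
  have pF: "p \<in> ?F"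
  proof -
    obtain n where n: "n extreme_point_of P" "n \<in> ?F" using max_face_extreme_exists P x by blast
    then have "c' \<bullet> n \<le> c' \<bullet> p" using le[of n] unfolding V_def by (cases "n = p") auto
    then show ?thesis using n(2) p unfolding max_face_def extreme_point_of_def by force
  qed
  have "r \<in> \<rho> ` V" unfolding r_def using finV mV by (intro Max_in) auto
  then obtain v where v: "v \<in> V" "\<rho> v = r" by auto
  then have "c' \<bullet> v = c' \<bullet> p" using c'[OF v(1)] by (simp add: inner_diff_right)
  then have "v \<in> ?F" using pF v VP by (auto simp: max_face_def)
  then have "?F \<noteq> {p}" using v unfolding V_def by auto
  then obtain q where q: "closed_segment p q edge_of ?F"
    using edge_at_vertex[OF polytope_max_face[OF P], of p c'] p pF
      extreme_point_of_max_face[OF polytope_imp_convex[OF P], of p c'] by blast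
  then have qF: "q \<in> ?F" "q \<noteq> p" using edge_of_endpoints by blast+
  then have "c' \<bullet> q = c' \<bullet> p" using pF max_face_inner_eq by blast
  \<comment> \<open>Along an edge of this face \<open>c'\<close> is constant, so \<open>c\<close>
    gains \<open>r\<close> times what \<open>c0\<close> loses, and \<open>c0\<close> is maximal only
    at \<open>p\<close>.\<close>
  then have "c \<bullet> (q - p) = r * (c0 \<bullet> (p - q))"
    unfolding c'_def by (simp add: inner_add_left inner_diff_right algebra_simps)
  moreover have "0 < c0 \<bullet> (p - q)" using pos qF max_face_subset by blast
  ultimately have "0 < c \<bullet> (q - p)" using r mult_pos_pos[of r "c0 \<bullet> (p - q)"] by simp
  then have "c \<bullet> p < c \<bullet> q" by (simp add: inner_diff_right)
  then show thesis using that q edge_of_max_face polytope_imp_convex[OF P] by blast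
qed

section \<open>Walks in the edge graph\<close>

lemma climb_to_max_face:
  fixes P :: "'a::euclidean_space set"
  assumes P: "polytope P" and x: "x extreme_point_of P" "I x"
    and step: "\<And>y z. closed_segment y z edge_of P \<Longrightarrow> c \<bullet> y < c \<bullet> z \<Longrightarrow> I y \<Longrightarrow> I z"
  shows "\<exists>z. z extreme_point_of P \<and> z \<in> max_face c P \<and> I z"
  using x
\<comment> \<open>The simplex method carrying an invariant \<open>I\<close>: an improving edge
  leaves fewer vertices strictly above the current one.\<close>
proof (induction "card {v. v extreme_point_of P \<and> c \<bullet> x < c \<bullet> v}" arbitrary: x rule: less_induct)
  case less
  show ?case
  proof (cases "x \<in> max_face c P")
    case False
    then obtain w where "w \<in> P" "c \<bullet> x < c \<bullet> w"
      using less.prems(1) unfolding max_face_def extreme_point_of_def by force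
    then obtain y where y: "closed_segment x y edge_of P" "c \<bullet> x < c \<bullet> y"
      using improving_edge P less.prems(1) by blast
    have yP: "y extreme_point_of P" using y edge_of_endpoints by blast
    have "finite {v. v extreme_point_of P \<and> c \<bullet> x < c \<bullet> v}"
      using polytope_extreme_hull[OF P] by simp
    then have "card {v. v extreme_point_of P \<and> c \<bullet> y < c \<bullet> v} < card {v. v extreme_point_of P \<and> c \<bullet> x < c \<bullet> v}"
      using y(2) yP by (intro psubset_card_mono) auto
    then show ?thesis using less.hyps yP step[OF y less.prems(2)] by blast
  qed (use less.prems in blast)
qed

text \<open>The part of the edge graph strictly above a hyperplane is connected: climb from both
  vertices to the top face of \<open>c\<close>, then walk inside that face, which lies entirely
  above the level. Connectivity is expressed through functions \<open>f\<close> that are constant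
  along edges.\<close>

lemma connected_above:
  fixes P :: "'a::euclidean_space set"
  assumes P: "polytope P" and x: "x extreme_point_of P" "a < c \<bullet> x" and y: "y extreme_point_of P" "a < c \<bullet> y"
    and edge: "\<And>y z. closed_segment y z edge_of P \<Longrightarrow> a < c \<bullet> y \<Longrightarrow> a < c \<bullet> z \<Longrightarrow> f y = f z"
  shows "f x = f y"
proof -
  let ?M = "max_face c P"
  note conv = polytope_imp_convex[OF P]
  have M: "polytope ?M" by (simp add: P polytope_max_face)
  have *: "\<exists>z. z extreme_point_of ?M \<and> a < c \<bullet> z \<and> f z = f x" if "x extreme_point_of P" "a < c \<bullet> x" for x
    using climb_to_max_face[OF P that(1), of "\<lambda>z. a < c \<bullet> z \<and> f z = f x" c] that(2) edge
      extreme_point_of_max_face[OF conv] less_trans by metis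
  obtain x' where x': "x' extreme_point_of ?M" "a < c \<bullet> x'" "f x' = f x" using * x by blast
  obtain y' where y': "y' extreme_point_of ?M" "a < c \<bullet> y'" "f y' = f y" using * y by blast
  \<comment> \<open>Maximizing \<open>d\<close> inside the top face forces the walk to end at
    \<open>y'\<close>.\<close>
  obtain d where d: "max_face d ?M = {y'}" using extreme_point_max_face[OF M y'(1)] by blast
  have "f z = f z'" if "closed_segment z z' edge_of ?M" for z z'
  proof (rule edge)
    show "closed_segment z z' edge_of P" using that edge_of_max_face conv by blast
    have "z \<in> ?M" "z' \<in> ?M" "y' \<in> ?M" using that y'(1) edge_of_endpoints by (auto simp: extreme_point_of_def)
    then show "a < c \<bullet> z" "a < c \<bullet> z'" using y'(2) max_face_inner_eq by metis+
  qed
  then have "\<exists>z. z extreme_point_of ?M \<and> z \<in> max_face d ?M \<and> f z = f x'"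
    by (intro climb_to_max_face[OF M x'(1)]) auto
  then have "f y' = f x'" using d by auto
  then show ?thesis using x' y' by simp
qed

lemma connected_vertices:
  fixes P :: "'a::euclidean_space set"
  assumes "polytope P" "x extreme_point_of P" "y extreme_point_of P"
    and "\<And>y z. closed_segment y z edge_of P \<Longrightarrow> f y = f z"
  shows "f x = f y"
  \<comment> \<open>For the zero functional and level -1 the height condition always holds.\<close>
  using connected_above[of P x "-1" 0 y f] assms by auto

text \<open>Otherwise some edge at the vertex \<open>b\<close> would improve \<open>d\<close> or
  \<open>- d\<close>.\<close>

lemma orthogonal_edges_imp_constant:
  fixes P :: "'a::euclidean_space set"
  assumes P: "polytope P" and d: "\<And>x y. closed_segment x y edge_of P \<Longrightarrow> d \<bullet> x = d \<bullet> y"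
    and "x \<in> P" "y \<in> P"
  shows "d \<bullet> x = d \<bullet> y"
proof -
  obtain b where b: "b extreme_point_of P" using polytope_extreme_exists P assms(3) by blast
  have "d \<bullet> a = d \<bullet> b" if "a \<in> P" for a
  proof (rule ccontr)
    assume "d \<bullet> a \<noteq> d \<bullet> b"
    then consider "d \<bullet> b < d \<bullet> a" | "(- d) \<bullet> b < (- d) \<bullet> a" by fastforce
    then show False
    proof cases
      case 1
      then show False using improving_edge[OF P b that 1] d by (metis order_less_irrefl)
    next
      case 2
      then show False using improving_edge[OF P b that 2] d by (metis inner_minus_left order_less_irrefl)
    qed
  qed
  then show ?thesis using assms(3,4) by simp
qed

section \<open>Deformations and maps on vertices\<close>

lemma max_face_convex_hull:
  assumes "m \<in> W" "\<And>w. w \<in> W \<Longrightarrow> c \<bullet> w \<le> c \<bullet> m"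
  shows "m \<in> max_face c (convex hull W)"
proof -
  have "convex hull W \<subseteq> {x. c \<bullet> x \<le> c \<bullet> m}"
    using assms by (intro hull_minimal) (auto simp: convex_halfspace_le)
  then show ?thesis using assms(1) hull_inc[of m W convex] by (auto simp: max_face_def)
qed

text \<open>Along an edge \<open>u\<close> moves in the same direction as the vertex, so a walk
  climbing in \<open>c\<close> never lowers the height of \<open>u\<close>; on the top face the
  edges are orthogonal to \<open>c\<close> and this height is constant.\<close>

lemma vertex_map_monotone:
  fixes P :: "'a::euclidean_space set"
  assumes P: "polytope P"
    and u: "\<And>x y. closed_segment x y edge_of P \<Longrightarrow> \<exists>l\<ge>0. u x - u y = l *\<^sub>R (x - y)"
    and p: "p extreme_point_of P" "p \<in> max_face c P" and v: "v extreme_point_of P"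
  shows "c \<bullet> u v \<le> c \<bullet> u p"
proof -
  note conv = polytope_imp_convex[OF P]
  have *: "\<exists>l\<ge>0. c \<bullet> u x - c \<bullet> u y = l * (c \<bullet> x - c \<bullet> y)" if "closed_segment x y edge_of P" for x y
    using u[OF that] by (metis inner_diff_right inner_scaleR_right)
  have step: "c \<bullet> u y \<le> c \<bullet> u z" if "closed_segment y z edge_of P" "c \<bullet> y < c \<bullet> z" for y z
  proof -
    obtain l where "l \<ge> 0" "c \<bullet> u y - c \<bullet> u z = l * (c \<bullet> y - c \<bullet> z)" using * \<open>closed_segment y z edge_of P\<close> by blast
    moreover have "l * (c \<bullet> y - c \<bullet> z) \<le> 0" using that \<open>l \<ge> 0\<close> by (intro mult_nonneg_nonpos) auto
    ultimately show ?thesis by linarith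
  qed
  have "\<exists>z. z extreme_point_of P \<and> z \<in> max_face c P \<and> c \<bullet> u v \<le> c \<bullet> u z"
    using climb_to_max_face[OF P v, of "\<lambda>z. c \<bullet> u v \<le> c \<bullet> u z" c] step order_trans by blast
  then obtain z where z: "z extreme_point_of max_face c P" "c \<bullet> u v \<le> c \<bullet> u z"
    using extreme_point_of_max_face[OF conv] by blast
  have "c \<bullet> u x = c \<bullet> u y" if "closed_segment x y edge_of max_face c P" for x y
  proof -
    have "closed_segment x y edge_of P" using that edge_of_max_face conv by blast
    moreover have "c \<bullet> x = c \<bullet> y" using that edge_of_endpoints max_face_inner_eq by blast
    ultimately show ?thesis using *[of x y] by auto
  qed
  then have "c \<bullet> u z = c \<bullet> u p"
    using connected_vertices[OF polytope_max_face[OF P] z(1), of p "\<lambda>x. c \<bullet> u x"]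
      extreme_point_of_max_face[OF conv] p by blast
  then show ?thesis using z by simp
qed

lemma vertex_map_max_face:
  fixes P :: "'a::euclidean_space set"
  assumes P: "polytope P"
    and u: "\<And>x y. closed_segment x y edge_of P \<Longrightarrow> \<exists>l\<ge>0. u x - u y = l *\<^sub>R (x - y)"
    and p: "p extreme_point_of P" "p \<in> max_face c P"
  shows "u p \<in> max_face c (convex hull (u ` {x. x extreme_point_of P}))"
  using p vertex_map_monotone[OF P u p] by (intro max_face_convex_hull) auto

lemma polytope_set_plus: "polytope A \<Longrightarrow> polytope B \<Longrightarrow> polytope (A + B)"
  unfolding polytope_def by (metis convex_hull_set_plus finite_set_plus)

lemma polytope_sum: "(\<And>i. i \<in> I \<Longrightarrow> polytope (A i)) \<Longrightarrow> polytope (\<Sum>i\<in>I. A i)"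
  by (induction I rule: infinite_finite_induct)
     (simp_all add: polytope_set_plus set_zero polytope_sing)

text \<open>If \<open>M\<close> bounds the edge coefficients of \<open>u\<close>, the complementary
  map \<open>M *\<^sub>R x - u x\<close> has the nonnegative coefficients \<open>M - l\<close>, and
  its hull is the missing summand: the two maps add up to the dilation by \<open>M\<close>, hence so
  do the support functions of their hulls.\<close>

lemma vertex_map_deformation:
  fixes P :: "'a::euclidean_space set"
  assumes P: "polytope P"
    and u: "\<And>x y. closed_segment x y edge_of P \<Longrightarrow> \<exists>l\<ge>0. u x - u y = l *\<^sub>R (x - y)"
  shows "deformation (convex hull (u ` {x. x extreme_point_of P})) P"
proof -
  let ?V = "{x. x extreme_point_of P}"
  have fin: "finite ?V" using polytope_extreme_hull[OF P] by simp
  have "\<exists>M. \<forall>x y. closed_segment x y edge_of P \<longrightarrow> u x - u y = l x y *\<^sub>R (x - y) \<longrightarrow> l x y \<le> M" for l :: "_ \<Rightarrow> _ \<Rightarrow> real"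
  proof -
    have "finite ((\<lambda>(x, y). l x y) ` (?V \<times> ?V))" using fin by simp
    then have "bdd_above ((\<lambda>(x, y). l x y) ` (?V \<times> ?V))" by (rule bdd_above_finite)
    then obtain M where M: "\<And>t. t \<in> (\<lambda>(x, y). l x y) ` (?V \<times> ?V) \<Longrightarrow> t \<le> M"
      unfolding bdd_above_def by blast
    have "l x y \<le> M" if "closed_segment x y edge_of P" for x y
      using edge_of_endpoints(2,3)[OF that] by (intro M image_eqI[of _ _ "(x, y)"]) auto
    then show ?thesis by blast
  qed
  moreover obtain l where l: "\<And>x y. closed_segment x y edge_of P \<Longrightarrow> 0 \<le> l x y \<and> u x - u y = l x y *\<^sub>R (x - y)"
    using u by metis
  ultimately obtain M0 where M0: "\<And>x y. closed_segment x y edge_of P \<Longrightarrow> l x y \<le> M0" by blast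
  \<comment> \<open>The maximum with 1 keeps \<open>M\<close> positive even when all coefficients
    vanish or there are no edges.\<close>
  define M where "M = max M0 1"
  have M: "0 < M" and lM: "\<And>x y. closed_segment x y edge_of P \<Longrightarrow> l x y \<le> M"
    using M0 unfolding M_def by (auto simp: le_max_iff_disj)
  define u' where "u' x = M *\<^sub>R x - u x" for x
  have u': "\<exists>l\<ge>0. u' x - u' y = l *\<^sub>R (x - y)" if "closed_segment x y edge_of P" for x y
    using l[OF that] lM[OF that] unfolding u'_def
    by (intro exI[of _ "M - l x y"]) (simp add: algebra_simps)
  let ?R = "convex hull (u ` ?V)" and ?R' = "convex hull (u' ` ?V)"
  have pR: "polytope ?R" "polytope ?R'" using fin by (auto intro!: polytope_convex_hull)
  have "P = (*\<^sub>R) (1/M) ` ?R + (*\<^sub>R) (1/M) ` ?R'"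
  proof (cases "P = {}")
    case True
    then show ?thesis by (auto simp: set_plus_def)
  next
    case False
    show ?thesis
    proof (rule eq_by_max_face)
      fix c
      obtain p where p: "p extreme_point_of P" "p \<in> max_face c P" using max_face_extreme_exists P False by blast
      have 1: "u p \<in> max_face c ?R" by (rule vertex_map_max_face[OF P u p])
      have 2: "u' p \<in> max_face c ?R'" by (rule vertex_map_max_face[OF P u' p])
      have "(1/M) *\<^sub>R u p + (1/M) *\<^sub>R u' p = p"
        using M unfolding u'_def by (simp add: algebra_simps)
      then have "p \<in> max_face c ((*\<^sub>R) (1/M) ` ?R + (*\<^sub>R) (1/M) ` ?R')"
        using 1 2 M unfolding max_face_set_plus by (metis divide_pos_pos imageI max_face_scaleR set_plus_intro zero_less_one)
      then show "\<exists>x\<in>max_face c P. \<exists>y\<in>max_face c ((*\<^sub>R) (1/M) ` ?R + (*\<^sub>R) (1/M) ` ?R'). c \<bullet> x = c \<bullet> y"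
        using p by blast
    qed (use P pR in \<open>auto intro!: polytope_set_plus polytope_scaling\<close>)
  qed
  then show ?thesis unfolding deformation_def
    using pR M polytope_scaling[OF pR(2)] by (meson divide_pos_pos zero_less_one)
qed

text \<open>\<open>q\<close> sends a vertex of \<open>S\<close> to its part in \<open>R\<close>,
  which is unique by extremality. The first property is stated for every functional maximal at
  \<open>p\<close>, not only for those exposing \<open>p\<close> alone, so that support functions
  can be compared later.\<close>

lemma deformation_vertex_map:
  fixes S :: "'a::euclidean_space set"
  assumes S: "polytope S" "S \<noteq> {}" and R: "deformation R S"
  obtains q where
    "\<And>c p. p extreme_point_of S \<Longrightarrow> p \<in> max_face c S \<Longrightarrow> q p \<in> max_face c R"
    "\<And>c p. max_face c S = {p} \<Longrightarrow> max_face c R = {q p}"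
    "\<And>p p'. closed_segment p p' edge_of S \<Longrightarrow> \<exists>l\<ge>0. q p - q p' = l *\<^sub>R (p - p')"
proof -
  obtain l R' where l: "0 < l" and pol: "polytope R" "polytope R'" and eq: "S = (*\<^sub>R) l ` R + R'"
    using R unfolding deformation_def by blast
  have unique: "x = x'" if p: "p extreme_point_of S" and x: "x \<in> R" "y \<in> R'" "p = l *\<^sub>R x + y"
    and x': "x' \<in> R" "y' \<in> R'" "p = l *\<^sub>R x' + y'" for p x y x' y'
  proof -
    \<comment> \<open>Exchanging the parts of two representations of \<open>p\<close> gives two
      points of \<open>S\<close> with midpoint \<open>p\<close>; they coincide because
      \<open>p\<close> is extreme.\<close>
    have in1: "l *\<^sub>R x + y' \<in> S" and in2: "l *\<^sub>R x' + y \<in> S" unfolding eq using x x' by auto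
    have mid: "p = midpoint (l *\<^sub>R x + y') (l *\<^sub>R x' + y)"
    proof -
      have "2 *\<^sub>R p = (l *\<^sub>R x + y) + (l *\<^sub>R x' + y')"
        unfolding x(3)[symmetric] x'(3)[symmetric] by (simp add: scaleR_2)
      then have "2 *\<^sub>R p = (l *\<^sub>R x + y') + (l *\<^sub>R x' + y)"
        by (simp add: algebra_simps)
      then show ?thesis unfolding midpoint_def by (metis inverse_eq_divide scaleR_half_double scaleR_2 scaleR_left_commute scaleR_right_distrib)
    qed
    have e: "l *\<^sub>R x + y' = l *\<^sub>R x' + y"
    proof (rule ccontr)
      assume "l *\<^sub>R x + y' \<noteq> l *\<^sub>R x' + y"
      then have "p \<in> open_segment (l *\<^sub>R x + y') (l *\<^sub>R x' + y)" using mid by simp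
      then show False using p in1 in2 unfolding extreme_point_of_def by blast
    qed
    have "l *\<^sub>R x + y = l *\<^sub>R x' + y'" using x(3) x'(3) by simp
    with e have "(l *\<^sub>R x + y') + (l *\<^sub>R x + y) = (l *\<^sub>R x' + y) + (l *\<^sub>R x' + y')"
      by (simp only:)
    then have "l *\<^sub>R x + l *\<^sub>R x = l *\<^sub>R x' + l *\<^sub>R x'"
      by (simp add: algebra_simps)
    then have "2 *\<^sub>R (l *\<^sub>R x) = 2 *\<^sub>R (l *\<^sub>R x')"
      by (simp only: scaleR_2)
    then show ?thesis using l by simp
  qed
  define q where "q p = (THE x. x \<in> R \<and> (\<exists>y\<in>R'. p = l *\<^sub>R x + y))" for p
  have q: "q p = x" if "p extreme_point_of S" "x \<in> R" "y \<in> R'" "p = l *\<^sub>R x + y" for p x y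
    unfolding q_def using unique[OF that(1)] that by (intro the_equality) blast+
  have mf: "\<exists>y\<in>max_face c R'. q p \<in> max_face c R \<and> p = l *\<^sub>R q p + y"
    if p: "p extreme_point_of S" "p \<in> max_face c S" for p c
  proof -
    obtain x y where "x \<in> max_face c R" "y \<in> max_face c R'" "p = l *\<^sub>R x + y"
      using p(2) l unfolding eq max_face_set_plus max_face_scaleR[OF l] by (auto elim!: set_plus_elim)
    then show ?thesis using q[OF p(1), of x y] max_face_subset by (metis subsetD)
  qed
  have ne: "R \<noteq> {}" "R' \<noteq> {}" using S eq by auto
  have single: "max_face c R = {q p}" if m: "max_face c S = {p}" for c p
  proof -
    have p: "p extreme_point_of S" using max_face_singleton_extreme[OF polytope_imp_convex[OF S(1)] that] .
    obtain y where y: "y \<in> max_face c R'" "q p \<in> max_face c R" "p = l *\<^sub>R q p + y"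
      using mf[OF p, of c] m by blast
    have "x = q p" if x: "x \<in> max_face c R" for x
    proof -
      have "l *\<^sub>R x + y \<in> max_face c S"
        unfolding eq max_face_set_plus max_face_scaleR[OF l] using x y by blast
      then have "l *\<^sub>R x + y = p" using m by blast
      then have "l *\<^sub>R x + y = l *\<^sub>R q p + y" by (rule trans[OF _ y(3)])
      then show ?thesis using l by simp
    qed
    then show ?thesis using y(2) by blast
  qed
  have edge: "\<exists>k\<ge>0. q p - q p' = k *\<^sub>R (p - p')" if e: "closed_segment p p' edge_of S" for p p'
  proof -
    have ext: "p extreme_point_of S" "p' extreme_point_of S" "p \<noteq> p'" using e edge_of_endpoints by blast+
    have "closed_segment p p' \<noteq> {}" by simp
    then obtain c where c: "closed_segment p p' = max_face c S"
      using face_of_polytope_max_face[OF S(1)] e unfolding edge_of_def by blast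
    obtain y where y: "y \<in> max_face c R'" "q p \<in> max_face c R" "p = l *\<^sub>R q p + y"
      using mf[OF ext(1), of c] c by auto
    obtain y' where y': "y' \<in> max_face c R'" "q p' \<in> max_face c R" "p' = l *\<^sub>R q p' + y'"
      using mf[OF ext(2), of c] c by auto
    \<comment> \<open>The part of \<open>p'\<close> in \<open>R\<close> combined with the part of
      \<open>p\<close> in \<open>R'\<close> stays on the exposed edge, so the two parts in
      \<open>R\<close> differ by a multiple of the edge direction.\<close>
    have "l *\<^sub>R q p' + y \<in> closed_segment p p'"
      unfolding c unfolding eq max_face_set_plus max_face_scaleR[OF l] using y(1) y'(2) by blast
    then obtain t where t: "l *\<^sub>R q p' + y = (1 - t) *\<^sub>R p + t *\<^sub>R p'" by (auto simp: in_segment)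
    have "l *\<^sub>R (q p - q p') = (l *\<^sub>R q p + y) - (l *\<^sub>R q p' + y)" by (simp add: algebra_simps)
    also have "\<dots> = p - ((1 - t) *\<^sub>R p + t *\<^sub>R p')" unfolding t y(3)[symmetric] ..
    finally have "l *\<^sub>R (q p - q p') = t *\<^sub>R (p - p')" by (simp add: algebra_simps)
    then have "(1/l) *\<^sub>R (l *\<^sub>R (q p - q p')) = (1/l) *\<^sub>R (t *\<^sub>R (p - p'))" by simp
    then have k: "q p - q p' = (t/l) *\<^sub>R (p - p')" using l by simp
    \<comment> \<open>The sign of the coefficient is read off with a functional exposing
      \<open>p\<close>, since it also exposes \<open>q p\<close>.\<close>
    obtain d where d: "max_face d S = {p}" using extreme_point_max_face S(1) ext(1) by blast
    have "d \<bullet> p' < d \<bullet> p" using d ext max_face_inner_less[of p d S p'] by (auto simp: extreme_point_of_def)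
    moreover have "d \<bullet> q p' \<le> d \<bullet> q p"
      using single[OF d] y'(2) max_face_inner_le[of "q p" d R "q p'"] max_face_subset by blast
    moreover have "d \<bullet> q p - d \<bullet> q p' = (t/l) * (d \<bullet> p - d \<bullet> p')"
      using arg_cong[OF k, of "\<lambda>x. d \<bullet> x"] by (simp add: inner_diff_right)
    ultimately have "0 \<le> (t/l) * (d \<bullet> p - d \<bullet> p')" "0 < d \<bullet> p - d \<bullet> p'" by linarith+
    then have "0 \<le> t/l" by (simp only: zero_le_mult_iff) linarith
    then show ?thesis using k by blast
  qed
  show thesis using that[of q] mf single edge by blast
qed

section \<open>Vertex figures\<close>

text \<open>
  The vertex figure at \<open>p\<close> is realized as the convex hull of the normalized vectors
  \<open>(v - p) / (c0 \<bullet> (p - v))\<close>, where \<open>c0\<close> exposes \<open>p\<close>.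
\<close>

lemma vertex_figure_face:
  fixes P :: "'a::euclidean_space set"
  assumes P: "polytope P" and c0: "max_face c0 P = {p}"
    and V: "V = {x. x extreme_point_of P} - {p}"
    and y: "\<And>v. y v = (1 / (c0 \<bullet> (p - v))) *\<^sub>R (v - p)"
    and ne: "V \<noteq> {}"
  obtains F where "F face_of P" "p \<in> F" "\<And>v. v \<in> V \<Longrightarrow> v \<in> F \<longleftrightarrow> y v \<in> max_face c (convex hull (y ` V))"
    "\<And>T. finite T \<Longrightarrow> max_face c (convex hull (y ` V)) \<subseteq> convex hull T \<Longrightarrow> aff_dim F \<le> int (card T)"
proof -
  let ?K = "convex hull (y ` V)"
  have finV: "finite V" unfolding V using polytope_extreme_hull[OF P] by simp
  have VP: "V \<subseteq> P" unfolding V extreme_point_of_def by auto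
  have pP: "p \<in> P" using c0 max_face_subset[of c0 P] by auto
  have pos: "0 < c0 \<bullet> (p - v)" if "v \<in> V" for v
    using max_face_inner_less[of p c0 P v] c0 that VP V by (auto simp: inner_diff_right)
  have K: "polytope ?K" "?K \<noteq> {}" using finV ne by (auto intro: polytope_convex_hull)
  then obtain k where k: "k \<in> max_face c ?K" using max_face_nonempty by blast
  define r where "r = c \<bullet> k"
  \<comment> \<open>On \<open>v - p\<close> the functional \<open>c'\<close> is zero if
    \<open>y v\<close> lies on the exposed face of the figure and negative for the other vertices
    \<open>v\<close>, so that face becomes a face of \<open>P\<close> through
    \<open>p\<close>.\<close>
  define c' where "c' = c + r *\<^sub>R c0"
  have c': "c' \<bullet> (v - p) = (c0 \<bullet> (p - v)) * (c \<bullet> y v - r)" if "v \<in> V" for v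
  proof -
    have "c0 \<bullet> (v - p) = - (c0 \<bullet> (p - v))" by (simp add: inner_diff_right)
    moreover have "c \<bullet> (v - p) = (c0 \<bullet> (p - v)) * (c \<bullet> y v)" using pos[OF that] unfolding y by simp
    ultimately show ?thesis unfolding c'_def by (simp add: inner_add_left algebra_simps)
  qed
  have yK: "y v \<in> ?K" if "v \<in> V" for v using that by (simp add: hull_inc)
  have yle: "c \<bullet> y v \<le> r" if "v \<in> V" for v unfolding r_def using max_face_inner_le[OF k yK[OF that]] .
  have le: "c' \<bullet> v \<le> c' \<bullet> p" if "v \<in> V" for v
  proof -
    have "c' \<bullet> (v - p) \<le> 0"
      unfolding c'[OF that] using pos[OF that] yle[OF that] by (intro mult_nonneg_nonpos) auto
    then show ?thesis by (simp add: inner_diff_right)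
  qed
  let ?F = "max_face c' P"
  have pF: "p \<in> ?F"
  proof -
    obtain n where n: "n extreme_point_of P" "n \<in> ?F" using max_face_extreme_exists P pP by blast
    then have "c' \<bullet> n \<le> c' \<bullet> p" using le[of n] unfolding V by (cases "n = p") auto
    then show ?thesis using n(2) pP unfolding max_face_def by force
  qed
  have iff: "v \<in> ?F \<longleftrightarrow> y v \<in> max_face c ?K" if v: "v \<in> V" for v
  proof -
    have "v \<in> ?F \<longleftrightarrow> c' \<bullet> v = c' \<bullet> p"
      using v VP pF le[OF v] max_face_inner_eq[OF _ pF, of v] unfolding max_face_def by auto
    also have "\<dots> \<longleftrightarrow> c' \<bullet> (v - p) = 0" by (simp add: inner_diff_right)
    also have "\<dots> \<longleftrightarrow> c \<bullet> y v = r" unfolding c'[OF v] using pos[OF v] by simp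
    also have "\<dots> \<longleftrightarrow> y v \<in> max_face c ?K"
      using max_face_inner_eq[OF _ k, of "y v"] k yK[OF v] unfolding r_def max_face_def by auto
    finally show ?thesis .
  qed
  have dim: "aff_dim ?F \<le> int (card T)"
    if T: "finite T" "max_face c ?K \<subseteq> convex hull T" for T
  proof -
    \<comment> \<open>Each vertex \<open>v\<close> other than \<open>p\<close> of the face lies on
      the line through \<open>p\<close> and \<open>p + y v\<close>, so points whose hull contains
      the face of the figure span, together with \<open>p\<close>, the face of
      \<open>P\<close>.\<close>
    let ?A = "affine hull (insert p ((+) p ` T))"
    have "{x. x extreme_point_of ?F} \<subseteq> ?A"
    proof
      fix v assume "v \<in> {x. x extreme_point_of ?F}"
      then have v: "v extreme_point_of P" "v \<in> ?F"
        using extreme_point_of_max_face[OF polytope_imp_convex[OF P]] by auto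
      show "v \<in> ?A"
      proof (cases "v = p")
        case False
        then have vV: "v \<in> V" using v V by auto
        then have "y v \<in> affine hull T"
          using iff v T(2) convex_hull_subset_affine_hull[of T] by blast
        then have "p + y v \<in> affine hull ((+) p ` T)" by (simp add: affine_hull_translation)
        also have "\<dots> \<subseteq> ?A" by (intro hull_mono) auto
        finally have "p + y v \<in> ?A" .
        moreover have "p \<in> ?A" by (simp add: hull_inc)
        ultimately have "(1 - c0 \<bullet> (p - v)) *\<^sub>R p + (c0 \<bullet> (p - v)) *\<^sub>R (p + y v) \<in> ?A"
          by (intro mem_affine affine_affine_hull) auto
        moreover have "(1 - c0 \<bullet> (p - v)) *\<^sub>R p + (c0 \<bullet> (p - v)) *\<^sub>R (p + y v) = v"
          using pos[OF vV] unfolding y by (simp add: scaleR_add_right scaleR_left_diff_distrib)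
        ultimately show ?thesis by simp
      qed (simp add: hull_inc)
    qed
    then have "convex hull {x. x extreme_point_of ?F} \<subseteq> ?A"
      by (intro hull_minimal) (auto simp: affine_imp_convex)
    then have "?F \<subseteq> ?A" using polytope_extreme_hull(2)[OF polytope_max_face[OF P, of c']] by simp
    then have "aff_dim ?F \<le> aff_dim (insert p ((+) p ` T))"
      using aff_dim_subset[of ?F ?A] by (simp add: aff_dim_affine_hull)
    also have "\<dots> \<le> int (card (insert p ((+) p ` T))) - 1"
      using T(1) by (intro aff_dim_le_card) auto
    also have "\<dots> \<le> int (card T)"
      using card_insert_le_m1[of "card T + 1" "(+) p ` T" p] card_image_le[OF T(1), of "(+) p"] by simp
    finally show ?thesis .
  qed
  show thesis
    using that[OF max_face_face_of[OF polytope_imp_convex[OF P], of c'] pF iff dim] by blast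
qed

text \<open>In the vertex figure, edges at \<open>p\<close> become vertices, 2-faces at
  \<open>p\<close> become edges, and increase along \<open>s\<close> becomes positivity of
  \<open>s\<close>: the claim is \<open>connected_above\<close> for the figure at level 0. Only
  2-faces lying above \<open>p\<close> are needed in \<open>loc\<close>, which is what a downward
  sweep can provide.\<close>

lemma edges_at_vertex_connected:
  fixes P :: "'a::euclidean_space set"
  assumes P: "polytope P" and p: "p extreme_point_of P"
    and loc: "\<And>F v w. F face_of P \<Longrightarrow> aff_dim F = 2 \<Longrightarrow> closed_segment p v edge_of F \<Longrightarrow>
      closed_segment p w edge_of F \<Longrightarrow>
      (\<And>x. x extreme_point_of F \<Longrightarrow> x \<noteq> p \<Longrightarrow> s \<bullet> p < s \<bullet> x) \<Longrightarrow> f v = f w"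
    and v: "closed_segment p v edge_of P" "s \<bullet> p < s \<bullet> v"
    and w: "closed_segment p w edge_of P" "s \<bullet> p < s \<bullet> w"
  shows "f v = f w"
proof -
  note conv = polytope_imp_convex[OF P]
  obtain c0 where c0: "max_face c0 P = {p}" using extreme_point_max_face P p by blast
  define V where "V = {x. x extreme_point_of P} - {p}"
  define y where "y v = (1 / (c0 \<bullet> (p - v))) *\<^sub>R (v - p)" for v
  let ?K = "convex hull (y ` V)"
  have finV: "finite V" unfolding V_def using polytope_extreme_hull[OF P] by simp
  have VP: "V \<subseteq> P" unfolding V_def extreme_point_of_def by auto
  have pos: "0 < c0 \<bullet> (p - v)" if "v \<in> V" for v
    using max_face_inner_less[of p c0 P v] c0 that VP V_def by (auto simp: inner_diff_right)
  have inV: "x \<in> V" if "closed_segment p x edge_of P" for x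
    using edge_of_endpoints[OF that] unfolding V_def by auto
  then have ne: "V \<noteq> {}" using v by blast
  have K: "polytope ?K" using finV by (auto intro: polytope_convex_hull)
  note fig = vertex_figure_face[OF P c0 V_def y_def ne]
  have spos: "0 < s \<bullet> y x \<longleftrightarrow> s \<bullet> p < s \<bullet> x" if "x \<in> V" for x
    using pos[OF that] unfolding y_def by (simp add: inner_diff_right zero_less_divide_iff)
  \<comment> \<open>A vertex of the figure comes from a face of dimension at most 1 containing
    \<open>p\<close> and \<open>x\<close>, hence from an edge at \<open>p\<close> and from no other
    vertex than \<open>x\<close>.\<close>
  have unique: "closed_segment p x edge_of P \<and> (\<forall>x'\<in>V. y x' = y x \<longrightarrow> x' = x)"
    if x: "x \<in> V" "y x extreme_point_of ?K" for x
  proof -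
    obtain c where c: "max_face c ?K = {y x}" using extreme_point_max_face K x by blast
    obtain F where F: "F face_of P" "p \<in> F" "\<And>v. v \<in> V \<Longrightarrow> v \<in> F \<longleftrightarrow> y v \<in> max_face c ?K"
      "\<And>T. finite T \<Longrightarrow> max_face c ?K \<subseteq> convex hull T \<Longrightarrow> aff_dim F \<le> int (card T)"
      using fig[of c] by blast
    have "aff_dim F \<le> 1" using F(4)[of "{y x}"] c by simp
    have xF: "x \<in> F" using F(3) x c by auto
    have "p \<noteq> x" using x V_def by auto
    then have "F \<noteq> {}" "\<not> (\<exists>a. F = {a})" using F(2) xF by auto
    then have "aff_dim F \<noteq> 0" "\<not> aff_dim F < 0" using aff_dim_eq_0[of F] aff_dim_negative_iff[of F] by auto
    with \<open>aff_dim F \<le> 1\<close> have "aff_dim F = 1" by linarith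
    then have Fe: "F edge_of P" using F(1) by (simp add: edge_of_def)
    then obtain a b where ab: "F = closed_segment a b" using edge_of_segment P by blast
    have ext: "z = a \<or> z = b" if "z extreme_point_of P" "z \<in> F" for z
      using extreme_point_of_face[OF F(1)] that ab extreme_point_of_segment by blast
    have 1: "p = a \<or> p = b" "x = a \<or> x = b" using ext p F(2) x xF V_def by auto
    then have "closed_segment p x = F" using \<open>p \<noteq> x\<close> ab closed_segment_commute by metis
    moreover have "x' = x" if "x' \<in> V" "y x' = y x" for x'
      using that ext[of x'] 1 \<open>p \<noteq> x\<close> F(3)[of x'] c V_def by auto
    ultimately show ?thesis using Fe by blast
  qed
  have ext: "y x extreme_point_of ?K" if x: "closed_segment p x edge_of P" for x
  proof -
    have "closed_segment p x face_of P" "closed_segment p x \<noteq> {}" using x by (auto simp: edge_of_def)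
    then obtain c where c: "closed_segment p x = max_face c P" using face_of_polytope_max_face P by blast
    \<comment> \<open>Conversely, a functional exposing the edge vanishes at \<open>y x\<close> and
      is negative at all other generators of the figure.\<close>
    have cp: "c \<bullet> v < c \<bullet> p" if "v \<in> V" "v \<noteq> x" for v
    proof -
      have "v \<notin> closed_segment p x"
        using extreme_point_of_face[of "closed_segment p x" P v] x that extreme_point_of_segment[of v p x]
        unfolding V_def edge_of_def by blast
      then show ?thesis using c that VP max_face_inner_less[of p c P v] by auto
    qed
    have cx: "c \<bullet> x = c \<bullet> p" using c max_face_inner_eq[of x c P p] by auto
    have sgn: "c \<bullet> y v = (c \<bullet> v - c \<bullet> p) / (c0 \<bullet> (p - v))" for v unfolding y_def by (simp add: inner_diff_right)
    have "c \<bullet> y x = 0" using cx sgn by simp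
    have neg: "c \<bullet> k < 0" if "k \<in> y ` V" "k \<noteq> y x" for k
      using that cp pos unfolding sgn by (force simp: sgn divide_neg_pos)
    have xV: "y x \<in> y ` V" using inV x by blast
    have mf: "y x \<in> max_face c ?K"
      using xV neg \<open>c \<bullet> y x = 0\<close> by (intro max_face_convex_hull) (auto, metis imageI order_refl less_imp_le)
    obtain k where k: "k extreme_point_of ?K" "k \<in> max_face c ?K"
      using max_face_extreme_exists K mf max_face_subset by blast
    have "c \<bullet> k = 0" using max_face_inner_eq[OF k(2) mf] \<open>c \<bullet> y x = 0\<close> by simp
    then have "k = y x" using neg[of k] extreme_point_of_convex_hull[OF k(1)] by force
    then show ?thesis using k by simp
  qed
  \<comment> \<open>\<open>f\<close> is transported to the figure; by \<open>unique\<close> the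
    choice is forced at the vertices of the figure.\<close>
  define g where "g k = f (SOME x. x \<in> V \<and> y x = k)" for k
  have g: "g (y x) = f x" if "x \<in> V" "y x extreme_point_of ?K" for x
  proof -
    have "(SOME x'. x' \<in> V \<and> y x' = y x) = x"
      using unique[OF that] that by (intro some_equality) auto
    then show ?thesis by (simp add: g_def)
  qed
  have "g (y v) = g (y w)"
  proof (rule connected_above[OF K])
    show "y v extreme_point_of ?K" "y w extreme_point_of ?K" "0 < s \<bullet> y v" "0 < s \<bullet> y w"
      using ext v w spos inV by auto
    fix k l assume kl: "closed_segment k l edge_of ?K" "0 < s \<bullet> k" "0 < s \<bullet> l"
    have ekl: "k extreme_point_of ?K" "l extreme_point_of ?K" "k \<noteq> l" using edge_of_endpoints[OF kl(1)] by auto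
    then obtain a b where a: "a \<in> V" "k = y a" and b: "b \<in> V" "l = y b"
      using extreme_point_of_convex_hull by blast
    obtain c where c: "closed_segment k l = max_face c ?K"
      using face_of_polytope_max_face[OF K, of "closed_segment k l"] kl(1) unfolding edge_of_def by auto
    obtain F where F: "F face_of P" "p \<in> F" "\<And>v. v \<in> V \<Longrightarrow> v \<in> F \<longleftrightarrow> y v \<in> max_face c ?K"
      "\<And>T. finite T \<Longrightarrow> max_face c ?K \<subseteq> convex hull T \<Longrightarrow> aff_dim F \<le> int (card T)"
      using fig[of c] by blast
    have "max_face c ?K \<subseteq> convex hull {k, l}" using c segment_convex_hull by blast
    then have "aff_dim F \<le> 2" using F(4)[of "{k, l}"] ekl(3) by simp
    have abF: "a \<in> F" "b \<in> F" using F(3) a b c by (auto simp flip: c)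
    have "a \<noteq> b" using a b ekl by auto
    have "aff_dim F = 2"
    proof (rule ccontr)
      assume "aff_dim F \<noteq> 2"
      with \<open>aff_dim F \<le> 2\<close> have "aff_dim F \<le> 1" by linarith
      moreover have "F \<noteq> {}" "\<not> (\<exists>a. F = {a})" using abF \<open>a \<noteq> b\<close> by auto
      then have "aff_dim F \<noteq> 0" "\<not> aff_dim F < 0" using aff_dim_eq_0[of F] aff_dim_negative_iff[of F] by auto
      ultimately have "aff_dim F = 1" by linarith
      then have "F edge_of P" using F(1) by (simp add: edge_of_def)
      then obtain a' b' where ab: "F = closed_segment a' b'" using edge_of_segment P by blast
      have "z = a' \<or> z = b'" if "z extreme_point_of P" "z \<in> F" for z
        using extreme_point_of_face[OF F(1)] that ab extreme_point_of_segment by blast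
      then show False using a b p F(2) abF \<open>a \<noteq> b\<close> unfolding V_def by (metis DiffD1 DiffD2 mem_Collect_eq singletonI)
    qed
    have edge: "closed_segment p a edge_of F" "closed_segment p b edge_of F"
      using unique[of a] unique[of b] a b ekl edge_of_face[OF F(1)]
        closed_segment_subset[OF F(2) abF(1) face_of_imp_convex[OF F(1)]]
        closed_segment_subset[OF F(2) abF(2) face_of_imp_convex[OF F(1)]] by auto
    have "f a = f b"
    proof (rule loc[OF F(1) \<open>aff_dim F = 2\<close> edge])
      fix x assume "x extreme_point_of F" "x \<noteq> p"
      then have "x \<in> V" "x \<in> F" using extreme_point_of_face[OF F(1)] V_def by auto
      \<comment> \<open>The other vertices of \<open>F\<close> project into the segment between two
        points where \<open>s\<close> is positive.\<close>
      then have "y x \<in> closed_segment k l" using F(3) c by auto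
      moreover have "closed_segment k l \<subseteq> {z. 0 < s \<bullet> z}"
        using kl by (intro closed_segment_subset) (auto simp: convex_halfspace_gt)
      ultimately show "s \<bullet> p < s \<bullet> x" using spos[OF \<open>x \<in> V\<close>] by blast
    qed
    then show "g k = g l" using g a b ekl by auto
  qed
  then show ?thesis using g ext inV v w by auto
qed

section \<open>Potentials on the vertices of a polytope\<close>

text \<open>Adding a small positive multiple of the new vector \<open>e\<close> to \<open>s\<close>
  repairs a zero at \<open>e\<close> and keeps the finitely many nonzero values nonzero.\<close>

lemma functional_nonzero_on_finite:
  fixes D :: "'a::euclidean_space set"
  assumes "finite D" "0 \<notin> D"
  obtains s where "\<And>d. d \<in> D \<Longrightarrow> s \<bullet> d \<noteq> 0"
proof -
  have "\<exists>s. \<forall>d\<in>D. s \<bullet> d \<noteq> 0"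
    using assms
  proof (induction D rule: finite_induct)
    case (insert e D)
    then obtain s where s: "\<forall>d\<in>D. s \<bullet> d \<noteq> 0" by auto
    have "\<forall>\<^sub>F t::real in at_right 0. \<forall>d\<in>insert e D. (s + t *\<^sub>R e) \<bullet> d \<noteq> 0"
    proof (rule eventually_ball_finite, use insert in simp, intro ballI)
      fix d assume d: "d \<in> insert e D"
      show "\<forall>\<^sub>F t::real in at_right 0. (s + t *\<^sub>R e) \<bullet> d \<noteq> 0"
      proof (cases "s \<bullet> d = 0")
        case True
        then have "d = e" using s d by auto
        have "\<forall>\<^sub>F t::real in at_right 0. 0 < t" by (rule eventually_at_right_less)
        then show ?thesis
          by eventually_elim (use True \<open>d = e\<close> insert in \<open>simp add: inner_add_left\<close>)
      next
        case False
        have "((\<lambda>t. (s + t *\<^sub>R e) \<bullet> d) \<longlongrightarrow> (s + 0 *\<^sub>R e) \<bullet> d) (at_right 0)" by (intro tendsto_intros)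
        then show ?thesis using False by (intro tendsto_imp_eventually_ne) auto
      qed
    qed
    then show ?case using eventually_happens'[OF trivial_limit_at_right_real] by blast
  qed auto
  then show thesis using that by blast
qed

text \<open>
  Sweep the vertices downwards along a generic functional \<open>s\<close>. The value at a new vertex \<open>p\<close> does not depend
  on the chosen increasing edge at \<open>p\<close>: two such edges are linked by increasing edges, consecutive ones
  spanning a 2-face whose other vertices have been visited before.
\<close>

lemma potential_from_two_faces:
  fixes P :: "'a::euclidean_space set" and \<phi> :: "'a \<Rightarrow> 'a \<Rightarrow> 'b::ab_group_add"
  assumes P: "polytope P"
    and anti: "\<And>x y. closed_segment x y edge_of P \<Longrightarrow> \<phi> y x = - \<phi> x y"
    and loc: "\<And>F. F face_of P \<Longrightarrow> aff_dim F = 2 \<Longrightarrow>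
      \<exists>u. \<forall>x y. closed_segment x y edge_of F \<longrightarrow> u x - u y = \<phi> x y"
  obtains u where "\<And>x y. closed_segment x y edge_of P \<Longrightarrow> u x - u y = \<phi> x y"
proof -
  let ?V = "{x. x extreme_point_of P}"
  have finV: "finite ?V" using polytope_extreme_hull[OF P] by simp
  define D where "D = (\<lambda>(x, y). x - y) ` (?V \<times> ?V) - {0}"
  have "finite D" "0 \<notin> D" unfolding D_def using finV by auto
  then obtain s where s: "\<And>d. d \<in> D \<Longrightarrow> s \<bullet> d \<noteq> 0"
    using functional_nonzero_on_finite[of D] by blast
  have inj: "s \<bullet> x \<noteq> s \<bullet> y" if "x \<in> ?V" "y \<in> ?V" "x \<noteq> y" for x y
    using s[of "x - y"] that unfolding D_def by (force simp: inner_diff_right)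
  \<comment> \<open>The induction runs over sets of vertices closed upwards for \<open>s\<close>;
    removing the lowest vertex preserves this.\<close>
  have "\<exists>u. \<forall>x\<in>W. \<forall>y\<in>W. closed_segment x y edge_of P \<longrightarrow> u x - u y = \<phi> x y"
    if "W \<subseteq> ?V" "\<And>x y. x \<in> W \<Longrightarrow> y \<in> ?V \<Longrightarrow> s \<bullet> x \<le> s \<bullet> y \<Longrightarrow> y \<in> W" for W
    using that
  proof (induction "card W" arbitrary: W)
    case 0
    then have "W = {}" using finV finite_subset by fastforce
    then show ?case by simp
  next
    case (Suc n)
    have finW: "finite W" "W \<noteq> {}" using Suc(2) card.infinite by fastforce+
    then obtain p where p: "p \<in> W" "\<And>w. w \<in> W \<Longrightarrow> s \<bullet> p \<le> s \<bullet> w"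
      using ex_is_arg_min_if_finite[of W "\<lambda>w. s \<bullet> w"] by (auto simp: is_arg_min_linorder)
    have less: "s \<bullet> p < s \<bullet> w" if "w \<in> W" "w \<noteq> p" for w
      using p(2)[OF that(1)] inj[of p w] p(1) that Suc.prems(1) by (metis order_le_less subsetD)
    have "n = card (W - {p})" using Suc(2) p(1) finW by simp
    moreover have "W - {p} \<subseteq> ?V" using Suc.prems by auto
    moreover have "y \<in> W - {p}" if "x \<in> W - {p}" "y \<in> ?V" "s \<bullet> x \<le> s \<bullet> y" for x y
      using Suc.prems(2)[of x y] that less[of x] by auto
    ultimately obtain u where u: "\<And>x y. x \<in> W - {p} \<Longrightarrow> y \<in> W - {p} \<Longrightarrow> closed_segment x y edge_of P \<Longrightarrow> u x - u y = \<phi> x y"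
      using Suc.hyps(1)[of "W - {p}"] by blast
    have pP: "p extreme_point_of P" using p Suc.prems by auto
    \<comment> \<open>\<open>f x\<close> is the value at \<open>p\<close> prescribed by the edge
      from \<open>p\<close> to \<open>x\<close>.\<close>
    define f where "f x = u x + \<phi> p x" for x
    have f: "f v = f w" if "closed_segment p v edge_of P" "s \<bullet> p < s \<bullet> v"
      "closed_segment p w edge_of P" "s \<bullet> p < s \<bullet> w" for v w
    proof (rule edges_at_vertex_connected[OF P pP _ that])
      fix F a b assume F: "F face_of P" "aff_dim F = 2"
        and ab: "closed_segment p a edge_of F" "closed_segment p b edge_of F"
        and above: "\<And>x. x extreme_point_of F \<Longrightarrow> x \<noteq> p \<Longrightarrow> s \<bullet> p < s \<bullet> x"
      obtain uF where uF: "\<And>x y. closed_segment x y edge_of F \<Longrightarrow> uF x - uF y = \<phi> x y" using loc[OF F] by blast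
      \<comment> \<open>Above \<open>p\<close> the potential \<open>u\<close> and the local
        potential of \<open>F\<close> have equal increments along the edges of \<open>F\<close>;
        these vertices being connected, the two differ by a constant.\<close>
      have const: "u a - uF a = u b - uF b"
      proof (rule connected_above[of F a "s \<bullet> p" s b "\<lambda>x. u x - uF x"])
        show "polytope F" using F P face_of_polytope_polytope by blast
        show "a extreme_point_of F" "b extreme_point_of F" using edge_of_endpoints ab by blast+
        then show "s \<bullet> p < s \<bullet> a" "s \<bullet> p < s \<bullet> b" using above edge_of_endpoints(1) ab by metis+
        fix x y assume xy: "closed_segment x y edge_of F" "s \<bullet> p < s \<bullet> x" "s \<bullet> p < s \<bullet> y"
        have e: "closed_segment x y edge_of P" using xy(1) edge_of_face[OF F(1)] by blast
        then have "x \<in> W - {p}" "y \<in> W - {p}"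
          using Suc.prems(2)[OF p(1), of x] Suc.prems(2)[OF p(1), of y] edge_of_endpoints[OF e] xy(2,3) by auto
        then have "u x - u y = uF x - uF y" using u e uF xy(1) by metis
        then show "u x - uF x = u y - uF y" by (simp add: algebra_simps)
      qed
      have "f a = (u a - uF a) + uF p" using uF[OF ab(1)] unfolding f_def by (simp flip: uF[OF ab(1)])
      also have "\<dots> = (u b - uF b) + uF p" by (simp only: const)
      also have "\<dots> = f b" unfolding f_def by (simp flip: uF[OF ab(2)])
      finally show "f a = f b" .
    qed
    have nb: "s \<bullet> p < s \<bullet> w" if "closed_segment p w edge_of P" "w \<in> W" for w
      using edge_of_endpoints(1)[OF that(1)] less that(2) by auto
    \<comment> \<open>If no edge leads from \<open>p\<close> into \<open>W\<close>, any value
      serves.\<close>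
    obtain z where z: "\<And>w. closed_segment p w edge_of P \<Longrightarrow> w \<in> W \<Longrightarrow> z = f w"
      using f nb by metis
    have "(u(p := z)) x - (u(p := z)) y = \<phi> x y"
      if xy: "x \<in> W" "y \<in> W" "closed_segment x y edge_of P" for x y
    proof -
      have "x \<noteq> y" using edge_of_endpoints xy by blast
      then consider "x \<noteq> p" "y \<noteq> p" | "x = p" "y \<noteq> p" | "x \<noteq> p" "y = p" by blast
      then show ?thesis
      proof cases
        case 1
        then show ?thesis using u xy by simp
      next
        case 2
        then show ?thesis using z[of y] xy unfolding f_def by simp
      next
        case 3
        then have e: "closed_segment p x edge_of P" using xy closed_segment_commute by metis
        show ?thesis using 3 z[OF e xy(1)] anti[OF e] unfolding f_def by simp
      qed
    qed
    then show ?case by blast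
  qed
  from this[of ?V] obtain u where "\<forall>x\<in>?V. \<forall>y\<in>?V. closed_segment x y edge_of P \<longrightarrow> u x - u y = \<phi> x y"
    by auto
  then show thesis using that[of u] edge_of_endpoints by blast
qed

section \<open>Two polytopes in parallelogramic position\<close>

lemma in_span_by_functionals:
  fixes z :: "'a::euclidean_space"
  assumes "\<And>d. (\<And>a. a \<in> A \<Longrightarrow> d \<bullet> a = 0) \<Longrightarrow> d \<bullet> z = 0"
  shows "z \<in> span A"
proof -
  have "z \<in> (span A)\<^sup>\<bottom>\<^sup>\<bottom>"
    unfolding orthogonal_comp_def orthogonal_def
    using assms by (auto simp: inner_commute span_base)
  then show ?thesis by (simp add: orthogonal_comp_self)
qed

lemma parallel_by_functionals:
  fixes z :: "'a::euclidean_space"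
  assumes "\<And>d. d \<bullet> v = 0 \<Longrightarrow> d \<bullet> z = 0"
  obtains t where "z = t *\<^sub>R v"
  using in_span_by_functionals[of "{v}" z] assms by (auto simp: span_singleton)

text \<open>The shape of the conclusion matches \<open>two_generic\<close>, which asks for two
  edges; if one element suffices it is repeated with coefficient 0.\<close>

lemma in_span_two_elements:
  fixes z :: "'a::euclidean_space"
  assumes z: "z \<in> span A" and A: "dim A \<le> 2" "A \<noteq> {}"
  obtains a b \<alpha> \<beta> where "a \<in> A" "b \<in> A" "z = \<alpha> *\<^sub>R a + \<beta> *\<^sub>R b"
proof -
  obtain B where B: "B \<subseteq> A" "independent B" "A \<subseteq> span B" "card B = dim A"
    using basis_exists[of A] by blast
  have zB: "z \<in> span B" using z B(3) by (meson span_minimal subsetD subspace_span)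
  have finB: "finite B" using B(2) independent_imp_finite by blast
  obtain a0 where a0: "a0 \<in> A" using A by blast
  consider "card B = 0" | "card B = 1" | "card B = 2" using B(4) A(1) by linarith
  then show thesis
  proof cases
    case 1
    then have "z = 0 *\<^sub>R a0 + 0 *\<^sub>R a0" using zB finB by simp
    then show thesis using that a0 by blast
  next
    case 2
    then obtain b where b: "B = {b}" using card_1_singletonE by blast
    then obtain k where "z = k *\<^sub>R b" using zB by (auto simp: span_singleton)
    then have "z = k *\<^sub>R b + 0 *\<^sub>R b" by simp
    then show thesis using that b B(1) by blast
  next
    case 3
    then obtain b b' where b: "B = {b, b'}" using card_2_iff by metis
    then obtain k where "z - k *\<^sub>R b \<in> span {b'}" using zB span_insert[of b "{b'}"] by auto
    then obtain k' where "z - k *\<^sub>R b = k' *\<^sub>R b'" by (auto simp: span_singleton)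
    then have "z = k *\<^sub>R b + k' *\<^sub>R b'" by (metis add.commute diff_add_cancel)
    then show thesis using that b B(1) by blast
  qed
qed

text \<open>Parallelism to \<open>F\<close> is assumed in dual form, which is how
  \<open>generic_max_face\<close> delivers it. The directions of \<open>F\<close> are spanned by its
  edges, because a functional constant along all edges is constant on \<open>F\<close>, and two
  edges suffice in dimension 2.\<close>

lemma parallel_two_face_not_two_generic:
  fixes P :: "'a::euclidean_space set"
  assumes P: "polytope P" and F: "F face_of P" "aff_dim F = 2"
    and z: "\<And>d. (\<And>x y. x \<in> F \<Longrightarrow> y \<in> F \<Longrightarrow> d \<bullet> x = d \<bullet> y) \<Longrightarrow> d \<bullet> z = 0"
  shows "\<not> two_generic z P"
proof -
  have pF: "polytope F" using P F face_of_polytope_polytope by blast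
  define A where "A = {y - x | x y. closed_segment x y edge_of F}"
  have zA: "z \<in> span A"
  proof (rule in_span_by_functionals, rule z)
    fix d x y assume d: "\<And>a. a \<in> A \<Longrightarrow> d \<bullet> a = 0" and xy: "x \<in> F" "y \<in> F"
    have "d \<bullet> a = d \<bullet> b" if "closed_segment a b edge_of F" for a b
    proof -
      have "d \<bullet> (b - a) = 0" using that by (intro d) (auto simp: A_def)
      then show ?thesis by (simp add: inner_diff_right)
    qed
    then show "d \<bullet> x = d \<bullet> y" using orthogonal_edges_imp_constant[OF pF _ xy] by blast
  qed
  have "F \<noteq> {}" using F(2) by auto
  then obtain p where p: "p extreme_point_of F" using polytope_extreme_exists pF by blast
  have "F \<noteq> {p}" using F(2) by auto
  then obtain q where q: "closed_segment p q edge_of F" using edge_at_vertex pF p by blast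
  then have A0: "A \<noteq> {}" unfolding A_def by auto
  have dimA: "dim A \<le> 2"
  proof -
    have pin: "p \<in> F" using p by (simp add: extreme_point_of_def)
    have "A \<subseteq> span ((+) (- p) ` F)"
    proof
      fix a assume "a \<in> A"
      then obtain x y where e: "closed_segment x y edge_of F" and a: "a = y - x" unfolding A_def by blast
      note xy = edge_of_endpoints(4,5)[OF e] a
      have "(- p + y) - (- p + x) \<in> span ((+) (- p) ` F)" using xy by (intro span_diff span_base) auto
      then show "a \<in> span ((+) (- p) ` F)" using xy by simp
    qed
    then have "dim A \<le> dim ((+) (- p) ` F)" by (metis dim_span dim_subset)
    also have "int \<dots> = aff_dim F" using aff_dim_eq_dim[of p F] pin by (simp add: hull_inc)
    finally show ?thesis using F(2) by simp
  qed
  obtain a b \<alpha> \<beta> where ab: "a \<in> A" "b \<in> A" "z = \<alpha> *\<^sub>R a + \<beta> *\<^sub>R b"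
    using in_span_two_elements[OF zA dimA A0] by blast
  obtain x y where xy: "a = y - x" "closed_segment x y edge_of F" using ab unfolding A_def by blast
  obtain x' y' where xy': "b = y' - x'" "closed_segment x' y' edge_of F" using ab unfolding A_def by blast
  have "closed_segment x y \<in> edges P \<and> closed_segment x y \<subseteq> F"
    "closed_segment x' y' \<in> edges P \<and> closed_segment x' y' \<subseteq> F"
    using xy xy' edge_of_face[OF F(1)] by (auto simp: edges_def)
  then show ?thesis unfolding two_generic_def using F ab(3) xy(1) xy'(1) by blast
qed

lemma separate_directions:
  fixes v z :: "'a::euclidean_space"
  assumes "\<And>t. z \<noteq> t *\<^sub>R v"
  obtains d where "d \<bullet> v = 0" "0 < d \<bullet> z"
proof -
  obtain d where "d \<bullet> v = 0" "d \<bullet> z \<noteq> 0" using parallel_by_functionals assms by metis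
  then show thesis using that[of d] that[of "- d"] by (cases "0 < d \<bullet> z") auto
qed

lemma max_face_segment:
  fixes x y :: "'a::euclidean_space"
  assumes "d \<bullet> y < d \<bullet> x"
  shows "max_face d (closed_segment x y) = {x}"
proof -
  have "d \<bullet> z < d \<bullet> x" if z: "z \<in> closed_segment x y" "z \<noteq> x" for z
  proof -
    obtain u where u: "0 \<le> u" "z = (1 - u) *\<^sub>R x + u *\<^sub>R y" using z(1) unfolding in_segment by blast
    then have "u \<noteq> 0" using z(2) by auto
    have "d \<bullet> z = d \<bullet> x - u * (d \<bullet> x - d \<bullet> y)"
      unfolding u(2) by (simp add: inner_add_right inner_diff_right algebra_simps)
    moreover have "0 < u * (d \<bullet> x - d \<bullet> y)" using u \<open>u \<noteq> 0\<close> assms by (intro mult_pos_pos) auto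
    ultimately show ?thesis by linarith
  qed
  then have "d \<bullet> z \<le> d \<bullet> x" "d \<bullet> x \<le> d \<bullet> z \<Longrightarrow> z = x" if "z \<in> closed_segment x y" for z
    using that by force+
  then show ?thesis unfolding max_face_def by auto
qed

lemma max_face_segment_orthogonal:
  fixes x y :: "'a::euclidean_space"
  assumes "d \<bullet> y = d \<bullet> x"
  shows "max_face d (closed_segment x y) = closed_segment x y"
proof (rule max_face_orthogonal)
  have "d \<bullet> z = d \<bullet> x" if z: "z \<in> closed_segment x y" for z
  proof -
    obtain u where "z = (1 - u) *\<^sub>R x + u *\<^sub>R y" using z unfolding in_segment by blast
    then have "d \<bullet> z = (1 - u) * (d \<bullet> x) + u * (d \<bullet> y)" by (simp add: inner_add_right)
    then show ?thesis using assms by (simp add: algebra_simps)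
  qed
  then show "d \<bullet> z = d \<bullet> z'" if "z \<in> closed_segment x y" "z' \<in> closed_segment x y" for z z'
    using that by metis
qed

text \<open>For a nonempty face of a polytope this set is the relative interior of the normal cone.
  Convexity supplies the connectedness along which edge coefficients are compared.\<close>

lemma convex_exposing_functionals:
  fixes P :: "'a::euclidean_space set"
  assumes "F \<noteq> {}"
  shows "convex {c. max_face c P = F}"
proof (rule convexI)
  fix c1 c2 and a b :: real
  assume c: "c1 \<in> {c. max_face c P = F}" "c2 \<in> {c. max_face c P = F}" and ab: "0 \<le> a" "0 \<le> b" "a + b = 1"
  obtain x where x: "x \<in> F" using assms by blast
  have F: "max_face c1 P = F" "max_face c2 P = F" using c by auto
  let ?c = "a *\<^sub>R c1 + b *\<^sub>R c2"
  have le: "?c \<bullet> y \<le> ?c \<bullet> z" if "z \<in> F" "y \<in> P" for y z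
    using max_face_inner_le[of z c1 P y] max_face_inner_le[of z c2 P y] that F ab
    by (auto simp: inner_add_left intro!: add_mono mult_left_mono)
  have less: "?c \<bullet> y < ?c \<bullet> x" if "y \<in> P" "y \<notin> F" for y
  proof -
    have 1: "c1 \<bullet> y < c1 \<bullet> x" "c2 \<bullet> y < c2 \<bullet> x"
      using max_face_inner_less[of x _ P y] that F x by auto
    have le: "a * (c1 \<bullet> y) \<le> a * (c1 \<bullet> x)" "b * (c2 \<bullet> y) \<le> b * (c2 \<bullet> x)"
      using 1 ab by (auto intro!: mult_left_mono)
    consider "0 < a" | "0 < b" using ab by linarith
    then show ?thesis
    proof cases
      case 1
      then have "a * (c1 \<bullet> y) < a * (c1 \<bullet> x)" using \<open>c1 \<bullet> y < c1 \<bullet> x\<close> by simp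
      then show ?thesis using le by (simp add: inner_add_left)
    next
      case 2
      then have "b * (c2 \<bullet> y) < b * (c2 \<bullet> x)" using \<open>c2 \<bullet> y < c2 \<bullet> x\<close> by simp
      then show ?thesis using le by (simp add: inner_add_left)
    qed
  qed
  have "F \<subseteq> P" using F max_face_subset by blast
  have "max_face ?c P = F"
  proof
    show "F \<subseteq> max_face ?c P" using le \<open>F \<subseteq> P\<close> unfolding max_face_def by auto
    show "max_face ?c P \<subseteq> F"
      using less max_face_inner_le[of _ ?c P x] max_face_subset[of ?c P] x \<open>F \<subseteq> P\<close> linorder_not_le by blast
  qed
  then show "?c \<in> {c. max_face c P = F}" by simp
qed

text \<open>\<open>nonparallel\<close> is listed separately because \<open>pair\<close> speaks only
  of 2-faces and says nothing about two parallel segments.\<close>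

locale parallelogramic_summands =
  fixes P Q :: "'a::euclidean_space set"
  assumes P: "polytope P" "P \<noteq> {}" and Q: "polytope Q" "Q \<noteq> {}"
    and pair: "parallelogramic_pair P Q"
    and nonparallel: "\<And>x y a b t. closed_segment x y edge_of P \<Longrightarrow> closed_segment a b edge_of Q \<Longrightarrow>
      y - x \<noteq> t *\<^sub>R (b - a)"
begin

lemma nonparallel':
  assumes "closed_segment x y edge_of P" "closed_segment a b edge_of Q"
  shows "b - a \<noteq> t *\<^sub>R (y - x)"
proof
  assume *: "b - a = t *\<^sub>R (y - x)"
  have "a \<noteq> b" using assms edge_of_endpoints by blast
  then have "t \<noteq> 0" using * by auto
  then have "y - x = (1/t) *\<^sub>R (b - a)" using * by simp
  then show False using nonparallel assms by blast
qed

text \<open>For a generic functional, whatever vanishes on the edge of \<open>P\<close> is constant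
  on the face of \<open>Q\<close>. An edge of that face would then be parallel to the edge of
  \<open>P\<close>, so the face is a vertex.\<close>

lemma edge_exposed_with_vertex:
  assumes "max_face c P = closed_segment p p'" "closed_segment p p' edge_of P"
  obtains c' w where "max_face c' P = closed_segment p p'" "max_face c' Q = {w}"
    "max_face c' Q \<subseteq> max_face c Q"
proof -
  obtain c' where c': "max_face c' P = max_face c P" "max_face c' Q \<subseteq> max_face c Q"
    and gen: "\<And>d. \<forall>a\<in>max_face c P. \<forall>b\<in>max_face c P. d \<bullet> a = d \<bullet> b \<Longrightarrow>
        \<forall>x\<in>max_face c' Q. \<forall>y\<in>max_face c' Q. d \<bullet> x = d \<bullet> y"
    using generic_max_face[OF P(1) Q, of c] by blast
  let ?G = "max_face c' Q"
  have G: "polytope ?G" "?G \<noteq> {}" using Q polytope_max_face max_face_nonempty by auto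
  obtain w where w: "w extreme_point_of ?G" using polytope_extreme_exists G by blast
  have "?G = {w}"
  proof (rule ccontr)
    assume "?G \<noteq> {w}"
    then obtain w' where w': "closed_segment w w' edge_of ?G" using edge_at_vertex G(1) w by blast
    have "d \<bullet> (w' - w) = 0" if "d \<bullet> (p' - p) = 0" for d
    proof -
      have "max_face d (closed_segment p p') = closed_segment p p'"
        using that by (intro max_face_segment_orthogonal) (simp add: inner_diff_right)
      then have "d \<bullet> a = d \<bullet> b" if "a \<in> max_face c P" "b \<in> max_face c P" for a b
        using that assms(1) max_face_inner_eq[of a d "closed_segment p p'" b] by simp
      then have "d \<bullet> w' = d \<bullet> w"
        using gen[of d] edge_of_endpoints[OF w'] by blast
      then show ?thesis by (simp add: inner_diff_right)
    qed
    then obtain t where "w' - w = t *\<^sub>R (p' - p)" using parallel_by_functionals by blast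
    then show False
      using nonparallel'[OF assms(2)] w' edge_of_max_face[OF polytope_imp_convex[OF Q(1)]] by blast
  qed
  then show thesis using that c' assms by metis
qed

text \<open>Here 2-genericity of the edge directions of \<open>Q\<close> enters: an edge in a
  generic face of \<open>Q\<close> would be parallel to \<open>F\<close>. Consequently a translate
  of \<open>F\<close> is a face of \<open>P + Q\<close>.\<close>

lemma two_face_exposed_with_vertex:
  assumes F: "F face_of P" "aff_dim F = 2"
  obtains c w where "max_face c P = F" "max_face c Q = {w}"
proof -
  have "F \<noteq> {}" using F by auto
  then obtain c where c: "F = max_face c P" using face_of_polytope_max_face P F by blast
  obtain c' where c': "max_face c' P = max_face c P" "max_face c' Q \<subseteq> max_face c Q"
    and gen: "\<And>d. \<forall>a\<in>max_face c P. \<forall>b\<in>max_face c P. d \<bullet> a = d \<bullet> b \<Longrightarrow>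
        \<forall>x\<in>max_face c' Q. \<forall>y\<in>max_face c' Q. d \<bullet> x = d \<bullet> y"
    using generic_max_face[OF P(1) Q, of c] by blast
  let ?G = "max_face c' Q"
  have G: "polytope ?G" "?G \<noteq> {}" using Q polytope_max_face max_face_nonempty by auto
  obtain w where w: "w extreme_point_of ?G" using polytope_extreme_exists G by blast
  have "?G = {w}"
  proof (rule ccontr)
    assume "?G \<noteq> {w}"
    then obtain w' where w': "closed_segment w w' edge_of ?G" using edge_at_vertex G(1) w by blast
    have "\<not> two_generic (w' - w) P"
    proof (rule parallel_two_face_not_two_generic[OF P(1) F])
      fix d assume "\<And>x y. x \<in> F \<Longrightarrow> y \<in> F \<Longrightarrow> d \<bullet> x = d \<bullet> y"
      then have "d \<bullet> w' = d \<bullet> w" using gen[of d] c edge_of_endpoints[OF w'] by blast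
      then show "d \<bullet> (w' - w) = 0" by (simp add: inner_diff_right)
    qed
    moreover have "closed_segment w w' \<in> edges Q"
      using w' edge_of_max_face[OF polytope_imp_convex[OF Q(1)]] by (auto simp: edges_def)
    ultimately show False using pair unfolding parallelogramic_pair_def by blast
  qed
  then show thesis using that c' c by metis
qed

lemma convex_sum: "convex (P + Q)"
  using P Q polytope_imp_convex convex_set_plus by blast

lemma edge_plus_vertex:
  assumes "max_face c P = closed_segment p p'" "max_face c Q = {w}" "p \<noteq> p'"
  shows "closed_segment (p + w) (p' + w) edge_of (P + Q)"
proof -
  have "max_face c (P + Q) = (+) w ` closed_segment p p'"
    unfolding max_face_set_plus assms by (auto simp: set_plus_def add.commute)
  also have "\<dots> = closed_segment (p + w) (p' + w)"
    by (metis add.commute closed_segment_translation)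
  finally have "closed_segment (p + w) (p' + w) face_of (P + Q)"
    using max_face_face_of convex_sum by metis
  then show ?thesis using assms(3) by (simp add: edge_of_def aff_dim_closed_segment)
qed

end

lemma parallelogramic_summands_commute:
  assumes "parallelogramic_summands P Q" shows "parallelogramic_summands Q P"
proof -
  interpret parallelogramic_summands P Q by fact
  show ?thesis
    by unfold_locales (use P Q pair nonparallel' in \<open>auto simp: parallelogramic_pair_def\<close>)
qed

context parallelogramic_summands
begin

text \<open>The face of \<open>P + Q\<close> exposed by \<open>c\<close> is a parallelogram. Under
  \<open>q\<close> its sides keep their two independent directions, and closing up forces the two
  sides parallel to \<open>p' - p\<close> to be scaled equally.\<close>

lemma parallelogram:
  assumes q: "\<And>x y. closed_segment x y edge_of (P + Q) \<Longrightarrow> \<exists>l\<ge>0. q x - q y = l *\<^sub>R (x - y)"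
    and c: "max_face c P = closed_segment p p'" "max_face c Q = closed_segment x y"
    and ne: "p \<noteq> p'" "x \<noteq> y"
  shows "\<exists>l\<ge>0. q (p' + x) - q (p + x) = l *\<^sub>R (p' - p) \<and> q (p' + y) - q (p + y) = l *\<^sub>R (p' - p)"
proof -
  have eP: "closed_segment p p' edge_of P" and eQ: "closed_segment x y edge_of Q"
    using c ne max_face_face_of[OF polytope_imp_convex[OF P(1)], of c]
      max_face_face_of[OF polytope_imp_convex[OF Q(1)], of c]
    by (auto simp: edge_of_def aff_dim_closed_segment)
  have 1: "\<exists>l\<ge>0. q (a + z) - q (b + z) = l *\<^sub>R (a - b)"
    if ab: "closed_segment a b = closed_segment p p'" and z: "z \<in> {x, y}" for a b z
  proof -
    obtain z' where z': "closed_segment z z' = closed_segment x y" using z closed_segment_commute by blast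
    then have "closed_segment z z' edge_of Q" using eQ by (simp only:)
    then have "\<And>t. z - z' \<noteq> t *\<^sub>R (p' - p)"
      using nonparallel'[OF eP, of z z'] by (metis minus_diff_eq scaleR_minus_left)
    \<comment> \<open>A perturbation that is constant along the edge of \<open>P\<close> and prefers
      \<open>z\<close> to \<open>z'\<close> singles out the side of the parallelogram at
      \<open>z\<close>.\<close>
    then obtain d where d: "d \<bullet> (p' - p) = 0" "0 < d \<bullet> (z - z')" using separate_directions by blast
    have "\<forall>\<^sub>F \<epsilon> in at_right 0. max_face (c + \<epsilon> *\<^sub>R d) P = max_face d (max_face c P) \<and>
        max_face (c + \<epsilon> *\<^sub>R d) Q = max_face d (max_face c Q)"
      using eventually_max_face_perturb P Q by (intro eventually_conj) auto
    then obtain \<epsilon> where e: "max_face (c + \<epsilon> *\<^sub>R d) P = max_face d (max_face c P)"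
        "max_face (c + \<epsilon> *\<^sub>R d) Q = max_face d (max_face c Q)"
      using eventually_happens'[OF trivial_limit_at_right_real] by blast
    have "max_face (c + \<epsilon> *\<^sub>R d) P = closed_segment a b"
      unfolding e c ab using d by (intro max_face_segment_orthogonal) (simp add: inner_diff_right)
    moreover have "max_face (c + \<epsilon> *\<^sub>R d) Q = {z}"
      unfolding e c z'[symmetric] using d by (intro max_face_segment) (simp add: inner_diff_right)
    moreover have "a \<noteq> b" by (rule edge_of_endpoints(1)[of a b P]) (use eP in \<open>simp only: ab\<close>)
    ultimately have "closed_segment (a + z) (b + z) edge_of (P + Q)" by (rule edge_plus_vertex)
    from q[OF this] show ?thesis by simp
  qed
  interpret sw: parallelogramic_summands Q P
    by (rule parallelogramic_summands_commute) unfold_locales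
  have 2: "\<exists>l. q (a + x) - q (a + y) = l *\<^sub>R (x - y)" if a: "a \<in> {p, p'}" for a
  proof -
    obtain b where b: "closed_segment a b = closed_segment p p'" using a closed_segment_commute by blast
    then have "closed_segment a b edge_of P" using eP by (simp only:)
    then have "\<And>t. a - b \<noteq> t *\<^sub>R (y - x)"
      using nonparallel[OF _ eQ, of a b] by (metis minus_diff_eq scaleR_minus_left)
    then obtain d where d: "d \<bullet> (y - x) = 0" "0 < d \<bullet> (a - b)" using separate_directions by blast
    have "\<forall>\<^sub>F \<epsilon> in at_right 0. max_face (c + \<epsilon> *\<^sub>R d) P = max_face d (max_face c P) \<and>
        max_face (c + \<epsilon> *\<^sub>R d) Q = max_face d (max_face c Q)"
      using eventually_max_face_perturb P Q by (intro eventually_conj) auto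
    then obtain \<epsilon> where e: "max_face (c + \<epsilon> *\<^sub>R d) P = max_face d (max_face c P)"
        "max_face (c + \<epsilon> *\<^sub>R d) Q = max_face d (max_face c Q)"
      using eventually_happens'[OF trivial_limit_at_right_real] by blast
    have "max_face (c + \<epsilon> *\<^sub>R d) Q = closed_segment x y"
      unfolding e c using d by (intro max_face_segment_orthogonal) (simp add: inner_diff_right)
    moreover have "max_face (c + \<epsilon> *\<^sub>R d) P = {a}"
      unfolding e c b[symmetric] using d by (intro max_face_segment) (simp add: inner_diff_right)
    ultimately have "closed_segment (x + a) (y + a) edge_of (Q + P)" using ne(2) by (rule sw.edge_plus_vertex)
    then have "closed_segment (a + x) (a + y) edge_of (P + Q)" by (simp add: add.commute)
    from q[OF this] show ?thesis by auto
  qed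
  obtain l where l: "0 \<le> l" "q (p' + x) - q (p + x) = l *\<^sub>R (p' - p)"
    using 1[of p' p x] closed_segment_commute by blast
  obtain l' where l': "q (p' + y) - q (p + y) = l' *\<^sub>R (p' - p)"
    using 1[of p' p y] closed_segment_commute by blast
  obtain m where m: "q (p + x) - q (p + y) = m *\<^sub>R (x - y)" using 2 by blast
  obtain m' where m': "q (p' + x) - q (p' + y) = m' *\<^sub>R (x - y)" using 2 by blast
  \<comment> \<open>The discrepancy of one pair of opposite sides equals that of the other pair, so
    it lies in two independent directions.\<close>
  have "(l - l') *\<^sub>R (p' - p) = (q (p' + x) - q (p + x)) - (q (p' + y) - q (p + y))"
    unfolding l(2) l' by (simp add: scaleR_left_diff_distrib)
  also have "\<dots> = (q (p' + x) - q (p' + y)) - (q (p + x) - q (p + y))" by simp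
  also have "\<dots> = (m' - m) *\<^sub>R (x - y)" unfolding m m' by (simp add: scaleR_left_diff_distrib)
  finally have eq: "(l - l') *\<^sub>R (p' - p) = (m' - m) *\<^sub>R (x - y)" .
  have "l = l'"
  proof (rule ccontr)
    assume "l \<noteq> l'"
    then have "p' - p = (1 / (l - l')) *\<^sub>R ((l - l') *\<^sub>R (p' - p))" by simp
    also have "\<dots> = ((m - m') / (l - l')) *\<^sub>R (y - x)"
      unfolding eq by (simp add: scaleR_right_diff_distrib flip: scaleR_scaleR) (simp add: algebra_simps diff_divide_distrib)
    finally show False using nonparallel[OF eP eQ] by blast
  qed
  then show ?thesis using l l' by blast
qed

text \<open>
  The coefficient of an edge \<open>closed_segment p p'\<close> of \<open>P\<close> could depend on the vertex of \<open>Q\<close> it is translated by.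
  As a function of the functional \<open>c\<close> exposing \<open>closed_segment p p'\<close> it is locally constant, since the vertices of the
  face of the projection of \<open>Q\<close> along the edge exposed by \<open>c\<close> are linked by parallelograms; and the
  exposing functionals form a convex set.
\<close>

lemma edge_coefficient:
  assumes q: "\<And>x y. closed_segment x y edge_of (P + Q) \<Longrightarrow> \<exists>l\<ge>0. q x - q y = l *\<^sub>R (x - y)"
    and e: "closed_segment p p' edge_of P"
  shows "\<exists>l\<ge>0. \<forall>c w. max_face c P = closed_segment p p' \<longrightarrow> max_face c Q = {w} \<longrightarrow>
    q (p' + w) - q (p + w) = l *\<^sub>R (p' - p)"
proof -
  define v where "v = p' - p"
  have ne: "p \<noteq> p'" and v0: "v \<noteq> 0" using edge_of_endpoints(1)[OF e] by (auto simp: v_def)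
  \<comment> \<open>Orthogonal projection along the edge. Functionals exposing the edge vanish on
    \<open>v\<close>, so they see \<open>Q\<close> only through this projection.\<close>
  define \<pi> where "\<pi> x = x - ((x \<bullet> v) / (v \<bullet> v)) *\<^sub>R v" for x
  have lin: "linear \<pi>"
    by (rule linearI) (simp_all add: \<pi>_def algebra_simps add_divide_distrib)
  have orth: "\<pi> x \<bullet> v = 0" for x using v0 by (simp add: \<pi>_def inner_diff_left)
  have inner\<pi>: "c \<bullet> \<pi> x = c \<bullet> x" if "c \<bullet> v = 0" for c x using that by (simp add: \<pi>_def inner_diff_right)
  have adj: "\<pi> c \<bullet> x = c \<bullet> \<pi> x" for c x by (simp add: \<pi>_def inner_diff_left inner_diff_right inner_commute)
  have idem: "\<pi> (\<pi> x) = \<pi> x" for x using orth[of x] by (simp add: \<pi>_def[of "\<pi> x"])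
  have ker: "\<exists>s. x - y = s *\<^sub>R v" if "\<pi> x = \<pi> y" for x y
  proof -
    have "x - y = ((x \<bullet> v) / (v \<bullet> v)) *\<^sub>R v - ((y \<bullet> v) / (v \<bullet> v)) *\<^sub>R v"
      using that unfolding \<pi>_def by (simp add: algebra_simps)
    then show ?thesis by (metis scaleR_left_diff_distrib)
  qed
  let ?Q = "\<pi> ` Q"
  have Q': "polytope ?Q" "?Q \<noteq> {}" using Q lin polytope_linear_image by auto
  define C where "C = {c. max_face c P = closed_segment p p'}"
  have Cv: "c \<bullet> v = 0" if "c \<in> C" for c
    using that max_face_inner_eq[of p c P p'] unfolding C_def v_def by (simp add: inner_diff_right)
  have mfQ: "max_face c ?Q = \<pi> ` max_face c Q" if "c \<bullet> v = 0" for c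
    using inner\<pi>[OF that] by (auto simp: max_face_def)
  \<comment> \<open>\<open>L z\<close> is the edge coefficient at a point of \<open>Q\<close> over
    \<open>z\<close>, recovered by an inner product with \<open>v\<close>; it is meaningful where
    the fibre is a single point.\<close>
  define L where "L z = (let w = (SOME w. w \<in> Q \<and> \<pi> w = z) in ((q (p' + w) - q (p + w)) \<bullet> v) / (v \<bullet> v))" for z
  have L: "L (\<pi> w) = l"
    if "w \<in> Q" "\<And>w'. w' \<in> Q \<Longrightarrow> \<pi> w' = \<pi> w \<Longrightarrow> w' = w" "q (p' + w) - q (p + w) = l *\<^sub>R v" for w l
  proof -
    have "(SOME w'. w' \<in> Q \<and> \<pi> w' = \<pi> w) = w" using that by (intro some_equality) auto
    then show ?thesis using that(3) v0 by (simp add: L_def)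
  qed
  have in_face: "w' \<in> max_face c Q" if "c \<in> C" "w \<in> max_face c Q" "w' \<in> Q" "\<pi> w' = \<pi> w" for c w w'
  proof -
    have "c \<bullet> w' = c \<bullet> w" using inner\<pi>[OF Cv[OF that(1)]] that(4) by metis
    then show ?thesis using that by (auto simp: max_face_def)
  qed
  have step: "L x = L y" if c: "c \<in> C" and xy: "closed_segment x y edge_of max_face c ?Q" for c x y
  proof -
    let ?H = "max_face c ?Q"
    have H: "polytope ?H" using Q' polytope_max_face by blast
    have xyne: "x \<noteq> y" using edge_of_endpoints(1)[OF xy] .
    obtain d0 where d0: "closed_segment x y = max_face d0 ?H"
      using face_of_polytope_max_face[OF H, of "closed_segment x y"] xy unfolding edge_of_def by auto
    \<comment> \<open>Projecting \<open>d0\<close> does not change its values on the projected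
      polytope, and makes it vanish on \<open>v\<close>, so that the perturbed functional still
      exposes the edge of \<open>P\<close>.\<close>
    define d where "d = \<pi> d0"
    have dv: "d \<bullet> v = 0" unfolding d_def by (rule orth)
    have "d \<bullet> z = d0 \<bullet> z" if "z \<in> ?H" for z
      using that idem unfolding d_def adj by (auto simp: max_face_def)
    then have d: "max_face d ?H = closed_segment x y"
      unfolding d0 by (auto simp: max_face_def[of _ ?H])
    have "\<forall>\<^sub>F \<epsilon> in at_right 0. max_face (c + \<epsilon> *\<^sub>R d) P = max_face d (max_face c P) \<and>
        max_face (c + \<epsilon> *\<^sub>R d) ?Q = max_face d (max_face c ?Q)"
      using eventually_max_face_perturb P(1) Q'(1) by (intro eventually_conj) auto
    then obtain \<epsilon> where eps: "max_face (c + \<epsilon> *\<^sub>R d) P = max_face d (max_face c P)"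
        "max_face (c + \<epsilon> *\<^sub>R d) ?Q = max_face d (max_face c ?Q)"
      using eventually_happens'[OF trivial_limit_at_right_real] by blast
    define c' where "c' = c + \<epsilon> *\<^sub>R d"
    have c'P: "max_face c' P = closed_segment p p'"
    proof -
      have "max_face c' P = max_face d (closed_segment p p')" using eps(1) c by (simp add: c'_def C_def)
      also have "\<dots> = closed_segment p p'"
        using dv by (intro max_face_segment_orthogonal) (simp add: v_def inner_diff_right)
      finally show ?thesis .
    qed
    then have c'C: "c' \<in> C" by (simp add: C_def)
    let ?G = "max_face c' Q"
    have \<pi>G: "\<pi> ` ?G = closed_segment x y"
      using mfQ[OF Cv[OF c'C]] eps(2) d by (simp add: c'_def)
    have "x \<in> \<pi> ` ?G" "y \<in> \<pi> ` ?G" unfolding \<pi>G by auto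
    then obtain g1 g2 where g1: "g1 \<in> ?G" "\<pi> g1 = x" and g2: "g2 \<in> ?G" "\<pi> g2 = y" by blast
    have param: "\<exists>t s. 0 \<le> t \<and> t \<le> 1 \<and> g - g1 = t *\<^sub>R (g2 - g1) + s *\<^sub>R v" if "g \<in> ?G" for g
    proof -
      have "\<pi> g \<in> closed_segment x y" using that \<pi>G by blast
      then obtain t where t: "0 \<le> t" "t \<le> 1" "\<pi> g = (1 - t) *\<^sub>R x + t *\<^sub>R y" by (auto simp: in_segment)
      have "\<pi> g = \<pi> (g1 + t *\<^sub>R (g2 - g1))"
        using t(3) g1 g2 lin by (simp add: linear_add linear_scale linear_diff algebra_simps)
      then obtain s where "g - (g1 + t *\<^sub>R (g2 - g1)) = s *\<^sub>R v" using ker by blast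
      then have "g - g1 = t *\<^sub>R (g2 - g1) + s *\<^sub>R v" by (simp add: algebra_simps)
      then show ?thesis using t by blast
    qed
    have indep: "r = 0" if "s *\<^sub>R v = r *\<^sub>R (g2 - g1)" for s r
    proof -
      have "r *\<^sub>R (y - x) = \<pi> (s *\<^sub>R v)" unfolding that using lin g1 g2 by (simp add: linear_scale linear_diff)
      also have "\<dots> = 0" using v0 by (simp add: \<pi>_def)
      finally show ?thesis using xyne by simp
    qed
    \<comment> \<open>A point of the face off the line through \<open>g1\<close> and
      \<open>g2\<close> would make it a 2-face of \<open>Q\<close> parallel to \<open>v\<close>;
      here 2-genericity of the edge directions of \<open>P\<close> is used.\<close>
    have s0: "s = 0" if g: "g \<in> ?G" "g - g1 = t *\<^sub>R (g2 - g1) + s *\<^sub>R v" for g t s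
    proof (rule ccontr)
      assume s: "s \<noteq> 0"
      have G: "polytope ?G" by (simp add: Q polytope_max_face)
      have "?G \<subseteq> affine hull {g1, g2, g1 + v}"
      proof
        fix h assume "h \<in> ?G"
        then obtain t' s' where h: "h - g1 = t' *\<^sub>R (g2 - g1) + s' *\<^sub>R v" using param by blast
        have "h = g1 + (h - g1)" by simp
        also have "\<dots> = (1 - t' - s') *\<^sub>R g1 + t' *\<^sub>R g2 + s' *\<^sub>R (g1 + v)" unfolding h by (simp add: algebra_simps)
        finally show "h \<in> affine hull {g1, g2, g1 + v}" unfolding affine_hull_3 by force
      qed
      then have "aff_dim ?G \<le> aff_dim {g1, g2, g1 + v}"
        using aff_dim_subset[of ?G "affine hull {g1, g2, g1 + v}"] by (simp only: aff_dim_affine_hull)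
      also have "\<dots> \<le> int (card {g1, g2, g1 + v}) - 1" by (intro aff_dim_le_card) auto
      also have "\<dots> \<le> 2" by (simp add: card_insert_if)
      finally have "aff_dim ?G \<le> 2" .
      moreover have "\<not> aff_dim ?G \<le> 1"
      proof
        assume "aff_dim ?G \<le> 1"
        then have "collinear ?G" using collinear_aff_dim by blast
        then obtain u where u: "\<And>a b. a \<in> ?G \<Longrightarrow> b \<in> ?G \<Longrightarrow> \<exists>k. a - b = k *\<^sub>R u" unfolding collinear_def by blast
        obtain k1 where k1: "g2 - g1 = k1 *\<^sub>R u" using u g1 g2 by blast
        obtain k2 where k2: "g - g1 = k2 *\<^sub>R u" using u g1 g by blast
        have "k1 \<noteq> 0" using k1 g1 g2 xyne by auto
        then have "g - g1 = (k2 / k1) *\<^sub>R (g2 - g1)" using k1 k2 by simp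
        then have "s *\<^sub>R v = (k2 / k1 - t) *\<^sub>R (g2 - g1)" using g(2) by (simp add: algebra_simps)
        then have "k2 / k1 - t = 0" by (rule indep)
        with \<open>s *\<^sub>R v = _\<close> s v0 show False by simp
      qed
      ultimately have "aff_dim ?G = 2" by linarith
      then have "\<not> two_generic v Q"
      proof (rule parallel_two_face_not_two_generic[OF Q(1) max_face_face_of[OF polytope_imp_convex[OF Q(1)]]])
        fix f assume f: "\<And>a b. a \<in> ?G \<Longrightarrow> b \<in> ?G \<Longrightarrow> f \<bullet> a = f \<bullet> b"
        have "f \<bullet> (g - g1) = t * (f \<bullet> (g2 - g1)) + s * (f \<bullet> v)" unfolding g(2) by (simp add: inner_add_right)
        moreover have "f \<bullet> (g - g1) = 0" "f \<bullet> (g2 - g1) = 0"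
          using f[OF g(1) g1(1)] f[OF g2(1) g1(1)] by (simp_all add: inner_diff_right)
        ultimately show "f \<bullet> v = 0" using s by simp
      qed
      then show False using pair e unfolding parallelogramic_pair_def edges_def v_def by blast
    qed
    have "?G = closed_segment g1 g2"
    proof
      show "?G \<subseteq> closed_segment g1 g2"
      proof
        fix g assume g: "g \<in> ?G"
        obtain t s where ts: "0 \<le> t" "t \<le> 1" "g - g1 = t *\<^sub>R (g2 - g1) + s *\<^sub>R v" using param[OF g] by blast
        have "g = g1 + (g - g1)" by simp
        also have "\<dots> = (1 - t) *\<^sub>R g1 + t *\<^sub>R g2"
          unfolding ts(3) using s0[OF g ts(3)] by (simp add: algebra_simps)
        finally show "g \<in> closed_segment g1 g2" using ts by (auto simp: in_segment)
      qed
      show "closed_segment g1 g2 \<subseteq> ?G"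
        using g1 g2 polytope_max_face[OF Q(1)] by (intro closed_segment_subset polytope_imp_convex) auto
    qed
    moreover have "g1 \<noteq> g2" using g1 g2 xyne by auto
    ultimately obtain l where l: "q (p' + g1) - q (p + g1) = l *\<^sub>R v" "q (p' + g2) - q (p + g2) = l *\<^sub>R v"
      using parallelogram[OF q c'P _ ne] unfolding v_def by blast
    \<comment> \<open>The fibres over this edge of the projection are single points, so the choice
      in \<open>L\<close> returns the point itself.\<close>
    have uniq: "w' = w" if w: "w \<in> ?G" "w' \<in> Q" "\<pi> w' = \<pi> w" for w w'
    proof -
      have w': "w' \<in> ?G" using in_face[OF c'C w] .
      obtain t where t: "w - g1 = t *\<^sub>R (g2 - g1)" using param[OF w(1)] s0[OF w(1)] by fastforce
      obtain t' where t': "w' - g1 = t' *\<^sub>R (g2 - g1)" using param[OF w'] s0[OF w'] by fastforce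
      obtain s where s: "w' - w = s *\<^sub>R v" using ker w(3) by blast
      have "s *\<^sub>R v = (w' - g1) - (w - g1)" using s by simp
      also have "\<dots> = (t' - t) *\<^sub>R (g2 - g1)" unfolding t t' by (simp add: scaleR_left_diff_distrib)
      finally have "t' - t = 0" by (rule indep)
      then have "w' - g1 = w - g1" using t t' by simp
      then show ?thesis by simp
    qed
    have "L (\<pi> g1) = l" by (rule L[OF subsetD[OF max_face_subset g1(1)] uniq[OF g1(1)] l(1)])
    moreover have "L (\<pi> g2) = l" by (rule L[OF subsetD[OF max_face_subset g2(1)] uniq[OF g2(1)] l(2)])
    ultimately show ?thesis using g1 g2 by simp
  qed
  \<comment> \<open>The coefficient as seen by \<open>c\<close>; by \<open>step\<close> every vertex
    of the exposed face of the projection gives the same value.\<close>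
  define \<Lambda> where "\<Lambda> c = L (SOME z. z extreme_point_of max_face c ?Q)" for c
  have vert: "\<exists>z. z extreme_point_of max_face c ?Q" for c
    using polytope_extreme_exists polytope_max_face max_face_nonempty Q' by metis
  have \<Lambda>: "\<Lambda> c = L z" if c: "c \<in> C" and z: "z extreme_point_of max_face c ?Q" for c z
    unfolding \<Lambda>_def
    using connected_vertices[OF polytope_max_face[OF Q'(1)] someI_ex[OF vert] z, of L] step[OF c] by blast
  have "\<Lambda> constant_on C"
  proof (rule locally_constant_imp_constant)
    show "connected C"
      unfolding C_def by (intro convex_connected convex_exposing_functionals) auto
    fix c assume c: "c \<in> C"
    \<comment> \<open>Near \<open>c\<close> the exposed faces of the projection shrink into that of
      \<open>c\<close>, so a vertex used for \<open>c'\<close> can also be used for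
      \<open>c\<close>.\<close>
    obtain U where U: "open U" "c \<in> U" "\<And>c'. c' \<in> U \<Longrightarrow> max_face c' ?Q \<subseteq> max_face c ?Q"
      using eventually_max_face_subset[OF Q'(1), of c] unfolding eventually_nhds by blast
    have "\<Lambda> c' = \<Lambda> c" if c': "c' \<in> C \<inter> U" for c'
    proof -
      obtain z where z: "z extreme_point_of max_face c' ?Q" using vert by blast
      then have "z extreme_point_of ?Q" "z \<in> max_face c' ?Q"
        using extreme_point_of_max_face[OF polytope_imp_convex[OF Q'(1)]] by auto
      then have "z extreme_point_of max_face c ?Q"
        using extreme_point_of_max_face[OF polytope_imp_convex[OF Q'(1)]] U(3) c' by blast
      then show ?thesis using \<Lambda> c c' z by auto
    qed
    moreover have "openin (top_of_set C) (C \<inter> U)" using U(1) by (rule openin_open_Int)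
    ultimately show "\<exists>T. openin (top_of_set C) T \<and> c \<in> T \<and> (\<forall>x\<in>T. \<Lambda> x = \<Lambda> c)"
      using c U(2) by blast
  qed
  then obtain l where l: "\<And>c. c \<in> C \<Longrightarrow> \<Lambda> c = l" unfolding constant_on_def by blast
  have coeff: "\<exists>k\<ge>0. q (p' + w) - q (p + w) = k *\<^sub>R v \<and> k = l"
    if c: "max_face c P = closed_segment p p'" "max_face c Q = {w}" for c w
  proof -
    have cC: "c \<in> C" using c by (simp add: C_def)
    have "closed_segment (p + w) (p' + w) edge_of (P + Q)" using edge_plus_vertex c ne by blast
    then have "closed_segment (p' + w) (p + w) edge_of (P + Q)" by (simp add: closed_segment_commute)
    from q[OF this] obtain k where k: "0 \<le> k" "q (p' + w) - q (p + w) = k *\<^sub>R v" unfolding v_def by auto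
    have w: "w \<in> max_face c Q" using c by simp
    have "L (\<pi> w) = k" using w in_face[OF cC w] c(2) k(2) max_face_subset by (intro L) blast+
    moreover have "\<Lambda> c = L (\<pi> w)" using mfQ[OF Cv[OF cC]] c(2) by (intro \<Lambda> cC) simp
    ultimately show ?thesis using l[OF cC] k by auto
  qed
  show ?thesis
  proof (cases "\<exists>c w. max_face c P = closed_segment p p' \<and> max_face c Q = {w}")
    case True
    then have "0 \<le> l" using coeff by blast
    then show ?thesis using coeff unfolding v_def by blast
  next
    case False
    \<comment> \<open>Without such functionals the condition is vacuous, and 0 is taken to meet the
      sign requirement.\<close>
    then show ?thesis by (intro exI[of _ 0]) auto
  qed
qed

text \<open>The scaled edge vectors \<phi> form a cocycle: on a 2-face they are the increments of
  \<open>q\<close> on its translate in \<open>P + Q\<close>. Integration yields the vertex map of a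
  deformation of \<open>P\<close>, and indecomposability turns that map into a dilation with
  translation, whose factor is \<open>l\<close>.\<close>

lemma indecomposable_edge_coefficient:
  assumes q: "\<And>x y. closed_segment x y edge_of (P + Q) \<Longrightarrow> \<exists>l\<ge>0. q x - q y = l *\<^sub>R (x - y)"
    and ind: "indecomposable P"
  obtains l where "0 \<le> l" "\<And>c w x y. max_face c P = closed_segment x y \<Longrightarrow> x \<noteq> y \<Longrightarrow> max_face c Q = {w} \<Longrightarrow>
    q (x + w) - q (y + w) = l *\<^sub>R (x - y)"
proof -
  have "\<forall>x y. \<exists>l. closed_segment x y edge_of P \<longrightarrow> 0 \<le> l \<and> (\<forall>c w. max_face c P = closed_segment x y \<longrightarrow>
      max_face c Q = {w} \<longrightarrow> q (x + w) - q (y + w) = l *\<^sub>R (x - y))"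
  proof (intro allI)
    fix x y
    show "\<exists>l. closed_segment x y edge_of P \<longrightarrow> 0 \<le> l \<and> (\<forall>c w. max_face c P = closed_segment x y \<longrightarrow>
      max_face c Q = {w} \<longrightarrow> q (x + w) - q (y + w) = l *\<^sub>R (x - y))"
    proof (cases "closed_segment x y edge_of P")
      case True
      then have "closed_segment y x edge_of P" by (simp add: closed_segment_commute)
      from edge_coefficient[OF q this] show ?thesis by (auto simp: closed_segment_commute)
    qed simp
  qed
  then obtain k where k: "\<And>x y. closed_segment x y edge_of P \<Longrightarrow> 0 \<le> k x y"
    "\<And>x y c w. closed_segment x y edge_of P \<Longrightarrow> max_face c P = closed_segment x y \<Longrightarrow>
      max_face c Q = {w} \<Longrightarrow> q (x + w) - q (y + w) = k x y *\<^sub>R (x - y)" by metis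
  define \<phi> where "\<phi> x y = k x y *\<^sub>R (x - y)" for x y
  note conv = polytope_imp_convex[OF P(1)]
  have expose: "\<exists>c w. max_face c P = closed_segment x y \<and> max_face c Q = {w}"
    if e: "closed_segment x y edge_of P" for x y
  proof -
    obtain c where "closed_segment x y = max_face c P"
      using face_of_polytope_max_face[OF P(1), of "closed_segment x y"] e unfolding edge_of_def by auto
    then show ?thesis using edge_exposed_with_vertex[of c x y] e by metis
  qed
  obtain u where u: "\<And>x y. closed_segment x y edge_of P \<Longrightarrow> u x - u y = \<phi> x y"
  proof (rule potential_from_two_faces[OF P(1), of \<phi>])
    fix x y assume e: "closed_segment x y edge_of P"
    obtain c w where c: "max_face c P = closed_segment x y" "max_face c Q = {w}" using expose[OF e] by blast
    then have "q (x + w) - q (y + w) = \<phi> x y" unfolding \<phi>_def using k(2) e by blast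
    moreover have "q (y + w) - q (x + w) = \<phi> y x"
      unfolding \<phi>_def using k(2)[of y x c w] e c closed_segment_commute by metis
    ultimately show "\<phi> y x = - \<phi> x y" by (metis minus_diff_eq)
  next
    fix F assume F: "F face_of P" "aff_dim F = 2"
    obtain c w where c: "max_face c P = F" "max_face c Q = {w}" using two_face_exposed_with_vertex[OF F] by blast
    have "q (x + w) - q (y + w) = \<phi> x y" if e: "closed_segment x y edge_of F" for x y
    proof -
      have pF: "polytope F" using F P face_of_polytope_polytope by blast
      \<comment> \<open>Perturbing by a functional that exposes the edge within \<open>F\<close>
        keeps the vertex \<open>w\<close> of \<open>Q\<close>, so a single translation vector serves
        all edges of \<open>F\<close>.\<close>
      obtain d where d: "closed_segment x y = max_face d F"
        using face_of_polytope_max_face[OF pF, of "closed_segment x y"] e unfolding edge_of_def by auto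
      have "\<forall>\<^sub>F \<epsilon> in at_right 0. max_face (c + \<epsilon> *\<^sub>R d) P = max_face d (max_face c P) \<and>
          max_face (c + \<epsilon> *\<^sub>R d) Q = max_face d (max_face c Q)"
        using eventually_max_face_perturb P Q by (intro eventually_conj) auto
      then obtain \<epsilon> where eps: "max_face (c + \<epsilon> *\<^sub>R d) P = max_face d (max_face c P)"
          "max_face (c + \<epsilon> *\<^sub>R d) Q = max_face d (max_face c Q)"
        using eventually_happens'[OF trivial_limit_at_right_real] by blast
      have "max_face (c + \<epsilon> *\<^sub>R d) P = closed_segment x y" unfolding eps c d ..
      moreover have "max_face (c + \<epsilon> *\<^sub>R d) Q = {w}" unfolding eps c by (rule max_face_singleton)
      moreover have "closed_segment x y edge_of P" using e edge_of_face[OF F(1)] by blast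
      ultimately show ?thesis unfolding \<phi>_def using k(2) by blast
    qed
    then show "\<exists>u. \<forall>x y. closed_segment x y edge_of F \<longrightarrow> u x - u y = \<phi> x y"
      by (intro exI[of _ "\<lambda>x. q (x + w)"]) auto
  qed blast
  have u': "\<exists>l\<ge>0. u x - u y = l *\<^sub>R (x - y)" if "closed_segment x y edge_of P" for x y
    using u[OF that] k(1)[OF that] unfolding \<phi>_def by blast
  let ?R = "convex hull (u ` {x. x extreme_point_of P})"
  have "deformation ?R P" by (rule vertex_map_deformation[OF P(1) u'])
  then obtain l t where l: "0 \<le> l" "?R = (+) t ` (*\<^sub>R) l ` P" using ind unfolding indecomposable_def by blast
  \<comment> \<open>A functional exposing \<open>x\<close> turns equality of the two polytopes into
    equality of the two points it exposes.\<close>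
  have uP: "u x = t + l *\<^sub>R x" if x: "x extreme_point_of P" for x
  proof -
    obtain c where c: "max_face c P = {x}" using extreme_point_max_face P x by blast
    have "u x \<in> max_face c ?R" using c by (intro vertex_map_max_face[OF P(1) u' x]) auto
    also have "\<dots> = (+) t ` (*\<^sub>R) l ` {x}"
      unfolding l(2) max_face_translation max_face_scaleR_nonneg[OF l(1) P(1)] c ..
    finally show ?thesis by simp
  qed
  show thesis
  proof (rule that[OF l(1)])
    fix c w x y assume c: "max_face c P = closed_segment x y" "x \<noteq> y" "max_face c Q = {w}"
    then have e: "closed_segment x y edge_of P"
      using max_face_face_of[OF conv, of c] by (auto simp: edge_of_def aff_dim_closed_segment)
    have "q (x + w) - q (y + w) = u x - u y" using k(2)[OF e c(1,3)] u[OF e] unfolding \<phi>_def by simp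
    also have "\<dots> = l *\<^sub>R (x - y)" using uP edge_of_endpoints[OF e] by (simp add: algebra_simps)
    finally show "q (x + w) - q (y + w) = l *\<^sub>R (x - y)" .
  qed
qed

end

section \<open>Edge-deformation vectors\<close>

text \<open>\<open>q z\<close> lies on the translated dilate of the edge; a functional exposing
  \<open>z\<close> in \<open>S\<close> forces it to be the end that corresponds to
  \<open>z\<close>.\<close>

lemma vertex_map_edge:
  fixes S :: "'a::euclidean_space set"
  assumes S: "polytope S"
    and q: "\<And>c p. p extreme_point_of S \<Longrightarrow> p \<in> max_face c S \<Longrightarrow> q p \<in> max_face c R"
    and e: "max_face c S = closed_segment z z'" "z \<noteq> z'"
    and l: "0 \<le> l" and face: "max_face c R = (+) t ` (*\<^sub>R) l ` closed_segment z z'"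
  shows "q z = t + l *\<^sub>R z"
proof -
  have zz': "closed_segment z z' edge_of S"
    using max_face_face_of[OF polytope_imp_convex[OF S], of c] e by (auto simp: edge_of_def aff_dim_closed_segment)
  note zS = edge_of_endpoints[OF zz']
  have "z \<in> max_face c S" unfolding e(1) by simp
  then have "q z \<in> (+) t ` (*\<^sub>R) l ` closed_segment z z'"
    using q[OF zS(2)] unfolding face[symmetric] by blast
  then obtain y where y: "y \<in> closed_segment z z'" "q z = t + l *\<^sub>R y" by auto
  obtain d where d: "max_face d S = {z}" using extreme_point_max_face S zS by blast
  have "t + l *\<^sub>R z \<in> max_face c R" unfolding face by (intro imageI) simp
  then have "t + l *\<^sub>R z \<in> R" using max_face_subset by blast
  moreover have "q z \<in> max_face d R" using q[OF zS(2)] d by simp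
  ultimately have "d \<bullet> (t + l *\<^sub>R z) \<le> d \<bullet> q z" by (rule max_face_inner_le[rotated])
  then have le: "l * (d \<bullet> z) \<le> l * (d \<bullet> y)" unfolding y(2) by (simp add: inner_add_right)
  show ?thesis
  proof (cases "l = 0 \<or> y = z")
    case False
    then have "0 < l" using l by simp
    have "y \<in> S" using y(1) zz' edge_of_imp_subset by blast
    then have "d \<bullet> y < d \<bullet> z" using False d max_face_inner_less[of z d S y] by auto
    then show ?thesis using le \<open>0 < l\<close> by simp
  qed (use y in auto)
qed

text \<open>Both definite descriptions in the definitions are resolved here; from then on
  coefficients are computed from exposed faces alone.\<close>

lemma edge_deformation_vector_eqI:
  fixes S :: "'a::euclidean_space set"
  assumes S: "polytope S" "S \<noteq> {}" and R: "deformation R S"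
    and e: "max_face c S = closed_segment s s'" "s \<noteq> s'"
    and l: "0 \<le> l" and face: "max_face c R = (+) t ` (*\<^sub>R) l ` closed_segment s s'"
  shows "edge_deformation_vector S R (closed_segment s s') = l"
proof -
  note conv = polytope_imp_convex[OF S(1)]
  have edge: "closed_segment s s' edge_of S"
    using max_face_face_of[OF conv, of c] e by (auto simp: edge_of_def aff_dim_closed_segment)
  obtain q where q:
    "\<And>c p. p extreme_point_of S \<Longrightarrow> p \<in> max_face c S \<Longrightarrow> q p \<in> max_face c R"
    "\<And>c p. max_face c S = {p} \<Longrightarrow> max_face c R = {q p}"
    using deformation_vertex_map[OF S R] by metis
  have convR: "convex R" using R polytope_imp_convex unfolding deformation_def by blast
  have assoc: "assoc_vertex S R p = q p" if p: "p extreme_point_of S" for p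
    unfolding assoc_vertex_def
  proof (rule the_equality)
    obtain c where c: "max_face c S = {p}" using extreme_point_max_face S p by blast
    then show "q p extreme_point_of R \<and> (\<forall>c. max_face c S = {p} \<longrightarrow> max_face c R = {q p})"
      using q(2) max_face_singleton_extreme[OF convR] by blast
    fix x assume "x extreme_point_of R \<and> (\<forall>c. max_face c S = {p} \<longrightarrow> max_face c R = {x})"
    then show "x = q p" using q(2)[OF c] c by auto
  qed
  have qz: "q z = t + l *\<^sub>R z" if z: "closed_segment z z' = closed_segment s s'" for z z'
  proof (rule vertex_map_edge[OF S(1) q(1) _ _ l])
    show "max_face c S = closed_segment z z'" "max_face c R = (+) t ` (*\<^sub>R) l ` closed_segment z z'"
      unfolding z by (fact e(1) face)+
    have "closed_segment z z' edge_of S" using edge by (simp only: z)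
    then show "z \<noteq> z'" by (rule edge_of_endpoints(1))
  qed
  show ?thesis
    unfolding edge_deformation_vector_def
  proof (simp only: edges_def mem_Collect_eq edge if_True, rule the_equality)
    show "0 \<le> l \<and> (\<forall>p p'. closed_segment s s' = closed_segment p p' \<longrightarrow>
        assoc_vertex S R p - assoc_vertex S R p' = l *\<^sub>R (p - p'))"
    proof (intro conjI allI impI l)
      fix p p' assume eq: "closed_segment s s' = closed_segment p p'"
      then have "closed_segment p p' edge_of S" using edge by (simp only:)
      note ext = edge_of_endpoints[OF this]
      have "q p = t + l *\<^sub>R p" "q p' = t + l *\<^sub>R p'"
        using qz[of p p'] qz[of p' p] eq closed_segment_commute by metis+
      then show "assoc_vertex S R p - assoc_vertex S R p' = l *\<^sub>R (p - p')"
        using assoc ext by (simp add: algebra_simps)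
    qed
    fix l' assume "0 \<le> l' \<and> (\<forall>p p'. closed_segment s s' = closed_segment p p' \<longrightarrow>
        assoc_vertex S R p - assoc_vertex S R p' = l' *\<^sub>R (p - p'))"
    then have "assoc_vertex S R s - assoc_vertex S R s' = l' *\<^sub>R (s - s')" by blast
    moreover have "q s = t + l *\<^sub>R s" "q s' = t + l *\<^sub>R s'"
      using qz[of s s'] qz[of s' s] closed_segment_commute by metis+
    then have "assoc_vertex S R s - assoc_vertex S R s' = l *\<^sub>R (s - s')"
      using assoc edge_of_endpoints[OF edge] by (simp add: algebra_simps)
    ultimately have "(l' - l) *\<^sub>R (s - s') = 0" by (auto simp: scaleR_left_diff_distrib)
    then show "l' = l" using e(2) by simp
  qed
qed

section \<open>Minkowski sums of dilates\<close>

lemma scaleR_set_plus: "(*\<^sub>R) c ` (A + B) = (*\<^sub>R) c ` A + (*\<^sub>R) c ` (B :: 'a::real_vector set)"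
proof
  show "(*\<^sub>R) c ` (A + B) \<subseteq> (*\<^sub>R) c ` A + (*\<^sub>R) c ` B"
    by (auto elim!: set_plus_elim simp: scaleR_add_right intro!: set_plus_intro)
  show "(*\<^sub>R) c ` A + (*\<^sub>R) c ` B \<subseteq> (*\<^sub>R) c ` (A + B)"
  proof
    fix x assume "x \<in> (*\<^sub>R) c ` A + (*\<^sub>R) c ` B"
    then obtain a b where "a \<in> A" "b \<in> B" "x = c *\<^sub>R a + c *\<^sub>R b" by (auto elim!: set_plus_elim)
    then show "x \<in> (*\<^sub>R) c ` (A + B)" by (intro image_eqI[of _ _ "a + b"]) (auto simp: scaleR_add_right)
  qed
qed

lemma scaleR_set_sum: "(*\<^sub>R) c ` (\<Sum>i\<in>I. A i) = (\<Sum>i\<in>I. (*\<^sub>R) c ` (A i :: 'a::real_vector set))"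
  by (induction I rule: infinite_finite_induct) (simp_all add: scaleR_set_plus set_zero)

lemma translation_set_sum:
  fixes A :: "'i \<Rightarrow> 'a::ab_group_add set"
  assumes "finite I"
  shows "(\<Sum>i\<in>I. (+) (t i) ` A i) = (+) (\<Sum>i\<in>I. t i) ` (\<Sum>i\<in>I. A i)"
  using assms
proof (induction I rule: finite_induct)
  case (insert i I)
  have split: "{t i + (\<Sum>i\<in>I. t i)} = {t i} + {\<Sum>i\<in>I. t i}" by (simp add: set_plus_def)
  show ?case
    unfolding sum.insert[OF insert.hyps] insert.IH
    unfolding translation_eq_singleton_plus split
    by (simp only: ac_simps)
qed simp

lemma set_sum_nonempty: "(\<And>i. i \<in> I \<Longrightarrow> A i \<noteq> {}) \<Longrightarrow> (\<Sum>i\<in>I. A i :: 'a::comm_monoid_add set) \<noteq> {}"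
  by (induction I rule: infinite_finite_induct) (auto simp: set_plus_def set_zero)

lemma set_plus_singletonD:
  fixes A B :: "'a::ab_group_add set"
  assumes "A + B = {w}"
  obtains a where "A = {a}"
proof -
  have "A \<noteq> {}" "B \<noteq> {}" using assms by auto
  then obtain a b where ab: "a \<in> A" "b \<in> B" by blast
  have "x = a" if "x \<in> A" for x
  proof -
    have "x + b \<in> A + B" "a + b \<in> A + B" using that ab by auto
    then have "x + b = a + b" unfolding assms by simp
    then show ?thesis by simp
  qed
  then show thesis using that ab by blast
qed

lemma set_sum_singletonD:
  fixes A :: "'i \<Rightarrow> 'a::ab_group_add set"
  assumes "finite I" "(\<Sum>i\<in>I. A i) = {w}" "i \<in> I"
  obtains a where "A i = {a}"
  using assms set_plus_singletonD[of "A i" "\<Sum>j\<in>I - {i}. A j"] by (metis sum.remove)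

lemma set_sum_singletons:
  assumes "\<And>i. i \<in> I \<Longrightarrow> \<exists>a. A i = {a}"
  shows "\<exists>a. (\<Sum>i\<in>I. A i :: 'a::comm_monoid_add set) = {a}"
  using assms
proof (induction I rule: infinite_finite_induct)
  case (insert i I)
  have "\<exists>a. A i = {a}" "\<exists>b. (\<Sum>i\<in>I. A i) = {b}" using insert by simp_all
  then obtain a b where "A i = {a}" "(\<Sum>i\<in>I. A i) = {b}" by blast
  then show ?case using insert by (auto simp: set_plus_def)
qed (auto simp: set_zero)

lemma convex_split:
  fixes A :: "'a::real_vector set"
  assumes "convex A" "0 \<le> a" "a \<le> 1"
  shows "A = (*\<^sub>R) a ` A + (*\<^sub>R) (1 - a) ` A"
proof
  show "A \<subseteq> (*\<^sub>R) a ` A + (*\<^sub>R) (1 - a) ` A"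
  proof
    fix x assume "x \<in> A"
    then have "a *\<^sub>R x + (1 - a) *\<^sub>R x \<in> (*\<^sub>R) a ` A + (*\<^sub>R) (1 - a) ` A" by auto
    then show "x \<in> (*\<^sub>R) a ` A + (*\<^sub>R) (1 - a) ` A" by (simp add: algebra_simps)
  qed
  show "(*\<^sub>R) a ` A + (*\<^sub>R) (1 - a) ` A \<subseteq> A"
    using assms by (auto simp: set_plus_def intro!: convexD)
qed

lemma deformation_translation:
  assumes "deformation R S"
  shows "deformation ((+) t ` R) S"
proof -
  obtain l R' where l: "0 < l" "polytope R'" "S = (*\<^sub>R) l ` R + R'" and R: "polytope R"
    using assms unfolding deformation_def by blast
  have 0: "(*\<^sub>R) l ` {t} + {- (l *\<^sub>R t)} = 0" by (simp add: set_plus_def set_zero)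
  have "(*\<^sub>R) l ` ((+) t ` R) + (+) (- (l *\<^sub>R t)) ` R' =
      ((*\<^sub>R) l ` {t} + {- (l *\<^sub>R t)}) + ((*\<^sub>R) l ` R + R')"
    unfolding translation_eq_singleton_plus scaleR_set_plus by (simp only: ac_simps)
  then have "S = (*\<^sub>R) l ` ((+) t ` R) + (+) (- (l *\<^sub>R t)) ` R'"
    unfolding 0 l(3) by simp
  then show ?thesis
    unfolding deformation_def using l R polytope_translation_eq by blast
qed

lemma deformation_trans_summand:
  assumes "deformation (A + B) S" "polytope A" "polytope B"
  shows "deformation A S"
proof -
  obtain l R' where l: "0 < l" "polytope R'" "S = (*\<^sub>R) l ` (A + B) + R'"
    using assms unfolding deformation_def by blast
  have "S = (*\<^sub>R) l ` A + ((*\<^sub>R) l ` B + R')" unfolding l(3) scaleR_set_plus by (simp add: add.assoc)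
  moreover have "polytope ((*\<^sub>R) l ` B + R')" using assms l polytope_scaling polytope_set_plus by blast
  ultimately show ?thesis unfolding deformation_def using l(1) assms(2) by blast
qed

lemma deformation_sum_scaled:
  fixes P :: "'i \<Rightarrow> 'a::euclidean_space set"
  assumes I: "finite I" "\<And>i. i \<in> I \<Longrightarrow> polytope (P i)" and \<alpha>: "\<And>i. i \<in> I \<Longrightarrow> 0 \<le> \<alpha> i"
  shows "deformation (\<Sum>i\<in>I. (*\<^sub>R) (\<alpha> i) ` P i) (\<Sum>i\<in>I. P i)"
proof -
  \<comment> \<open>\<open>M\<close> is positive and dominates every \<alpha> i, so by convexity
    each \<open>P i\<close> splits into its dilate by \<open>\<alpha> i / M\<close> and a
    remainder.\<close>
  define M where "M = 1 + (\<Sum>i\<in>I. \<alpha> i)"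
  have M: "0 < M" unfolding M_def using \<alpha> by (simp add: sum_nonneg add_pos_nonneg)
  have \<alpha>M: "0 \<le> \<alpha> i / M" "\<alpha> i / M \<le> 1" if "i \<in> I" for i
    using \<alpha>[OF that] M member_le_sum[of i I \<alpha>] that \<alpha> I(1) by (auto simp: M_def divide_le_eq_1)
  have "(\<Sum>i\<in>I. P i) = (\<Sum>i\<in>I. (*\<^sub>R) (\<alpha> i / M) ` P i + (*\<^sub>R) (1 - \<alpha> i / M) ` P i)"
    using convex_split[OF polytope_imp_convex[OF I(2)] \<alpha>M] by (intro sum.cong) auto
  also have "\<dots> = (\<Sum>i\<in>I. (*\<^sub>R) (\<alpha> i / M) ` P i) + (\<Sum>i\<in>I. (*\<^sub>R) (1 - \<alpha> i / M) ` P i)"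
    by (rule sum.distrib)
  also have "(\<Sum>i\<in>I. (*\<^sub>R) (\<alpha> i / M) ` P i) = (*\<^sub>R) (1 / M) ` (\<Sum>i\<in>I. (*\<^sub>R) (\<alpha> i) ` P i)"
    unfolding scaleR_set_sum by (simp add: image_image)
  finally show ?thesis
    unfolding deformation_def using M I(2)
    by (intro conjI exI[of _ "1 / M"] exI[of _ "\<Sum>i\<in>I. (*\<^sub>R) (1 - \<alpha> i / M) ` P i"] polytope_sum polytope_scaling) auto
qed

section \<open>Sums in parallelogramic position\<close>

text \<open>The edge extends to a 2-face, and the two edges in \<open>two_generic\<close> may
  coincide, the second one taken with coefficient 0.\<close>

lemma parallel_edge_not_two_generic:
  fixes P :: "'a::euclidean_space set"
  assumes P: "polytope P" "2 \<le> aff_dim P" and e: "closed_segment a b edge_of P"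
  shows "\<not> two_generic (t *\<^sub>R (b - a)) P"
proof -
  have "closed_segment a b face_of P" "aff_dim (closed_segment a b) \<le> 2" using e by (auto simp: edge_of_def)
  then obtain G where G: "G face_of P" "closed_segment a b \<subseteq> G" "aff_dim G = 2"
    using face_chain[OF P(1), of "closed_segment a b" 2] P(2) by auto
  have "t *\<^sub>R (b - a) = t *\<^sub>R (b - a) + 0 *\<^sub>R (b - a)" by simp
  then show ?thesis unfolding two_generic_def edges_def using G e by blast
qed

text \<open>\<open>dim1\<close> gives each summand an edge, hence a coordinate of the deformation
  cone. \<open>dim2\<close> is what rules out parallel segments among the summands when every 2-face
  condition is vacuous.\<close>

locale parallelogramic_family =
  fixes I :: "nat set" and P :: "nat \<Rightarrow> 'a::euclidean_space set"
  assumes finI: "finite I"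
    and pol: "\<And>i. i \<in> I \<Longrightarrow> polytope (P i)"
    and dim1: "\<And>i. i \<in> I \<Longrightarrow> 1 \<le> aff_dim (P i)"
    and indec: "\<And>i. i \<in> I \<Longrightarrow> indecomposable (P i)"
    and position: "parallelogramic_position I P"
    and dim2: "2 \<le> card I \<Longrightarrow> 2 \<le> aff_dim (\<Sum>i\<in>I. P i)"
begin

definition S where "S = (\<Sum>i\<in>I. P i)"

definition Q where "Q i = (\<Sum>j\<in>I - {i}. P j)"

lemma ne: "i \<in> I \<Longrightarrow> P i \<noteq> {}"
  using dim1 by force

lemma S: "polytope S" "S \<noteq> {}"
  unfolding S_def using pol ne by (auto intro!: polytope_sum set_sum_nonempty)

lemma Q: "polytope (Q i)" "Q i \<noteq> {}"
proof -
  show "polytope (Q i)" unfolding Q_def using pol by (intro polytope_sum) auto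
  show "Q i \<noteq> {}" unfolding Q_def using ne by (intro set_sum_nonempty) auto
qed

lemma S_split: "i \<in> I \<Longrightarrow> S = P i + Q i"
  unfolding S_def Q_def using finI by (rule sum.remove)

text \<open>Parallel edges of \<open>P i\<close> and \<open>Q i\<close> violate genericity as soon
  as one of the two has a 2-face. Otherwise both are segments of the same direction and
  \<open>S\<close> is collinear, against \<open>dim2\<close>.\<close>

lemma summands:
  assumes i: "i \<in> I"
  shows "parallelogramic_summands (P i) (Q i)"
proof
  show "polytope (P i)" "P i \<noteq> {}" "polytope (Q i)" "Q i \<noteq> {}" using pol ne i Q by auto
  show pair: "parallelogramic_pair (P i) (Q i)" using position i unfolding parallelogramic_position_def Q_def by blast
  fix x y a b t
  assume xy: "closed_segment x y edge_of P i" and ab: "closed_segment a b edge_of Q i"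
  show "y - x \<noteq> t *\<^sub>R (b - a)"
  proof
    assume par: "y - x = t *\<^sub>R (b - a)"
    note xyP = edge_of_endpoints[OF xy] and abQ = edge_of_endpoints[OF ab]
    have "t \<noteq> 0" using par xyP by auto
    then have par': "b - a = (1 / t) *\<^sub>R (y - x)" using par by simp
    have "I \<noteq> {i}"
    proof
      assume "I = {i}"
      then have "Q i = {0}" unfolding Q_def by (simp add: set_zero)
      then show False using abQ by auto
    qed
    then have "card {i} < card I" using i finI by (intro psubset_card_mono) auto
    then have dimS: "2 \<le> aff_dim S" using dim2 by (simp add: S_def)
    have small: "aff_dim (P i) \<le> 1" "aff_dim (Q i) \<le> 1"
    proof -
      have "two_generic (b - a) (P i)" "two_generic (y - x) (Q i)"
        using pair xy ab unfolding parallelogramic_pair_def edges_def by auto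
      then have "\<not> 2 \<le> aff_dim (P i)" "\<not> 2 \<le> aff_dim (Q i)"
        using parallel_edge_not_two_generic[OF pol[OF i] _ xy, of "1 / t"]
          parallel_edge_not_two_generic[OF Q(1) _ ab, of t] par par' by metis+
      then show "aff_dim (P i) \<le> 1" "aff_dim (Q i) \<le> 1" by linarith+
    qed
    have dir: "\<exists>k. z - z' = k *\<^sub>R (b - a)"
      if A: "aff_dim A \<le> 1" "c \<in> A" "c' \<in> A" "c \<noteq> c'" "c' - c = k *\<^sub>R (b - a)" and z: "z \<in> A" "z' \<in> A"
      for A :: "'a set" and c c' k z z'
    proof -
      have "collinear A" using A(1) collinear_aff_dim by blast
      then obtain u where u: "\<And>a b. a \<in> A \<Longrightarrow> b \<in> A \<Longrightarrow> \<exists>k. a - b = k *\<^sub>R u" unfolding collinear_def by blast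
      obtain k1 where k1: "c' - c = k1 *\<^sub>R u" using u A by blast
      obtain k2 where k2: "z - z' = k2 *\<^sub>R u" using u z by blast
      have "k1 \<noteq> 0" using k1 A(4) by auto
      then have "z - z' = (k2 / k1) *\<^sub>R (c' - c)" using k1 k2 by simp
      then show ?thesis using A(5) by auto
    qed
    have "collinear S"
      unfolding collinear_def S_split[OF i]
    proof (intro exI[of _ "b - a"] ballI)
      fix z z' assume "z \<in> P i + Q i" "z' \<in> P i + Q i"
      then obtain p q p' q' where z: "p \<in> P i" "q \<in> Q i" "z = p + q" "p' \<in> P i" "q' \<in> Q i" "z' = p' + q'"
        by (metis set_plus_elim)
      obtain k where k: "p - p' = k *\<^sub>R (b - a)" using dir[OF small(1) xyP(4,5,1) par] z by blast
      obtain k' where k': "q - q' = k' *\<^sub>R (b - a)" using dir[OF small(2) abQ(4,5,1), of 1] z by auto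
      have "z - z' = (p - p') + (q - q')" using z by simp
      also have "\<dots> = (k + k') *\<^sub>R (b - a)" unfolding k k' by (simp add: scaleR_add_left)
      finally show "\<exists>k. z - z' = k *\<^sub>R (b - a)" by blast
    qed
    then show False using dimS collinear_aff_dim by force
  qed
qed

text \<open>The functional \<open>c\<close> exposes an edge of \<open>S\<close> that comes from the edge \<open>closed_segment p p'\<close> of \<open>P i\<close>.\<close>

definition exposes where
  "exposes c i p p' w \<longleftrightarrow> i \<in> I \<and> p \<noteq> p' \<and> max_face c (P i) = closed_segment p p' \<and> max_face c (Q i) = {w}"

lemma exposes_max_face:
  assumes "exposes c i p p' w"
  shows "max_face c S = closed_segment (p + w) (p' + w)" "p + w \<noteq> p' + w"
proof -
  have i: "i \<in> I" and e: "p \<noteq> p'" "max_face c (P i) = closed_segment p p'" "max_face c (Q i) = {w}"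
    using assms by (auto simp: exposes_def)
  have "max_face c S = (+) w ` closed_segment p p'"
    unfolding S_split[OF i] max_face_set_plus e by (auto simp: set_plus_def add.commute)
  also have "\<dots> = closed_segment (p + w) (p' + w)" by (metis add.commute closed_segment_translation)
  finally show "max_face c S = closed_segment (p + w) (p' + w)" .
  show "p + w \<noteq> p' + w" using e by simp
qed

text \<open>Since the faces of the other summands add up to a point, each of them is a point, and
  dilating them only translates the contribution of \<open>P i\<close>.\<close>

lemma exposes_max_face_sum:
  assumes ex: "exposes c i p p' w" and \<alpha>: "\<And>j. j \<in> I \<Longrightarrow> 0 \<le> \<alpha> j"
  shows "\<exists>t. max_face c (\<Sum>j\<in>I. (*\<^sub>R) (\<alpha> j) ` P j) = (+) t ` (*\<^sub>R) (\<alpha> i) ` closed_segment (p + w) (p' + w)"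
proof -
  have i: "i \<in> I" and e: "p \<noteq> p'" "max_face c (P i) = closed_segment p p'" "max_face c (Q i) = {w}"
    using ex by (auto simp: exposes_def)
  have "\<exists>a. (\<Sum>j\<in>I - {i}. (*\<^sub>R) (\<alpha> j) ` max_face c (P j)) = {a}"
  proof (rule set_sum_singletons)
    fix j assume j: "j \<in> I - {i}"
    have "(\<Sum>j\<in>I - {i}. max_face c (P j)) = {w}" using e(3) by (simp add: Q_def max_face_sum)
    then obtain a where "max_face c (P j) = {a}" using set_sum_singletonD j finI by (metis finite_Diff)
    then show "\<exists>a. (*\<^sub>R) (\<alpha> j) ` max_face c (P j) = {a}" by auto
  qed
  then obtain a where a: "(\<Sum>j\<in>I - {i}. (*\<^sub>R) (\<alpha> j) ` max_face c (P j)) = {a}" by blast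
  have "max_face c (\<Sum>j\<in>I. (*\<^sub>R) (\<alpha> j) ` P j) = (\<Sum>j\<in>I. (*\<^sub>R) (\<alpha> j) ` max_face c (P j))"
    unfolding max_face_sum using \<alpha> pol by (intro sum.cong refl max_face_scaleR_nonneg)
  also have "\<dots> = (*\<^sub>R) (\<alpha> i) ` closed_segment p p' + {a}"
    using sum.remove[OF finI i, of "\<lambda>j. (*\<^sub>R) (\<alpha> j) ` max_face c (P j)"] a e(2) by simp
  also have "\<dots> = (+) (a - \<alpha> i *\<^sub>R w) ` (*\<^sub>R) (\<alpha> i) ` ((+) w ` closed_segment p p')"
    by (auto simp: set_plus_def image_image algebra_simps)
  also have "(+) w ` closed_segment p p' = closed_segment (p + w) (p' + w)"
    by (metis add.commute closed_segment_translation)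
  finally show ?thesis by blast
qed

text \<open>Some summand contributes more than a point. If the remaining sum did so too, both
  contributions would contain edges parallel to the edge of \<open>S\<close>, against
  \<open>nonparallel\<close>.\<close>

lemma edge_of_S_exposes:
  assumes e: "max_face c S = closed_segment s s'" "s \<noteq> s'"
  obtains i p p' w where "exposes c i p p' w" "s = p + w" "s' = p' + w"
proof -
  have "\<exists>i\<in>I. \<not> (\<exists>a. max_face c (P i) = {a})"
  proof (rule ccontr)
    assume "\<not> ?thesis"
    then obtain a where "(\<Sum>i\<in>I. max_face c (P i)) = {a}" using set_sum_singletons by metis
    then have "closed_segment s s' = {a}" using e(1) by (simp add: S_def max_face_sum)
    then show False using e(2) by (metis ends_in_segment singletonD)
  qed
  then obtain i where i: "i \<in> I" and G1: "\<not> (\<exists>a. max_face c (P i) = {a})" by blast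
  interpret parallelogramic_summands "P i" "Q i" using summands[OF i] .
  let ?G = "max_face c (P i)" and ?H = "max_face c (Q i)"
  have GH: "?G + ?H = closed_segment s s'" using e(1) unfolding S_split[OF i] max_face_set_plus .
  have pG: "polytope ?G" "?G \<noteq> {}" and pH: "polytope ?H" "?H \<noteq> {}"
    using P Q by (auto simp: polytope_max_face max_face_nonempty)
  have par: "\<exists>k. x - y = k *\<^sub>R (s' - s)" if "x \<in> closed_segment s s'" "y \<in> closed_segment s s'" for x y
  proof -
    obtain a b where ab: "x = (1 - a) *\<^sub>R s + a *\<^sub>R s'" "y = (1 - b) *\<^sub>R s + b *\<^sub>R s'"
      using \<open>x \<in> _\<close> \<open>y \<in> _\<close> unfolding in_segment by blast
    have "x - y = (a - b) *\<^sub>R (s' - s)" unfolding ab by (simp add: algebra_simps)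
    then show ?thesis by blast
  qed
  obtain g where g: "g extreme_point_of ?G" using polytope_extreme_exists pG by blast
  then obtain g' where g': "closed_segment g g' edge_of ?G" using edge_at_vertex[OF pG(1) g] G1 by blast
  obtain h where h: "h extreme_point_of ?H" using polytope_extreme_exists pH by blast
  have mem: "g \<in> ?G" "g' \<in> ?G" "h \<in> ?H" using edge_of_endpoints[OF g'] h by (auto simp: extreme_point_of_def)
  have H: "?H = {h}"
  proof (rule ccontr)
    assume "?H \<noteq> {h}"
    then obtain h' where h': "closed_segment h h' edge_of ?H" using edge_at_vertex[OF pH(1) h] by blast
    then have h'H: "h' \<in> ?H" "h \<noteq> h'" using edge_of_endpoints by blast+
    have "g' + h \<in> closed_segment s s'" "g + h \<in> closed_segment s s'" "g + h' \<in> closed_segment s s'"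
      unfolding GH[symmetric] using mem h'H by auto
    then obtain k k' where k: "(g' + h) - (g + h) = k *\<^sub>R (s' - s)" "(g + h') - (g + h) = k' *\<^sub>R (s' - s)"
      using par by metis
    have "k' \<noteq> 0" using k(2) h'H(2) by auto
    then have "g' - g = (k / k') *\<^sub>R (h' - h)" using k by simp
    moreover have "closed_segment g g' edge_of P i" "closed_segment h h' edge_of Q i"
      using g' h' edge_of_max_face polytope_imp_convex P(1) Q(1) by blast+
    ultimately show False using nonparallel by blast
  qed
  have "?G = (+) (- h) ` ((+) h ` ?G)" by (simp add: image_image)
  also have "(+) h ` ?G = closed_segment s s'"
    unfolding GH[symmetric] H by (auto simp: set_plus_def add.commute)
  also have "(+) (- h) ` closed_segment s s' = closed_segment (s - h) (s' - h)"
    by (metis add.commute closed_segment_translation diff_conv_add_uminus)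
  finally have "exposes c i (s - h) (s' - h) h" using i e(2) H by (simp add: exposes_def)
  then show thesis using that by simp
qed

lemma edge_of_P_exposes:
  assumes i: "i \<in> I"
  obtains c p p' w where "exposes c i p p' w"
proof -
  interpret parallelogramic_summands "P i" "Q i" using summands[OF i] .
  obtain g where g: "g extreme_point_of P i" using polytope_extreme_exists P by blast
  have "P i \<noteq> {g}" using dim1[OF i] by auto
  then obtain g' where g': "closed_segment g g' edge_of P i" using edge_at_vertex[OF P(1) g] by blast
  obtain c where c: "closed_segment g g' = max_face c (P i)"
    using face_of_polytope_max_face[OF P(1), of "closed_segment g g'"] g' unfolding edge_of_def by auto
  obtain c' w where "max_face c' (P i) = closed_segment g g'" "max_face c' (Q i) = {w}"
    using edge_exposed_with_vertex[OF c[symmetric] g'] by metis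
  then have "exposes c' i g g' w" using i edge_of_endpoints(1)[OF g'] by (simp add: exposes_def)
  then show thesis by (rule that)
qed

lemma deformation_sum:
  assumes "\<And>j. j \<in> I \<Longrightarrow> 0 \<le> \<alpha> j"
  shows "deformation ((+) t ` (\<Sum>j\<in>I. (*\<^sub>R) (\<alpha> j) ` P j)) S"
  unfolding S_def using assms finI pol by (intro deformation_translation deformation_sum_scaled) auto

lemma edge_deformation_vector_sum:
  assumes ex: "exposes c i p p' w" and \<alpha>: "\<And>j. j \<in> I \<Longrightarrow> 0 \<le> \<alpha> j"
  shows "edge_deformation_vector S ((+) t ` (\<Sum>j\<in>I. (*\<^sub>R) (\<alpha> j) ` P j)) (max_face c S) = \<alpha> i"
proof -
  obtain t' where t': "max_face c (\<Sum>j\<in>I. (*\<^sub>R) (\<alpha> j) ` P j) = (+) t' ` (*\<^sub>R) (\<alpha> i) ` closed_segment (p + w) (p' + w)"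
    using exposes_max_face_sum[OF ex, of \<alpha>] \<alpha> by blast
  have "i \<in> I" using ex by (simp add: exposes_def)
  show ?thesis
    unfolding exposes_max_face[OF ex]
  proof (rule edge_deformation_vector_eqI[OF S deformation_sum[OF \<alpha>] exposes_max_face[OF ex] \<alpha>[OF \<open>i \<in> I\<close>]])
    show "max_face c ((+) t ` (\<Sum>j\<in>I. (*\<^sub>R) (\<alpha> j) ` P j)) = (+) (t + t') ` (*\<^sub>R) (\<alpha> i) ` closed_segment (p + w) (p' + w)"
      unfolding max_face_translation t' by (simp add: image_image add.assoc)
  qed
qed

lemma deformation_imp_sum:
  assumes R: "deformation R S"
  obtains \<alpha> t where "\<And>i. i \<in> I \<Longrightarrow> 0 \<le> \<alpha> i" "R = (+) t ` (\<Sum>i\<in>I. (*\<^sub>R) (\<alpha> i) ` P i)"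
proof -
  note convS = polytope_imp_convex[OF S(1)]
  obtain q where q:
    "\<And>c p. p extreme_point_of S \<Longrightarrow> p \<in> max_face c S \<Longrightarrow> q p \<in> max_face c R"
    "\<And>p p'. closed_segment p p' edge_of S \<Longrightarrow> \<exists>l\<ge>0. q p - q p' = l *\<^sub>R (p - p')"
    using deformation_vertex_map[OF S R] by metis
  have "\<exists>l\<ge>0. \<forall>c w x y. exposes c i x y w \<longrightarrow> q (x + w) - q (y + w) = l *\<^sub>R (x - y)" if i: "i \<in> I" for i
  proof -
    interpret parallelogramic_summands "P i" "Q i" using summands[OF i] .
    obtain l where "0 \<le> l" "\<And>c w x y. max_face c (P i) = closed_segment x y \<Longrightarrow> x \<noteq> y \<Longrightarrow> max_face c (Q i) = {w} \<Longrightarrow>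
      q (x + w) - q (y + w) = l *\<^sub>R (x - y)"
      using indecomposable_edge_coefficient[OF _ indec[OF i], of q] q(2) unfolding S_split[OF i] by blast
    then show ?thesis unfolding exposes_def by blast
  qed
  then obtain \<alpha> where \<alpha>: "\<And>i. i \<in> I \<Longrightarrow> 0 \<le> \<alpha> i"
    "\<And>i c w x y. i \<in> I \<Longrightarrow> exposes c i x y w \<Longrightarrow> q (x + w) - q (y + w) = \<alpha> i *\<^sub>R (x - y)"
    by metis
  let ?R2 = "(\<Sum>i\<in>I. (*\<^sub>R) (\<alpha> i) ` P i)"
  have R2: "deformation ?R2 S"
    unfolding S_def using finI pol \<alpha>(1) by (intro deformation_sum_scaled) auto
  obtain q2 where q2:
    "\<And>c p. p extreme_point_of S \<Longrightarrow> p \<in> max_face c S \<Longrightarrow> q2 p \<in> max_face c ?R2"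
    using deformation_vertex_map[OF S R2] by metis
  \<comment> \<open>On each edge of \<open>S\<close> both vertex maps have the coefficient \<alpha>
    i of the summand from which the edge comes.\<close>
  have const: "q x - q2 x = q y - q2 y" if xy: "closed_segment x y edge_of S" for x y
  proof -
    have "x \<noteq> y" using edge_of_endpoints(1)[OF xy] .
    obtain c where c: "max_face c S = closed_segment x y"
      using face_of_polytope_max_face[OF S(1), of "closed_segment x y"] xy unfolding edge_of_def
      by (metis empty_iff ends_in_segment(1))
    obtain i p p' w where ex: "exposes c i p p' w" and pw: "x = p + w" "y = p' + w"
      using edge_of_S_exposes[OF c \<open>x \<noteq> y\<close>] by blast
    have i: "i \<in> I" using ex by (simp add: exposes_def)
    have 1: "q x - q y = \<alpha> i *\<^sub>R (x - y)" using \<alpha>(2)[OF i ex] pw by simp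
    obtain t where t: "max_face c ?R2 = (+) t ` (*\<^sub>R) (\<alpha> i) ` closed_segment x y"
      using exposes_max_face_sum[OF ex, of \<alpha>] \<alpha>(1) pw by blast
    have "q2 x = t + \<alpha> i *\<^sub>R x" by (rule vertex_map_edge[OF S(1) q2 c \<open>x \<noteq> y\<close> \<alpha>(1)[OF i] t])
    moreover have "q2 y = t + \<alpha> i *\<^sub>R y"
      using vertex_map_edge[OF S(1) q2 c[unfolded closed_segment_commute[of x]] \<open>x \<noteq> y\<close>[symmetric]
        \<alpha>(1)[OF i] t[unfolded closed_segment_commute[of x]]] .
    ultimately have "q2 x - q2 y = q x - q y" unfolding 1 by (simp add: algebra_simps)
    then show ?thesis by (simp add: algebra_simps)
  qed
  obtain v where v: "v extreme_point_of S" using polytope_extreme_exists S by blast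
  define t where "t = q v - q2 v"
  have qq2: "q x = t + q2 x" if x: "x extreme_point_of S" for x
    using connected_vertices[OF S(1) v x, of "\<lambda>x. q x - q2 x"] const unfolding t_def by (metis diff_add_cancel)
  have "R = (+) t ` ?R2"
  proof (rule eq_by_max_face)
    show "polytope R" "polytope ((+) t ` ?R2)"
      using R R2 polytope_translation_eq unfolding deformation_def by blast+
    fix c
    obtain p where p: "p extreme_point_of S" "p \<in> max_face c S" using max_face_extreme_exists S by blast
    have "q p \<in> max_face c ((+) t ` ?R2)"
      unfolding max_face_translation qq2[OF p(1)] using q2[OF p] by blast
    then show "\<exists>x\<in>max_face c R. \<exists>y\<in>max_face c ((+) t ` ?R2). c \<bullet> x = c \<bullet> y"
      using q(1)[OF p] by blast
  qed
  then show thesis using that \<alpha>(1) by blast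
qed

end

section \<open>Simplicial cones with coordinates\<close>

lemma sum_fun_apply: "(\<Sum>i\<in>I. f i) x = (\<Sum>i\<in>I. f i x)"
  by (induction I rule: infinite_finite_induct) auto

text \<open>Evaluations at the points \<open>e i\<close> are dual to the generators, so the
  coordinates of a cone element are its values there; independence, dimension and faces reduce to
  evaluation.\<close>

locale coordinate_cone =
  fixes I :: "'i set" and b :: "'i \<Rightarrow> 'e \<Rightarrow> real" and e :: "'i \<Rightarrow> 'e"
  assumes finI: "finite I"
    and b: "\<And>i j. i \<in> I \<Longrightarrow> j \<in> I \<Longrightarrow> b j (e i) = (if i = j then 1 else 0)"
begin

definition C where "C = {(\<Sum>i\<in>I. \<alpha> i *\<^sub>R b i) | \<alpha>. \<forall>i\<in>I. 0 \<le> \<alpha> i}"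

lemma coordinate: "i \<in> I \<Longrightarrow> (\<Sum>j\<in>I. \<alpha> j *\<^sub>R b j) (e i) = \<alpha> i"
  using finI by (simp add: sum_fun_apply b if_distrib[of "\<lambda>x. _ * x"] cong: if_cong)

lemma inj: "inj_on b I"
  by (rule inj_onI) (metis b zero_neq_one)

lemma indep: "independent (b ` I)"
proof -
  have "u v = 0" if u: "(\<Sum>v\<in>b ` I. u v *\<^sub>R v) = 0" and v: "v \<in> b ` I" for u v
  proof -
    obtain i where i: "i \<in> I" "v = b i" using v by blast
    have "(\<Sum>j\<in>I. u (b j) *\<^sub>R b j) = 0" using u sum.reindex[OF inj, of "\<lambda>v. u v *\<^sub>R v"] by simp
    then have "u (b i) = 0" using coordinate[OF i(1), of "\<lambda>j. u (b j)"] by simp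
    then show ?thesis using i by simp
  qed
  then show ?thesis using finI unfolding dependent_finite[OF finite_imageI[OF finI]] by blast
qed

lemma b_in: "i \<in> I \<Longrightarrow> c \<ge> 0 \<Longrightarrow> c *\<^sub>R b i \<in> C"
  unfolding C_def mem_Collect_eq using finI
  by (intro exI[of _ "\<lambda>j. if j = i then c else 0"]) (auto simp: if_distrib[of "\<lambda>x. x *\<^sub>R _"] cong: if_cong)

lemma simplicial: "simplicial_cone C"
  unfolding simplicial_cone_def
proof (intro exI[of _ "b ` I"] conjI indep finite_imageI finI)
  show "C = {(\<Sum>v\<in>b ` I. a v *\<^sub>R v) | a. \<forall>v\<in>b ` I. 0 \<le> a v}"
  proof
    show "C \<subseteq> {(\<Sum>v\<in>b ` I. a v *\<^sub>R v) | a. \<forall>v\<in>b ` I. 0 \<le> a v}"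
    proof
      fix x assume "x \<in> C"
      then obtain \<alpha> where \<alpha>: "x = (\<Sum>i\<in>I. \<alpha> i *\<^sub>R b i)" "\<forall>i\<in>I. 0 \<le> \<alpha> i" unfolding C_def by blast
      let ?a = "\<alpha> \<circ> inv_into I b"
      have "x = (\<Sum>v\<in>b ` I. ?a v *\<^sub>R v)" unfolding sum.reindex[OF inj] \<alpha>(1) using inj by simp
      moreover have "\<forall>v\<in>b ` I. 0 \<le> ?a v" using \<alpha>(2) inj by simp
      ultimately show "x \<in> {(\<Sum>v\<in>b ` I. a v *\<^sub>R v) | a. \<forall>v\<in>b ` I. 0 \<le> a v}" by blast
    qed
    show "{(\<Sum>v\<in>b ` I. a v *\<^sub>R v) | a. \<forall>v\<in>b ` I. 0 \<le> a v} \<subseteq> C"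
    proof
      fix x assume "x \<in> {(\<Sum>v\<in>b ` I. a v *\<^sub>R v) | a. \<forall>v\<in>b ` I. 0 \<le> a v}"
      then obtain a where a: "x = (\<Sum>v\<in>b ` I. a v *\<^sub>R v)" "\<forall>v\<in>b ` I. 0 \<le> a v" by blast
      then have "x = (\<Sum>i\<in>I. a (b i) *\<^sub>R b i)" "\<forall>i\<in>I. 0 \<le> a (b i)" by (simp_all add: sum.reindex[OF inj])
      then show "x \<in> C" unfolding C_def mem_Collect_eq by (intro exI[of _ "\<lambda>i. a (b i)"] conjI)
    qed
  qed
qed

lemma dim: "dim C = card I"
proof -
  have "C \<subseteq> span (b ` I)"
    unfolding C_def by (auto intro!: span_sum intro: span_scale span_base)
  moreover have "b ` I \<subseteq> C" using b_in[of _ 1] by auto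
  ultimately have "span (b ` I) = span C"
    by (meson span_mono span_minimal subspace_span subset_antisym)
  then have "dim C = card (b ` I)" by (rule dim_eq_card[OF _ indep])
  then show ?thesis by (simp add: card_image inj)
qed

lemma ray_in: "conic hull {b i} = {c *\<^sub>R b i | c. 0 \<le> c}"
  by (auto simp: conic_hull_explicit)

text \<open>If \<open>v\<close> spans a ray and has a positive coordinate at \<open>i\<close>, it is
  the midpoint of a multiple of \<open>b i\<close> and a remainder, and the face property puts
  \<open>b i\<close> on the ray. Conversely, when a point of the ray of \<open>b i\<close> is
  interior to a segment in the cone, all other coordinates, being nonnegative, vanish at both
  ends.\<close>

lemma rays: "rays C = (\<lambda>i. conic hull {b i}) ` I"
proof
  show "rays C \<subseteq> (\<lambda>i. conic hull {b i}) ` I"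
  proof
    fix \<rho> assume "\<rho> \<in> rays C"
    then obtain v where \<rho>: "\<rho> face_of C" "v \<noteq> 0" "\<rho> = conic hull {v}" unfolding rays_def by blast
    have \<rho>v: "\<rho> = {c *\<^sub>R v | c. 0 \<le> c}" using \<rho>(3) by (auto simp: conic_hull_explicit)
    have "1 *\<^sub>R v \<in> \<rho>" unfolding \<rho>v using zero_le_one by blast
    then have v\<rho>: "v \<in> \<rho>" by simp
    then obtain \<alpha> where \<alpha>: "v = (\<Sum>i\<in>I. \<alpha> i *\<^sub>R b i)" "\<forall>i\<in>I. 0 \<le> \<alpha> i"
      using face_of_imp_subset[OF \<rho>(1)] unfolding C_def by blast
    have "\<exists>i\<in>I. \<alpha> i \<noteq> 0"
    proof (rule ccontr)
      assume "\<not> ?thesis"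
      then have "v = 0" unfolding \<alpha>(1) by (intro sum.neutral) auto
      then show False using \<rho>(2) by simp
    qed
    then obtain i where i: "i \<in> I" "0 < \<alpha> i" using \<alpha>(2) by fastforce
    \<comment> \<open>The factor 2 makes \<open>v\<close> the midpoint; the two points differ in
      coordinate \<open>i\<close>, so \<open>v\<close> lies in the open segment between
      them.\<close>
    let ?x = "(2 * \<alpha> i) *\<^sub>R b i" and ?y = "\<Sum>j\<in>I. (if j = i then 0 else 2 * \<alpha> j) *\<^sub>R b j"
    have xC: "?x \<in> C" using i by (intro b_in) auto
    have yC: "?y \<in> C" unfolding C_def mem_Collect_eq using \<alpha>(2) by (intro exI conjI[OF refl]) auto
    have "?x \<noteq> ?y"
    proof
      assume "?x = ?y"
      then have "?x (e i) = ?y (e i)" by simp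
      then show False using i b[OF i(1) i(1)] coordinate[OF i(1), of "\<lambda>j. if j = i then 0 else 2 * \<alpha> j"] by simp
    qed
    moreover have "v = (1 - 1 / 2) *\<^sub>R ?x + (1 / 2) *\<^sub>R ?y"
    proof -
      have "?y = (\<Sum>j\<in>I - {i}. (2 * \<alpha> j) *\<^sub>R b j)" by (subst sum.remove[OF finI i(1)]) (auto intro!: sum.cong)
      moreover have "2 *\<^sub>R v = ?x + (\<Sum>j\<in>I - {i}. (2 * \<alpha> j) *\<^sub>R b j)"
        unfolding \<alpha>(1) by (subst sum.remove[OF finI i(1)]) (simp add: scaleR_add_right scaleR_sum_right)
      ultimately have "2 *\<^sub>R v = ?x + ?y" by simp
      then have "(1 / 2) *\<^sub>R (2 *\<^sub>R v) = (1 / 2) *\<^sub>R (?x + ?y)" by (simp only:)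
      then show ?thesis by (simp add: scaleR_add_right)
    qed
    ultimately have "v \<in> open_segment ?x ?y"
      unfolding in_segment(2) by (intro conjI exI[of _ "1 / 2"]) auto
    then have "?x \<in> \<rho>" using face_ofD[OF \<rho>(1) _ xC yC v\<rho>] by blast
    then obtain c where c: "0 \<le> c" "?x = c *\<^sub>R v" unfolding \<rho>v by blast
    have "?x \<noteq> 0"
    proof
      assume "?x = 0"
      then have "?x (e i) = 0" by (simp only: zero_fun_apply)
      then show False using i b[OF i(1) i(1)] by simp
    qed
    then have "c \<noteq> 0" using c(2) by auto
    then have v: "v = ((2 * \<alpha> i) / c) *\<^sub>R b i"
      using arg_cong[OF c(2), of "\<lambda>x. (1 / c) *\<^sub>R x"] by simp
    have "\<rho> = conic hull {b i}"
      unfolding ray_in \<rho>v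
    proof safe
      fix k :: real assume "0 \<le> k"
      then show "\<exists>c. k *\<^sub>R v = c *\<^sub>R b i \<and> 0 \<le> c"
        using c(1) i unfolding v by (intro exI[of _ "k * ((2 * \<alpha> i) / c)"]) auto
    next
      fix k :: real assume "0 \<le> k"
      then show "\<exists>c. k *\<^sub>R b i = c *\<^sub>R v \<and> 0 \<le> c"
        using c(1) \<open>c \<noteq> 0\<close> i unfolding v by (intro exI[of _ "k * (c / (2 * \<alpha> i))"]) auto
    qed
    then show "\<rho> \<in> (\<lambda>i. conic hull {b i}) ` I" using i by blast
  qed
  show "(\<lambda>i. conic hull {b i}) ` I \<subseteq> rays C"
  proof safe
    fix i assume i: "i \<in> I"
    have sub: "conic hull {b i} \<subseteq> C" unfolding ray_in using b_in[OF i] by auto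
    have face: "conic hull {b i} face_of C"
      unfolding face_of_def
    proof (intro conjI sub ballI impI)
      show "convex (conic hull {b i})" by (simp add: convex_conic_hull)
      fix x y z assume x: "x \<in> C" and y: "y \<in> C" and z: "z \<in> conic hull {b i}" "z \<in> open_segment x y"
      obtain \<alpha> where \<alpha>: "x = (\<Sum>i\<in>I. \<alpha> i *\<^sub>R b i)" "\<forall>i\<in>I. 0 \<le> \<alpha> i" using x unfolding C_def by blast
      obtain \<beta> where \<beta>: "y = (\<Sum>i\<in>I. \<beta> i *\<^sub>R b i)" "\<forall>i\<in>I. 0 \<le> \<beta> i" using y unfolding C_def by blast
      obtain u where u: "0 < u" "u < 1" "z = (1 - u) *\<^sub>R x + u *\<^sub>R y" using z(2) by (auto simp: in_segment)
      obtain c where c: "z = c *\<^sub>R b i" using z(1) unfolding ray_in by blast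
      have zero: "\<alpha> j = 0 \<and> \<beta> j = 0" if j: "j \<in> I" "j \<noteq> i" for j
      proof -
        have "0 = z (e j)" unfolding c using b[OF j(1) i] j(2) by simp
        also have "\<dots> = (1 - u) * \<alpha> j + u * \<beta> j"
          unfolding u(3) using coordinate[OF j(1)] by (simp add: \<alpha>(1) \<beta>(1))
        finally have "(1 - u) * \<alpha> j + u * \<beta> j = 0" by simp
        moreover have "0 \<le> (1 - u) * \<alpha> j" "0 \<le> u * \<beta> j" using u \<alpha>(2) \<beta>(2) j by auto
        ultimately have "(1 - u) * \<alpha> j = 0" "u * \<beta> j = 0" by linarith+
        then show ?thesis using u by auto
      qed
      have "x = \<alpha> i *\<^sub>R b i"
        unfolding \<alpha>(1) using zero by (subst sum.remove[OF finI i]) simp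
      moreover have "y = \<beta> i *\<^sub>R b i"
        unfolding \<beta>(1) using zero by (subst sum.remove[OF finI i]) simp
      ultimately show "x \<in> conic hull {b i}" "y \<in> conic hull {b i}"
        unfolding ray_in using \<alpha>(2) \<beta>(2) i by blast+
    qed
    have "b i \<noteq> 0" using b[OF i i] by (metis zero_fun_apply zero_neq_one)
    then show "conic hull {b i} \<in> rays C" unfolding rays_def using face by blast
  qed
qed

lemma inj_rays: "inj_on (\<lambda>i. conic hull {b i}) I"
proof (rule inj_onI)
  fix i j assume ij: "i \<in> I" "j \<in> I" and eq: "conic hull {b i} = conic hull {b j}"
  have "1 *\<^sub>R b i \<in> conic hull {b i}" unfolding ray_in using zero_le_one by blast
  then obtain c where "b i = c *\<^sub>R b j" unfolding eq unfolding ray_in by auto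
  then have "b i (e i) = c * b j (e i)" by simp
  then show "i = j" using b[OF ij(1,1)] b[OF ij(1,2)] by (auto split: if_splits)
qed

end

section \<open>Normal fans\<close>

lemma normal_cone_iff: "F \<subseteq> P \<Longrightarrow> c \<in> normal_cone P F \<longleftrightarrow> F \<subseteq> max_face c P"
  unfolding normal_cone_def max_face_def by auto

lemma normal_fan_dilate_subset:
  fixes P :: "'a::euclidean_space set"
  assumes "0 < l"
  shows "normal_fan P \<subseteq> normal_fan ((+) t ` (*\<^sub>R) l ` P)"
proof
  fix N assume "N \<in> normal_fan P"
  then obtain F where F: "F face_of P" "F \<noteq> {}" "N = normal_cone P F" unfolding normal_fan_def by blast
  have "(*\<^sub>R) l ` F face_of (*\<^sub>R) l ` P"
    using assms F(1) by (subst face_of_linear_image) (auto intro: linear_scaleR injI)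
  then have "(+) t ` (*\<^sub>R) l ` F face_of (+) t ` (*\<^sub>R) l ` P" by simp
  moreover have "N = normal_cone ((+) t ` (*\<^sub>R) l ` P) ((+) t ` (*\<^sub>R) l ` F)"
    unfolding F(3) normal_cone_def using assms by (auto simp: inner_add_right)
  ultimately show "N \<in> normal_fan ((+) t ` (*\<^sub>R) l ` P)" unfolding normal_fan_def using F(2) by blast
qed

lemma normal_fan_dilate:
  fixes P :: "'a::euclidean_space set"
  assumes "0 < l"
  shows "normal_fan ((+) t ` (*\<^sub>R) l ` P) = normal_fan P"
proof
  have "(+) (- ((1 / l) *\<^sub>R t)) ` (*\<^sub>R) (1 / l) ` ((+) t ` (*\<^sub>R) l ` P) = P"
    using assms by (simp add: image_image scaleR_add_right)
  then show "normal_fan ((+) t ` (*\<^sub>R) l ` P) \<subseteq> normal_fan P"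
    using normal_fan_dilate_subset[of "1 / l" "(+) t ` (*\<^sub>R) l ` P" "- ((1 / l) *\<^sub>R t)"] assms by simp
qed (rule normal_fan_dilate_subset[OF assms])

lemma aff_dim_dilate:
  fixes P :: "'a::euclidean_space set"
  assumes "0 < l"
  shows "aff_dim ((*\<^sub>R) l ` P) = aff_dim P"
  using assms by (intro aff_dim_injective_linear_image) (auto intro: linear_scaleR injI)

lemma indecomposable_dilate:
  fixes P :: "'a::euclidean_space set"
  assumes P: "indecomposable P" and l: "0 < l"
  shows "indecomposable ((*\<^sub>R) l ` P)"
  unfolding indecomposable_def
proof (intro allI impI)
  fix R assume "deformation R ((*\<^sub>R) l ` P)"
  then obtain k R' where k: "0 < k" "polytope R" "polytope R'" "(*\<^sub>R) l ` P = (*\<^sub>R) k ` R + R'"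
    unfolding deformation_def by blast
  have "P = (*\<^sub>R) (1 / l) ` (*\<^sub>R) l ` P" using l by (simp add: image_image)
  also have "\<dots> = (*\<^sub>R) (k / l) ` R + (*\<^sub>R) (1 / l) ` R'"
    unfolding k(4) scaleR_set_plus by (simp add: image_image)
  finally have "deformation R P"
    unfolding deformation_def using k l polytope_scaling by (metis divide_pos_pos)
  then obtain m t where m: "0 \<le> m" "R = (+) t ` (*\<^sub>R) m ` P" using P unfolding indecomposable_def by blast
  then have "R = (+) t ` (*\<^sub>R) (m / l) ` (*\<^sub>R) l ` P" using l by (simp add: image_image)
  then show "\<exists>m\<ge>0. \<exists>t. R = (+) t ` (*\<^sub>R) m ` (*\<^sub>R) l ` P" using m l by (metis divide_nonneg_pos)
qed

section \<open>The deformation cone of the sum\<close>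

context parallelogramic_family
begin

lemma edge_type:
  assumes "e \<in> edges S"
  obtains c i p p' w where "exposes c i p p' w" "e = max_face c S"
proof -
  have e: "e edge_of S" using assms by (simp add: edges_def)
  then obtain s s' where s: "e = closed_segment s s'" "s \<noteq> s'" using edge_of_segment S by blast
  have "e face_of S" "e \<noteq> {}" using e s by (auto simp: edge_of_def)
  then obtain c where c: "e = max_face c S" using face_of_polytope_max_face S by blast
  then show thesis using edge_of_S_exposes[of c s s'] s that by metis
qed

lemma exposes_edge: "exposes c i p p' w \<Longrightarrow> max_face c S \<in> edges S"
  using exposes_max_face[of c i p p' w] max_face_face_of[OF polytope_imp_convex[OF S(1)], of c]
  by (simp add: edges_def edge_of_def aff_dim_closed_segment)

abbreviation basis where "basis i \<equiv> edge_deformation_vector S (P i)"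

lemma basis_exposes:
  assumes ex: "exposes c i p p' w" and j: "j \<in> I"
  shows "basis j (max_face c S) = (if i = j then 1 else 0)"
proof -
  \<comment> \<open>\<open>P j\<close> is the combination with unit coefficient vector: dilation by
    0 turns a nonempty set into the origin, the neutral element of Minkowski addition.\<close>
  have "(\<Sum>k\<in>I. (*\<^sub>R) (if k = j then 1 else 0) ` P k) = (\<Sum>k\<in>I. if k = j then P k else 0)"
    using ne by (intro sum.cong) (auto simp: set_zero)
  also have "\<dots> = P j" using finI j by simp
  finally have "P j = (+) 0 ` (\<Sum>k\<in>I. (*\<^sub>R) (if k = j then 1 else 0) ` P k)" by simp
  then show ?thesis using edge_deformation_vector_sum[OF ex, of "\<lambda>k. if k = j then 1 else 0" 0] by auto
qed

lemma edge_deformation_vector_combination: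
  assumes \<alpha>: "\<And>j. j \<in> I \<Longrightarrow> 0 \<le> \<alpha> j"
  shows "edge_deformation_vector S ((+) t ` (\<Sum>j\<in>I. (*\<^sub>R) (\<alpha> j) ` P j)) = (\<Sum>j\<in>I. \<alpha> j *\<^sub>R basis j)"
proof
  fix e
  show "edge_deformation_vector S ((+) t ` (\<Sum>j\<in>I. (*\<^sub>R) (\<alpha> j) ` P j)) e = (\<Sum>j\<in>I. \<alpha> j *\<^sub>R basis j) e"
  proof (cases "e \<in> edges S")
    case True
    then obtain c i p p' w where ex: "exposes c i p p' w" and e: "e = max_face c S" using edge_type by blast
    have "i \<in> I" using ex by (simp add: exposes_def)
    then have "(\<Sum>j\<in>I. \<alpha> j *\<^sub>R basis j) e = \<alpha> i"
      using finI unfolding e sum_fun_apply by (simp add: basis_exposes[OF ex] if_distrib[of "\<lambda>x. _ * x"] cong: if_cong)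
    then show ?thesis using edge_deformation_vector_sum[OF ex, of \<alpha> t] \<alpha> e by simp
  next
    case False
    then show ?thesis by (simp add: edge_deformation_vector_def sum_fun_apply)
  qed
qed

text \<open>A chosen edge of \<open>S\<close> coming from \<open>P i\<close>; the coordinate at
  \<open>i\<close> is read off there.\<close>

definition rep where "rep i = (SOME e. \<exists>c p p' w. exposes c i p p' w \<and> e = max_face c S)"

lemma rep:
  assumes "i \<in> I"
  obtains c p p' w where "exposes c i p p' w" "rep i = max_face c S"
proof -
  have "\<exists>e c p p' w. exposes c i p p' w \<and> e = max_face c S" using edge_of_P_exposes[OF assms] by metis
  from someI_ex[OF this] show thesis using that unfolding rep_def by blast
qed

sublocale cone: coordinate_cone I basis rep
proof
  show "finite I" by (rule finI)
  fix i j assume ij: "i \<in> I" "j \<in> I"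
  obtain c p p' w where "exposes c i p p' w" "rep i = max_face c S" using rep[OF ij(1)] by blast
  then show "basis j (rep i) = (if i = j then 1 else 0)" using basis_exposes ij(2) by simp
qed

lemma deformation_cone: "deformation_cone S = cone.C"
proof
  show "deformation_cone S \<subseteq> cone.C"
  proof
    fix x assume "x \<in> deformation_cone S"
    then obtain R where R: "deformation R S" "x = edge_deformation_vector S R" unfolding deformation_cone_def by blast
    obtain \<alpha> t where \<alpha>: "\<And>i. i \<in> I \<Longrightarrow> 0 \<le> \<alpha> i" "R = (+) t ` (\<Sum>i\<in>I. (*\<^sub>R) (\<alpha> i) ` P i)"
      using deformation_imp_sum[OF R(1)] by blast
    have "x = (\<Sum>j\<in>I. \<alpha> j *\<^sub>R basis j)" unfolding R(2) \<alpha>(2) by (rule edge_deformation_vector_combination[OF \<alpha>(1)])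
    then show "x \<in> cone.C" unfolding cone.C_def using \<alpha>(1) by blast
  qed
  show "cone.C \<subseteq> deformation_cone S"
  proof
    fix x assume "x \<in> cone.C"
    then obtain \<alpha> where \<alpha>: "x = (\<Sum>j\<in>I. \<alpha> j *\<^sub>R basis j)" "\<forall>i\<in>I. 0 \<le> \<alpha> i" unfolding cone.C_def by blast
    then have "x = edge_deformation_vector S ((+) 0 ` (\<Sum>j\<in>I. (*\<^sub>R) (\<alpha> j) ` P j))"
      using edge_deformation_vector_combination[of \<alpha> 0] by simp
    moreover have "deformation ((+) 0 ` (\<Sum>j\<in>I. (*\<^sub>R) (\<alpha> j) ` P j)) S" using \<alpha>(2) by (intro deformation_sum) auto
    ultimately show "x \<in> deformation_cone S" unfolding deformation_cone_def by blast
  qed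
qed

text \<open>The edges of \<open>S\<close> that are translates of edges of \<open>P i\<close>; these
  are the blocks of the edge decomposition.\<close>

definition edge_class where "edge_class i = {max_face c S | c. \<exists>p p' w. exposes c i p p' w}"

lemma combination_on_class:
  assumes "e \<in> edge_class i"
  shows "(\<Sum>j\<in>I. \<alpha> j *\<^sub>R basis j) e = \<alpha> i"
proof -
  obtain c p p' w where ex: "exposes c i p p' w" and e: "e = max_face c S" using assms unfolding edge_class_def by blast
  have "i \<in> I" using ex by (simp add: exposes_def)
  then show ?thesis using finI unfolding e sum_fun_apply by (simp add: basis_exposes[OF ex] if_distrib[of "\<lambda>x. _ * x"] cong: if_cong)
qed

lemma edge_in_class:
  assumes "e \<in> edges S"
  shows "\<exists>i\<in>I. e \<in> edge_class i"
proof -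
  obtain c i p p' w where ex: "exposes c i p p' w" "e = max_face c S" using edge_type[OF assms] .
  then have "e \<in> edge_class i" unfolding edge_class_def by blast
  moreover have "i \<in> I" using ex by (simp add: exposes_def)
  ultimately show ?thesis by blast
qed

lemma edge_class_edges: "edge_class i \<subseteq> edges S"
  unfolding edge_class_def using exposes_edge by blast

text \<open>The combination with unit coefficient at \<open>i\<close> has value 1 on the class of
  \<open>i\<close> and 0 on every other class.\<close>

lemma edge_class_unique: "e \<in> edge_class i \<Longrightarrow> e \<in> edge_class j \<Longrightarrow> i = j"
  using combination_on_class[of e i "\<lambda>k. if k = i then 1 else 0"]
    combination_on_class[of e j "\<lambda>k. if k = i then 1 else 0"] by (auto split: if_splits)

lemma edge_decomposable: "edge_decomposable S"
  unfolding edge_decomposable_def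
proof (intro exI[of _ "edge_class ` I"] conjI ballI)
  show "partition_on (edges S) (edge_class ` I)"
  proof (rule partition_onI)
    show "\<Union> (edge_class ` I) = edges S" using edge_in_class edge_class_edges by blast
    fix X Y assume "X \<in> edge_class ` I" "Y \<in> edge_class ` I" "X \<noteq> Y"
    then show "disjnt X Y" using edge_class_unique unfolding disjnt_def by blast
  next
    have "edge_class i \<noteq> {}" if i: "i \<in> I" for i
    proof -
      obtain c p p' w where "exposes c i p p' w" using edge_of_P_exposes[OF i] .
      then show ?thesis unfolding edge_class_def by blast
    qed
    then show "{} \<notin> edge_class ` I" by fastforce
  qed
  fix X assume "X \<in> edge_class ` I"
  then obtain i where i: "i \<in> I" "X = edge_class i" by blast
  show "dependent_edges S X"
    unfolding dependent_edges_def deformation_cone cone.C_def i(2)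
    using edge_class_edges combination_on_class by auto
  \<comment> \<open>Contracting the class of \<open>i\<close> amounts to dropping the summand
    \<open>P i\<close>, so the vector is the sum of the other generators.\<close>
  have "indicat_real (edges S - X) = (\<Sum>j\<in>I. (if j = i then 0 else 1) *\<^sub>R basis j)"
  proof
    fix e
    show "indicat_real (edges S - X) e = (\<Sum>j\<in>I. (if j = i then 0 else 1) *\<^sub>R basis j) e"
    proof (cases "e \<in> edges S")
      case True
      then obtain k where k: "k \<in> I" "e \<in> edge_class k" using edge_in_class by blast
      then have "e \<in> X \<longleftrightarrow> k = i" using edge_class_unique i(2) by blast
      then show ?thesis unfolding combination_on_class[OF k(2)] using True by simp
    next
      case False
      then show ?thesis by (simp add: edge_deformation_vector_def sum_fun_apply)
    qed
  qed
  also have "\<dots> \<in> cone.C" unfolding cone.C_def by (intro CollectI exI conjI[OF refl]) auto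
  finally show "contractible_edges S X"
    unfolding contractible_edges_def deformation_cone using i(2) edge_class_edges by simp
qed

section \<open>Uniqueness of the decomposition\<close>

lemma coefficients_unique:
  assumes eq: "(+) t ` (\<Sum>j\<in>I. (*\<^sub>R) (\<alpha> j) ` P j) = (+) t' ` (\<Sum>j\<in>I. (*\<^sub>R) (\<beta> j) ` P j)"
    and \<alpha>: "\<And>j. j \<in> I \<Longrightarrow> 0 \<le> \<alpha> j" and \<beta>: "\<And>j. j \<in> I \<Longrightarrow> 0 \<le> \<beta> j" and i: "i \<in> I"
  shows "\<alpha> i = \<beta> i"
proof -
  have "(\<Sum>j\<in>I. \<alpha> j *\<^sub>R basis j) = (\<Sum>j\<in>I. \<beta> j *\<^sub>R basis j)"
    using edge_deformation_vector_combination[of \<alpha> t] edge_deformation_vector_combination[of \<beta> t'] \<alpha> \<beta> eq by simp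
  then show ?thesis using cone.coordinate[OF i, of \<alpha>] cone.coordinate[OF i, of \<beta>] by simp
qed

text \<open>Some \<open>c\<close> exposes an edge of \<open>P i\<close> but only a vertex
  \<open>z\<close> of \<open>P j\<close>, so it is interior to the normal cone of \<open>z\<close>.
  If that were the normal cone of a face \<open>F\<close> of \<open>P i\<close>, then
  \<open>F\<close> would survive every small perturbation of \<open>c\<close> and lie in both ends
  of the edge.\<close>

lemma not_normally_equivalent:
  assumes i: "i \<in> I" and j: "j \<in> I" "i \<noteq> j"
  shows "\<not> normally_equivalent (P i) (P j)"
proof
  assume "normally_equivalent (P i) (P j)"
  then have fan: "normal_fan (P i) = normal_fan (P j)" by (simp add: normally_equivalent_def)
  obtain c p p' w where ex: "exposes c i p p' w" using edge_of_P_exposes[OF i] by blast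
  then have e: "p \<noteq> p'" "max_face c (P i) = closed_segment p p'" "max_face c (Q i) = {w}" by (auto simp: exposes_def)
  have "(\<Sum>k\<in>I - {i}. max_face c (P k)) = {w}" using e(3) by (simp add: Q_def max_face_sum)
  then obtain z where z: "max_face c (P j) = {z}"
    using set_sum_singletonD[of "I - {i}" "\<lambda>k. max_face c (P k)" w j] j finI by auto
  have zP: "z \<in> P j" using z max_face_subset by blast
  have "{z} face_of P j" using z max_face_face_of polytope_imp_convex[OF pol[OF j(1)]] by metis
  then have "normal_cone (P j) {z} \<in> normal_fan (P i)" unfolding fan unfolding normal_fan_def by blast
  then obtain F where F: "F face_of P i" "F \<noteq> {}" "normal_cone (P j) {z} = normal_cone (P i) F"
    unfolding normal_fan_def by blast
  have sub: "F \<subseteq> max_face d (closed_segment p p')" for d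
  proof -
    have "\<forall>\<^sub>F \<epsilon> in at_right 0. max_face (c + \<epsilon> *\<^sub>R d) (P i) = max_face d (max_face c (P i)) \<and>
        max_face (c + \<epsilon> *\<^sub>R d) (P j) = max_face d (max_face c (P j))"
      using eventually_max_face_perturb pol i j by (intro eventually_conj) auto
    then obtain \<epsilon> where eps: "max_face (c + \<epsilon> *\<^sub>R d) (P i) = max_face d (max_face c (P i))"
        "max_face (c + \<epsilon> *\<^sub>R d) (P j) = max_face d (max_face c (P j))"
      using eventually_happens'[OF trivial_limit_at_right_real] by blast
    have "c + \<epsilon> *\<^sub>R d \<in> normal_cone (P j) {z}"
      using zP eps(2) unfolding z max_face_singleton by (subst normal_cone_iff) auto
    then have "F \<subseteq> max_face (c + \<epsilon> *\<^sub>R d) (P i)"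
      unfolding F(3) using normal_cone_iff face_of_imp_subset[OF F(1)] by blast
    then show ?thesis unfolding eps(1) e(2) .
  qed
  have lt: "0 < (p' - p) \<bullet> (p' - p)" using e(1) by simp
  have "max_face (p - p') (closed_segment p p') = {p}"
    using lt by (intro max_face_segment) (simp add: inner_diff_left inner_diff_right inner_commute)
  moreover have "max_face (p' - p) (closed_segment p' p) = {p'}"
    using lt by (intro max_face_segment) (simp add: inner_diff_left inner_diff_right inner_commute)
  ultimately have "F \<subseteq> {p}" "F \<subseteq> {p'}" using sub[of "p - p'"] sub[of "p' - p"] closed_segment_commute by metis+
  then show False using F(2) e(1) by blast
qed

lemma sum_support:
  assumes \<alpha>: "\<And>j. j \<in> I \<Longrightarrow> 0 \<le> \<alpha> j"
  shows "(\<Sum>j\<in>{i \<in> I. 0 < \<alpha> i}. (*\<^sub>R) (\<alpha> j) ` P j) = (\<Sum>j\<in>I. (*\<^sub>R) (\<alpha> j) ` P j)"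
proof (rule sum.mono_neutral_left[OF finI])
  show "\<forall>j\<in>I - {i \<in> I. 0 < \<alpha> i}. (*\<^sub>R) (\<alpha> j) ` P j = 0"
  proof
    fix j assume j: "j \<in> I - {i \<in> I. 0 < \<alpha> i}"
    then have "\<alpha> j = 0" using \<alpha>[of j] by auto
    then show "(*\<^sub>R) (\<alpha> j) ` P j = 0" using ne[of j] j by (auto simp: set_zero)
  qed
qed auto

lemma indecomposable_decomposition_coefficients:
  assumes \<alpha>: "\<And>j. j \<in> I \<Longrightarrow> 0 \<le> \<alpha> j" and R: "R = (+) t ` (\<Sum>j\<in>I. (*\<^sub>R) (\<alpha> j) ` P j)"
  shows "indecomposable_decomposition {i \<in> I. 0 < \<alpha> i} (\<lambda>i. (*\<^sub>R) (\<alpha> i) ` P i) R"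
  unfolding indecomposable_decomposition_def
proof (intro conjI)
  show "\<forall>j\<in>{i \<in> I. 0 < \<alpha> i}. polytope ((*\<^sub>R) (\<alpha> j) ` P j) \<and> 1 \<le> aff_dim ((*\<^sub>R) (\<alpha> j) ` P j) \<and> indecomposable ((*\<^sub>R) (\<alpha> j) ` P j)"
    using pol dim1 indec by (auto simp: aff_dim_dilate intro: polytope_scaling indecomposable_dilate)
  show "\<exists>t. R = (+) t ` (\<Sum>j\<in>{i \<in> I. 0 < \<alpha> i}. (*\<^sub>R) (\<alpha> j) ` P j)" using R sum_support[of \<alpha>] \<alpha> by auto
  show "pairwise (\<lambda>j k. \<not> normally_equivalent ((*\<^sub>R) (\<alpha> j) ` P j) ((*\<^sub>R) (\<alpha> k) ` P k)) {i \<in> I. 0 < \<alpha> i}"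
    using not_normally_equivalent normal_fan_dilate[of _ 0 "P _"] unfolding pairwise_def normally_equivalent_def by auto
qed (use finI in simp)

text \<open>Writing \<open>R\<close> as a sum of dilates, any summand with positive coefficient is a
  deformation of \<open>R\<close>, hence a translated dilate of \<open>R\<close>. Its factor is
  nonzero because the summand is not a point, so the relation can be inverted.\<close>

lemma indecomposable_deformation:
  assumes R: "deformation R S" "1 \<le> aff_dim R" "indecomposable R"
  obtains i l t where "i \<in> I" "0 < l" "R = (+) t ` (*\<^sub>R) l ` P i"
proof -
  obtain \<beta> t where \<beta>: "\<And>i. i \<in> I \<Longrightarrow> 0 \<le> \<beta> i" "R = (+) t ` (\<Sum>i\<in>I. (*\<^sub>R) (\<beta> i) ` P i)"
    using deformation_imp_sum[OF R(1)] by blast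
  have "\<exists>i\<in>I. 0 < \<beta> i"
  proof (rule ccontr)
    assume "\<not> ?thesis"
    then have none: "{i \<in> I. 0 < \<beta> i} = {}" by blast
    have "(\<Sum>i\<in>I. (*\<^sub>R) (\<beta> i) ` P i) = 0"
      using sum_support[of \<beta>] \<beta>(1) unfolding none by simp
    then have "R = {t}" unfolding \<beta>(2) by (simp add: set_zero)
    then show False using R(2) by simp
  qed
  then obtain i where i: "i \<in> I" "0 < \<beta> i" by blast
  define R' where "R' = (+) t ` (\<Sum>j\<in>I - {i}. (*\<^sub>R) (\<beta> j) ` P j)"
  have "polytope R'" unfolding R'_def polytope_translation_eq using pol polytope_scaling by (intro polytope_sum) auto
  moreover have "R = (*\<^sub>R) 1 ` (*\<^sub>R) (\<beta> i) ` P i + R'"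
    unfolding \<beta>(2) R'_def translation_eq_singleton_plus sum.remove[OF finI i(1)] by (simp add: ac_simps)
  moreover have "polytope ((*\<^sub>R) (\<beta> i) ` P i)" using pol[OF i(1)] by (rule polytope_scaling)
  ultimately have "deformation ((*\<^sub>R) (\<beta> i) ` P i) R" unfolding deformation_def using zero_less_one by blast
  then obtain m s where m: "0 \<le> m" "(*\<^sub>R) (\<beta> i) ` P i = (+) s ` (*\<^sub>R) m ` R"
    using R(3) unfolding indecomposable_def by blast
  have "m \<noteq> 0"
  proof
    assume "m = 0"
    then have "(*\<^sub>R) (\<beta> i) ` P i \<subseteq> {s}" using m(2) by auto
    then have "aff_dim ((*\<^sub>R) (\<beta> i) ` P i) \<le> 0" using aff_dim_subset aff_dim_sing by metis
    then show False using aff_dim_dilate[OF i(2), of "P i"] dim1[OF i(1)] by auto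
  qed
  have "R = (+) (- ((1 / m) *\<^sub>R s)) ` (*\<^sub>R) (1 / m) ` ((+) s ` (*\<^sub>R) m ` R)"
    using \<open>m \<noteq> 0\<close> by (simp add: image_image scaleR_add_right)
  also have "\<dots> = (+) (- ((1 / m) *\<^sub>R s)) ` (*\<^sub>R) (\<beta> i / m) ` P i"
    unfolding m(2)[symmetric] by (simp add: image_image)
  finally have "R = (+) (- ((1 / m) *\<^sub>R s)) ` (*\<^sub>R) (\<beta> i / m) ` P i" .
  moreover have "0 < \<beta> i / m" using i(2) m(1) \<open>m \<noteq> 0\<close> by simp
  ultimately show thesis using that[OF i(1)] by blast
qed

text \<open>Each \<open>D j\<close> is a summand of \<open>R\<close>, hence a deformation of
  \<open>S\<close>, hence a translated dilate of some \<open>P i\<close>. Two of them cannot belong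
  to the same \<open>i\<close>, as they would be normally equivalent; uniqueness of the coefficients
  of \<open>R\<close> then identifies the factors.\<close>

lemma indecomposable_decomposition_unique:
  assumes \<alpha>: "\<And>j. j \<in> I \<Longrightarrow> 0 \<le> \<alpha> j" and R: "R = (+) t ` (\<Sum>j\<in>I. (*\<^sub>R) (\<alpha> j) ` P j)"
    and J: "indecomposable_decomposition J D R"
  obtains \<sigma> where "bij_betw \<sigma> J {i \<in> I. 0 < \<alpha> i}" "\<And>j. j \<in> J \<Longrightarrow> \<exists>t. D j = (+) t ` (*\<^sub>R) (\<alpha> (\<sigma> j)) ` P (\<sigma> j)"
proof -
  have finJ: "finite J" and D: "\<And>j. j \<in> J \<Longrightarrow> polytope (D j) \<and> 1 \<le> aff_dim (D j) \<and> indecomposable (D j)"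
    and pw: "pairwise (\<lambda>j k. \<not> normally_equivalent (D j) (D k)) J"
    using J unfolding indecomposable_decomposition_def by auto
  obtain s where s: "R = (+) s ` (\<Sum>j\<in>J. D j)" using J unfolding indecomposable_decomposition_def by blast
  have defR: "deformation R S" unfolding R by (rule deformation_sum[OF \<alpha>])
  have "\<exists>i l t. i \<in> I \<and> 0 < l \<and> D j = (+) t ` (*\<^sub>R) l ` P i" if j: "j \<in> J" for j
  proof -
    have "R = D j + (+) s ` (\<Sum>k\<in>J - {j}. D k)"
      unfolding s sum.remove[OF finJ j] translation_eq_singleton_plus by (simp only: ac_simps)
    moreover have "polytope ((+) s ` (\<Sum>k\<in>J - {j}. D k))"
      unfolding polytope_translation_eq using D by (intro polytope_sum) auto
    ultimately have "deformation (D j) S" using defR D[OF j] deformation_trans_summand by metis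
    then show ?thesis using indecomposable_deformation D[OF j] by metis
  qed
  then obtain \<sigma> l \<tau> where \<sigma>: "\<And>j. j \<in> J \<Longrightarrow> \<sigma> j \<in> I" "\<And>j. j \<in> J \<Longrightarrow> 0 < l j"
    "\<And>j. j \<in> J \<Longrightarrow> D j = (+) (\<tau> j) ` (*\<^sub>R) (l j) ` P (\<sigma> j)" by metis
  have fan: "normal_fan (D j) = normal_fan (P (\<sigma> j))" if "j \<in> J" for j
    using \<sigma>[OF that] normal_fan_dilate by metis
  have inj: "inj_on \<sigma> J"
    using pw fan unfolding pairwise_def normally_equivalent_def inj_on_def by metis
  \<comment> \<open>The factors are extended by 0 to the summands that do not occur, so that they
    can be compared with \<alpha> on all of \<open>I\<close>.\<close>
  define \<beta> where "\<beta> i = (if i \<in> \<sigma> ` J then l (inv_into J \<sigma> i) else 0)" for i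
  have \<beta>\<sigma>: "\<beta> (\<sigma> j) = l j" if "j \<in> J" for j using that inj by (simp add: \<beta>_def)
  have \<beta>0: "0 \<le> \<beta> i" for i
    unfolding \<beta>_def using \<sigma>(2) by (auto intro!: less_imp_le simp: inv_into_into)
  have pos: "0 < \<beta> i \<longleftrightarrow> i \<in> \<sigma> ` J" for i
    using \<beta>\<sigma> \<sigma>(2) by (auto simp: \<beta>_def split: if_splits)
  have "{i \<in> I. 0 < \<beta> i} = \<sigma> ` J" using pos \<sigma>(1) by auto
  then have "(\<Sum>j\<in>I. (*\<^sub>R) (\<beta> j) ` P j) = (\<Sum>i\<in>\<sigma> ` J. (*\<^sub>R) (\<beta> i) ` P i)"
    using sum_support[of \<beta>] \<beta>0 by simp
  also have "\<dots> = (\<Sum>j\<in>J. (*\<^sub>R) (l j) ` P (\<sigma> j))"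
    unfolding sum.reindex[OF inj] comp_def using \<beta>\<sigma> by (intro sum.cong) auto
  finally have sum: "(\<Sum>j\<in>I. (*\<^sub>R) (\<beta> j) ` P j) = (\<Sum>j\<in>J. (*\<^sub>R) (l j) ` P (\<sigma> j))" .
  have "(\<Sum>j\<in>J. D j) = (\<Sum>j\<in>J. (+) (\<tau> j) ` (*\<^sub>R) (l j) ` P (\<sigma> j))" using \<sigma>(3) by (intro sum.cong) auto
  also have "\<dots> = (+) (\<Sum>j\<in>J. \<tau> j) ` (\<Sum>j\<in>I. (*\<^sub>R) (\<beta> j) ` P j)"
    unfolding sum by (rule translation_set_sum[OF finJ])
  finally have R\<beta>: "R = (+) (s + (\<Sum>j\<in>J. \<tau> j)) ` (\<Sum>j\<in>I. (*\<^sub>R) (\<beta> j) ` P j)"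
    unfolding s by (simp add: image_image add.assoc)
  have \<alpha>\<beta>: "\<alpha> i = \<beta> i" if "i \<in> I" for i
    by (rule coefficients_unique[of t \<alpha> "s + (\<Sum>j\<in>J. \<tau> j)" \<beta> i])
      (use R R\<beta> \<alpha> \<beta>0 that in \<open>simp_all only:\<close>)
  have "{i \<in> I. 0 < \<alpha> i} = \<sigma> ` J" using \<alpha>\<beta> pos \<sigma>(1) by auto
  then have "bij_betw \<sigma> J {i \<in> I. 0 < \<alpha> i}" using inj by (simp add: bij_betw_def)
  moreover have "\<exists>t. D j = (+) t ` (*\<^sub>R) (\<alpha> (\<sigma> j)) ` P (\<sigma> j)" if "j \<in> J" for j
    using \<sigma>[OF that] \<alpha>\<beta> \<beta>\<sigma>[OF that] by metis
  ultimately show thesis using that by blast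
qed

end

theorem corollary4p3p3:
  fixes P :: "nat \<Rightarrow> 'a::euclidean_space set" and r :: nat
  assumes "\<And>i. i \<in> {1..r} \<Longrightarrow> polytope (P i)"
    and "\<And>i. i \<in> {1..r} \<Longrightarrow> 1 \<le> aff_dim (P i)"
    and "\<And>i. i \<in> {1..r} \<Longrightarrow> indecomposable (P i)"
    and "parallelogramic_position {1..r} P"
    and "2 \<le> r \<Longrightarrow> 2 \<le> aff_dim (\<Sum>i\<in>{1..r}. P i)"
  shows "edge_decomposable (\<Sum>i\<in>{1..r}. P i)
    \<and> uniquely_decomposable (\<Sum>i\<in>{1..r}. P i)
    \<and> simplicial_cone (deformation_cone (\<Sum>i\<in>{1..r}. P i))
    \<and> dim (deformation_cone (\<Sum>i\<in>{1..r}. P i)) = r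
    \<and> bij_betw (\<lambda>i. deformation_ray (\<Sum>i\<in>{1..r}. P i) (P i)) {1..r}
        (rays (deformation_cone (\<Sum>i\<in>{1..r}. P i)))
    \<and> (\<forall>R. deformation R (\<Sum>i\<in>{1..r}. P i) \<longrightarrow>
        (\<exists>\<alpha>. (\<forall>i\<in>{1..r}. 0 \<le> \<alpha> i)
          \<and> (\<exists>t. R = (+) t ` (\<Sum>i\<in>{1..r}. (*\<^sub>R) (\<alpha> i) ` P i))
          \<and> (\<forall>\<beta>. (\<forall>i\<in>{1..r}. 0 \<le> \<beta> i)
                \<and> (\<exists>t. R = (+) t ` (\<Sum>i\<in>{1..r}. (*\<^sub>R) (\<beta> i) ` P i))
                \<longrightarrow> (\<forall>i\<in>{1..r}. \<beta> i = \<alpha> i))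
          \<and> indecomposable_decomposition {i \<in> {1..r}. 0 < \<alpha> i} (\<lambda>i. (*\<^sub>R) (\<alpha> i) ` P i) R
          \<and> (\<forall>J Q. indecomposable_decomposition J Q R \<longrightarrow>
                (\<exists>\<sigma>. bij_betw \<sigma> J {i \<in> {1..r}. 0 < \<alpha> i}
                  \<and> (\<forall>j\<in>J. \<exists>t. Q j = (+) t ` (*\<^sub>R) (\<alpha> (\<sigma> j)) ` P (\<sigma> j))))))"
proof -
  interpret parallelogramic_family "{1..r}" P
    using assms by unfold_locales simp_all
  have "\<exists>\<alpha>. (\<forall>i\<in>{1..r}. 0 \<le> \<alpha> i)
          \<and> (\<exists>t. R = (+) t ` (\<Sum>i\<in>{1..r}. (*\<^sub>R) (\<alpha> i) ` P i))
          \<and> (\<forall>\<beta>. (\<forall>i\<in>{1..r}. 0 \<le> \<beta> i)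
                \<and> (\<exists>t. R = (+) t ` (\<Sum>i\<in>{1..r}. (*\<^sub>R) (\<beta> i) ` P i))
                \<longrightarrow> (\<forall>i\<in>{1..r}. \<beta> i = \<alpha> i))
          \<and> indecomposable_decomposition {i \<in> {1..r}. 0 < \<alpha> i} (\<lambda>i. (*\<^sub>R) (\<alpha> i) ` P i) R
          \<and> (\<forall>J Q. indecomposable_decomposition J Q R \<longrightarrow>
                (\<exists>\<sigma>. bij_betw \<sigma> J {i \<in> {1..r}. 0 < \<alpha> i}
                  \<and> (\<forall>j\<in>J. \<exists>t. Q j = (+) t ` (*\<^sub>R) (\<alpha> (\<sigma> j)) ` P (\<sigma> j))))"
    if R: "deformation R S" for R
  proof -
    obtain \<alpha> t where \<alpha>: "\<And>i. i \<in> {1..r} \<Longrightarrow> 0 \<le> \<alpha> i" "R = (+) t ` (\<Sum>i\<in>{1..r}. (*\<^sub>R) (\<alpha> i) ` P i)"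
      using deformation_imp_sum[OF R] by blast
    show ?thesis
    proof (intro exI[of _ \<alpha>] conjI allI impI)
      show "\<forall>i\<in>{1..r}. 0 \<le> \<alpha> i" "\<exists>t. R = (+) t ` (\<Sum>i\<in>{1..r}. (*\<^sub>R) (\<alpha> i) ` P i)" using \<alpha> by auto
      show "\<forall>i\<in>{1..r}. \<beta> i = \<alpha> i"
        if "(\<forall>i\<in>{1..r}. 0 \<le> \<beta> i) \<and> (\<exists>t. R = (+) t ` (\<Sum>i\<in>{1..r}. (*\<^sub>R) (\<beta> i) ` P i))" for \<beta>
        using that coefficients_unique[of _ \<beta> t \<alpha>] \<alpha> by metis
      show "indecomposable_decomposition {i \<in> {1..r}. 0 < \<alpha> i} (\<lambda>i. (*\<^sub>R) (\<alpha> i) ` P i) R"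
        by (rule indecomposable_decomposition_coefficients[OF \<alpha>])
      show "\<exists>\<sigma>. bij_betw \<sigma> J {i \<in> {1..r}. 0 < \<alpha> i} \<and> (\<forall>j\<in>J. \<exists>t. Q j = (+) t ` (*\<^sub>R) (\<alpha> (\<sigma> j)) ` P (\<sigma> j))"
        if "indecomposable_decomposition J Q R" for J Q
        using indecomposable_decomposition_unique[OF \<alpha> that] by metis
    qed
  qed
  moreover have "bij_betw (\<lambda>i. deformation_ray S (P i)) {1..r} (rays (deformation_cone S))"
    unfolding deformation_ray_def deformation_cone bij_betw_def using cone.rays cone.inj_rays by simp
  moreover have "dim (deformation_cone S) = r" unfolding deformation_cone using cone.dim by simp
  ultimately show ?thesis
    using edge_decomposable cone.simplicial unfolding uniquely_decomposable_def S_def[symmetric] deformation_cone by blast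
qed

end
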